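(* Let $w\in C^2([-2,2])$, $\eta>0$, $\mu>0$, $\gamma>0$, $f_r,f_p\in L^2(-1,1)$ and $0<\beta\le\alpha\le2\beta$. Then the functional $$\begin{aligned}F_1(v_r,v_p)=\;&\alpha\,\sharp(S_{v_r})+\beta\,\sharp(S_{\dot v_r}\setminus S_{v_r})+\int_{-1}^1\big(\eta|\ddot v_r|^2-f_rv_r\big)\,dx\\&+\mu\int_{-1}^1|v_r-v_p|^2\,dx+\int_{-1}^1\big(\gamma|v_p''|^2-f_pv_p\big)\,dx\end{aligned}$$ achieves a finite minimum over the pairs $(v_r,v_p)\in\mathbf{H}^2(-2,2)\times H^2(-2,2)$ such that $v_r=v_p=w$ in $(-2,-1)\cup(1,2)$.
   Context: $H^2$ is the usual Sobolev space. $\mathbf{H}^2(-2,2)$ is the set of functions $v:(-2,2)\to\mathbb{R}$ that are piecewise $H^2$, i.e. made of finitely many $H^2$ pieces: there is a finite partition $-2=s_0<\dots<s_n=2$ with $v\in H^2(s_{i-1},s_i)$ for each $i$. $\dot v$ is the absolutely continuous part of the distributional derivative $v'$, $\ddot v$ is the absolutely continuous part of $(\dot v)'$; $S_v$ and $S_{\dot v}$ are the sets of discontinuity points of $v$ and $\dot v$ in $(-2,2)$ (possibly including the points $\pm1$); $\sharp$ is the counting measure. *)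

theory Defs
  imports "HOL-Analysis.Analysis"
begin

text \<open>
  Elements of Lebesgue and Sobolev spaces over an open interval are represented by functions
  on the whole real line. Their values off the interval, and on null sets, are irrelevant: all
  notions below are invariant under changing a function almost everywhere on the interval.
\<close>

definition C2_on :: "real set \<Rightarrow> (real \<Rightarrow> real) \<Rightarrow> bool" where
  "C2_on A w \<longleftrightarrow> (\<exists>w' w''.
     (\<forall>x\<in>A. (w has_real_derivative w' x) (at x within A)) \<and>
     (\<forall>x\<in>A. (w' has_real_derivative w'' x) (at x within A)) \<and>
     continuous_on A w'')"

definition L2 :: "real \<Rightarrow> real \<Rightarrow> (real \<Rightarrow> real) set" where
  "L2 a b = {f. set_borel_measurable lebesgue {a<..<b} f \<and>
                set_integrable lebesgue {a<..<b} (\<lambda>x. (f x)\<^sup>2)}"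

definition locally_integrable :: "real \<Rightarrow> real \<Rightarrow> (real \<Rightarrow> real) \<Rightarrow> bool" where
  "locally_integrable a b f \<longleftrightarrow>
     (\<forall>K. compact K \<longrightarrow> K \<subseteq> {a<..<b} \<longrightarrow> set_integrable lebesgue K f)"

text \<open>The test functions on \<open>(a,b)\<close>, extended by zero to the real line.\<close>

definition test_fun :: "real \<Rightarrow> real \<Rightarrow> (real \<Rightarrow> real) \<Rightarrow> bool" where
  "test_fun a b \<phi> \<longleftrightarrow>
     (\<forall>k x. (deriv ^^ k) \<phi> field_differentiable (at x)) \<and>
     (\<exists>K. compact K \<and> K \<subseteq> {a<..<b} \<and> (\<forall>x. x \<notin> K \<longrightarrow> \<phi> x = 0))"

definition has_weak_deriv ::
    "nat \<Rightarrow> real \<Rightarrow> real \<Rightarrow> (real \<Rightarrow> real) \<Rightarrow> (real \<Rightarrow> real) \<Rightarrow> bool" where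
  "has_weak_deriv k a b v u \<longleftrightarrow>
     locally_integrable a b v \<and> locally_integrable a b u \<and>
     (\<forall>\<phi>. test_fun a b \<phi> \<longrightarrow>
        (LINT x:{a<..<b}|lebesgue. v x * (deriv ^^ k) \<phi> x) =
        (-1) ^ k * (LINT x:{a<..<b}|lebesgue. u x * \<phi> x))"

definition weak_deriv :: "nat \<Rightarrow> real \<Rightarrow> real \<Rightarrow> (real \<Rightarrow> real) \<Rightarrow> real \<Rightarrow> real" where
  "weak_deriv k a b v = (SOME u. has_weak_deriv k a b v u)"

text \<open>The Sobolev space \<open>H\<^sup>m(a,b)\<close>.\<close>

definition Sobolev_H :: "nat \<Rightarrow> real \<Rightarrow> real \<Rightarrow> (real \<Rightarrow> real) set" where
  "Sobolev_H m a b =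
     {v. v \<in> L2 a b \<and> (\<forall>k\<in>{1..m}. \<exists>u\<in>L2 a b. has_weak_deriv k a b v u)}"

definition piecewise_H2 :: "real \<Rightarrow> real \<Rightarrow> (real \<Rightarrow> real) set" where
  "piecewise_H2 a b =
     {v. \<exists>(n::nat) s. s 0 = a \<and> s n = b \<and>
           (\<forall>i<n. s i < s (Suc i) \<and> v \<in> Sobolev_H 2 (s i) (s (Suc i)))}"

text \<open>
  The distributional derivative of \<open>v\<close> on \<open>(a,b)\<close> is a finite signed measure with Lebesgue
  decomposition \<open>u dx + (\<nu> - \<nu>')\<close>, where the finite positive measures \<open>\<nu>\<close> and \<open>\<nu>'\<close> are
  concentrated on a Lebesgue null set \<open>N\<close>. The density \<open>u\<close> is unique almost everywhere on
  \<open>(a,b)\<close>.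
\<close>

definition has_ac_deriv ::
    "real \<Rightarrow> real \<Rightarrow> (real \<Rightarrow> real) \<Rightarrow> (real \<Rightarrow> real) \<Rightarrow> bool" where
  "has_ac_deriv a b v u \<longleftrightarrow>
     locally_integrable a b v \<and> set_integrable lebesgue {a<..<b} u \<and>
     (\<exists>\<nu> \<nu>' N. finite_measure \<nu> \<and> finite_measure \<nu>' \<and>
        sets \<nu> = sets borel \<and> sets \<nu>' = sets borel \<and>
        N \<in> null_sets lborel \<and> - N \<in> null_sets \<nu> \<and> - N \<in> null_sets \<nu>' \<and>
        (\<forall>\<phi>. test_fun a b \<phi> \<longrightarrow>
           - (LINT x:{a<..<b}|lebesgue. v x * deriv \<phi> x) =
           (LINT x:{a<..<b}|lebesgue. u x * \<phi> x) +
           (LINT x|\<nu>. \<phi> x) - (LINT x|\<nu>'. \<phi> x)))"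

definition ac_deriv :: "real \<Rightarrow> real \<Rightarrow> (real \<Rightarrow> real) \<Rightarrow> real \<Rightarrow> real" where
  "ac_deriv a b v = (SOME u. has_ac_deriv a b v u)"

text \<open>
  As \<open>v\<close> stands for its class modulo equality almost everywhere, it is continuous at a point
  if some representative of the class is.
\<close>

definition disc_set :: "real \<Rightarrow> real \<Rightarrow> (real \<Rightarrow> real) \<Rightarrow> real set" where
  "disc_set a b v =
     {x \<in> {a<..<b}. \<not> (\<exists>g. (AE y in lebesgue. y \<in> {a<..<b} \<longrightarrow> g y = v y) \<and> isCont g x)}"

abbreviation counting_measure :: "real set \<Rightarrow> ereal" where
  "counting_measure A \<equiv> enn2ereal (emeasure (count_space UNIV) A)"

definition F1 ::
    "real \<Rightarrow> real \<Rightarrow> real \<Rightarrow> real \<Rightarrow> real \<Rightarrow> (real \<Rightarrow> real) \<Rightarrow> (real \<Rightarrow> real) \<Rightarrow>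
     (real \<Rightarrow> real) \<Rightarrow> (real \<Rightarrow> real) \<Rightarrow> ereal" where
  "F1 \<alpha> \<beta> \<eta> \<mu> \<gamma> f\<^sub>r f\<^sub>p v\<^sub>r v\<^sub>p =
     (let Dv\<^sub>r = ac_deriv (-2) 2 v\<^sub>r;
          DDv\<^sub>r = ac_deriv (-2) 2 Dv\<^sub>r;
          v\<^sub>p'' = weak_deriv 2 (-2) 2 v\<^sub>p
      in ereal \<alpha> * counting_measure (disc_set (-2) 2 v\<^sub>r)
         + ereal \<beta> * counting_measure (disc_set (-2) 2 Dv\<^sub>r - disc_set (-2) 2 v\<^sub>r)
         + ereal (LINT x:{-1<..<1}|lebesgue. \<eta> * \<bar>DDv\<^sub>r x\<bar>\<^sup>2 - f\<^sub>r x * v\<^sub>r x)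
         + ereal (\<mu> * (LINT x:{-1<..<1}|lebesgue. \<bar>v\<^sub>r x - v\<^sub>p x\<bar>\<^sup>2))
         + ereal (LINT x:{-1<..<1}|lebesgue. \<gamma> * \<bar>v\<^sub>p'' x\<bar>\<^sup>2 - f\<^sub>p x * v\<^sub>p x))"

definition admissible :: "(real \<Rightarrow> real) \<Rightarrow> ((real \<Rightarrow> real) \<times> (real \<Rightarrow> real)) set" where
  "admissible w =
     {(v\<^sub>r, v\<^sub>p). v\<^sub>r \<in> piecewise_H2 (-2) 2 \<and> v\<^sub>p \<in> Sobolev_H 2 (-2) 2 \<and>
        (AE x in lebesgue. x \<in> {-2<..<-1} \<union> {1<..<2} \<longrightarrow> v\<^sub>r x = w x \<and> v\<^sub>p x = w x)}"

end

theory Submission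
  imports Defs "HOL-Complex_Analysis.Great_Picard"
begin

text \<open>
  Up to null sets, a piecewise \<open>H\<^sup>2\<close> function on \<open>(-2,2)\<close> is the double primitive of a
  square-integrable function plus finitely many jumps and creases, that is, terms
  \<open>a\<^sub>i + b\<^sub>i (x - t\<^sub>i)\<close> switched on at \<open>t\<^sub>i\<close>. Since the density of the absolutely continuous part of a
  measure is determined by its integrals over intervals, the derivatives and discontinuity sets in
  the functional can be read off from this form.

  Along a minimizing sequence the second derivatives are bounded in \<open>L\<^sup>2\<close> and there is a bounded number
  of singular points. For a subsequence the double primitives converge pointwise, with a lower
  semicontinuous \<open>L\<^sup>2\<close> norm of the second derivatives, and the singular points converge. Points with a
  common limit are merged into one, which does not raise the cost because \<open>\<alpha> \<le> 2 \<beta>\<close>. The limits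
  being distinct now, the coefficients \<open>a\<^sub>i\<close>, \<open>b\<^sub>i\<close> converge as well, and their cost is lower
  semicontinuous because \<open>\<beta> \<le> \<alpha>\<close>. The fidelity term is treated by Fatou's lemma.
\<close>

subsection \<open>Smooth bump functions\<close>

text \<open>Nothing bounds the size of a jump or crease, since only its presence is paid for, and
  the load on \<open>v\<^sub>r\<close> is linear in a function that may be large between two jumps.
  Completing the square in the fidelity term moves the load \<open>f\<^sub>r\<close> onto
  \<open>v\<^sub>p\<close>, at the price of a constant. As \<open>v\<^sub>p\<close> has no jumps and
  equals \<open>w\<close> on (-2,-1), its initial value and slope are known; it is then bounded by
  the L1 norm of its second derivative, and the bending term absorbs the load. An L2 bound on the
  sum of the jump and crease terms follows from the fidelity term inside (-1,1) and from the
  prescribed values outside. Colliding points are the second obstacle: as in a difference quotient,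
  their coefficients can blow up while the sum of the terms stays bounded, so coefficients need not
  converge before merging.\<close>

definition smooth :: "(real \<Rightarrow> real) \<Rightarrow> bool" where
  "smooth f \<longleftrightarrow> (\<forall>k x. (deriv ^^ k) f field_differentiable (at x))"

text \<open>Coinduction spares formulas for higher derivatives: it suffices to exhibit a class of
  functions that contains \<open>f\<close> and is closed under \<open>deriv\<close>.\<close>

lemma smooth_coinduct:
  assumes "f \<in> P" and step: "\<And>f. f \<in> P \<Longrightarrow> (\<forall>x. f field_differentiable (at x)) \<and> deriv f \<in> P"
  shows "smooth f"
proof -
  have "(deriv ^^ k) f \<in> P" for k
    by (induction k) (use assms in auto)
  then show ?thesis
    using step by (auto simp: smooth_def)
qed

lemma smooth_DERIV: "smooth f \<Longrightarrow> (f has_real_derivative deriv f x) (at x)"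
  unfolding smooth_def by (metis field_differentiable_derivI funpow_0)

lemma smooth_deriv: "smooth f \<Longrightarrow> smooth (deriv f)"
  unfolding smooth_def by (metis comp_apply funpow_Suc_right)

lemma smoothI_DERIV:
  assumes "\<And>x. (f has_real_derivative f' x) (at x)" "smooth f'"
  shows "smooth f"
proof -
  have d: "deriv f = f'"
    using assms(1) by (auto intro!: DERIV_imp_deriv)
  have "(deriv ^^ k) f field_differentiable (at x)" for k x
    using assms d
    by (cases k) (auto simp: smooth_def funpow_Suc_right field_differentiable_def
        simp del: funpow.simps)
  then show ?thesis by (simp add: smooth_def)
qed

lemma smooth_lincomb:
  assumes "smooth f" "smooth g"
  shows "smooth (\<lambda>x. a * f x + b * g x)"
proof (rule smooth_coinduct)
  let ?P = "{\<lambda>x. a * f x + b * g x |f g. smooth f \<and> smooth g}"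
  show "(\<lambda>x. a * f x + b * g x) \<in> ?P" using assms by blast
  fix h assume "h \<in> ?P"
  then obtain f g where h: "h = (\<lambda>x. a * f x + b * g x)" and fg: "smooth f" "smooth g" by blast
  have d: "(h has_real_derivative a * deriv f x + b * deriv g x) (at x)" for x
    unfolding h by (auto intro!: derivative_eq_intros smooth_DERIV fg)
  then have "deriv h = (\<lambda>x. a * deriv f x + b * deriv g x)"
    by (auto intro!: DERIV_imp_deriv)
  then show "(\<forall>x. h field_differentiable (at x)) \<and> deriv h \<in> ?P"
    using d fg smooth_deriv by (auto simp: field_differentiable_def)
qed

text \<open>The derivatives of \<open>exp (- 1/x)\<close>, extended by zero, all have this form.\<close>

definition flat :: "real poly \<Rightarrow> real \<Rightarrow> real" where
  "flat p x = (if x > 0 then poly p (1/x) * exp (- (1/x)) else 0)"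

lemma poly_exp_tendsto_0: "((\<lambda>y::real. poly p y * exp (- y)) \<longlongrightarrow> 0) at_top"
proof -
  have "((\<lambda>y::real. \<Sum>i\<le>degree p. coeff p i * (y ^ i / exp y)) \<longlongrightarrow> (\<Sum>i\<le>degree p. coeff p i * 0)) at_top"
    by (intro tendsto_sum tendsto_mult tendsto_const tendsto_power_div_exp_0)
  then show ?thesis
    by (simp add: poly_altdef sum_distrib_right exp_minus divide_inverse mult.assoc)
qed

text \<open>With \<open>y = 1/x\<close>, the derivative of \<open>poly p y * exp (- y)\<close> in
  \<open>x\<close> is \<open>y\<^sup>2 * poly (p - pderiv p) y * exp (- y)\<close>, which has the
  same form; \<open>[:0,0,1:]\<close> is the factor \<open>y\<^sup>2\<close>.\<close>

lemma flat_DERIV: "(flat p has_real_derivative flat ([:0,0,1:] * (p - pderiv p)) x) (at x)"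
proof -
  let ?q = "[:0,0,1:] * (p - pderiv p)"
  consider "x < 0" | "x = 0" | "x > 0" by linarith
  then show ?thesis
  proof cases
    case 1
    have "((\<lambda>_. 0) has_real_derivative 0) (at x)" by simp
    then have "(flat p has_real_derivative 0) (at x)"
      by (rule has_field_derivative_transform_within_open[where S = "{..<0}"])
         (use 1 in \<open>auto simp: flat_def\<close>)
    then show ?thesis using 1 by (simp add: flat_def)
  next
    case 3
    have "((\<lambda>x. poly p (1/x) * exp (- (1/x))) has_real_derivative flat ?q x) (at x)"
      using 3 by (auto intro!: derivative_eq_intros poly_DERIV[THEN DERIV_chain2]
          simp: flat_def field_simps power2_eq_square)
    then show ?thesis
      by (rule has_field_derivative_transform_within_open[where S = "{0<..}"])
         (use 3 in \<open>auto simp: flat_def\<close>)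
  next
    case 2
    \<comment> \<open>At 0 the difference quotient is \<open>poly p y * exp (- y)\<close> times
      \<open>y = 1/h\<close>, hence the extra factor \<open>[:0,1:]\<close>; the exponential beats
      every polynomial.\<close>
    have "((\<lambda>y. poly ([:0,1:] * p) y * exp (- y)) \<longlongrightarrow> 0) at_top"
      by (rule poly_exp_tendsto_0)
    then have "((\<lambda>h. poly ([:0,1:] * p) (inverse h) * exp (- inverse h)) \<longlongrightarrow> 0) (at_right 0)"
      by (rule filterlim_compose[OF _ filterlim_inverse_at_top_right])
    moreover have "eventually (\<lambda>h::real. h > 0) (at_right 0)"
      by (rule eventually_at_right_less)
    ultimately have R: "((\<lambda>h. flat p h / h) \<longlongrightarrow> 0) (at_right 0)"
      by (rule Lim_transform_eventually[OF _ eventually_mono])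
         (auto simp: flat_def field_simps)
    have L: "((\<lambda>h. flat p h / h) \<longlongrightarrow> 0) (at_left 0)"
      by (rule Lim_transform_eventually[OF tendsto_const eventually_mono[where P = "\<lambda>h. h < 0"]])
         (auto simp: flat_def eventually_at_filter)
    have "((\<lambda>h. flat p h / h) \<longlongrightarrow> 0) (at 0)"
      using L R by (rule filterlim_split_at)
    then show ?thesis
      using 2 by (simp add: DERIV_def flat_def)
  qed
qed

lemma flat_smult: "flat (smult c p) x = c * flat p x"
  by (simp add: flat_def)

text \<open>Bumps are products of two flat functions with affine arguments, and Leibniz' rule turns
  one product into a sum of two. Closing under sums yields a class stable under differentiation; the
  inner slopes \<open>k\<close> and \<open>m\<close> are absorbed into the polynomials by
  \<open>smult\<close>.\<close>

inductive_set flat_products :: "real \<Rightarrow> real \<Rightarrow> real \<Rightarrow> real \<Rightarrow> (real \<Rightarrow> real) set"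
  for k l m n :: real where
  flat_prod: "(\<lambda>x. flat p (k * x + l) * flat q (m * x + n)) \<in> flat_products k l m n"
| flat_add: "f \<in> flat_products k l m n \<Longrightarrow> g \<in> flat_products k l m n \<Longrightarrow>
    (\<lambda>x. f x + g x) \<in> flat_products k l m n"

lemma flat_products_smooth:
  assumes "f \<in> flat_products k l m n"
  shows "smooth f"
proof (rule smooth_coinduct[OF assms])
  fix f assume "f \<in> flat_products k l m n"
  then have "\<exists>f'\<in>flat_products k l m n. \<forall>x. (f has_real_derivative f' x) (at x)"
  proof induction
    case (flat_prod p q)
    let ?D = "\<lambda>p. [:0,0,1:] * (p - pderiv p)"
    let ?f' = "\<lambda>x. flat (smult k (?D p)) (k * x + l) * flat q (m * x + n)
        + flat p (k * x + l) * flat (smult m (?D q)) (m * x + n)"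
    have "((\<lambda>x. flat p (k * x + l) * flat q (m * x + n)) has_real_derivative ?f' x) (at x)" for x
      by (auto intro!: derivative_eq_intros flat_DERIV[THEN DERIV_chain2]
          simp: flat_smult simp del: mult_pCons_left)
    moreover have "?f' \<in> flat_products k l m n"
      by (intro flat_products.intros)
    ultimately show ?case by (intro bexI[of _ ?f'] allI)
  next
    case (flat_add f g)
    then obtain f' g' where *: "f' \<in> flat_products k l m n" "g' \<in> flat_products k l m n"
      "\<And>x. (f has_real_derivative f' x) (at x)" "\<And>x. (g has_real_derivative g' x) (at x)"
      by blast
    then have "(\<lambda>x. f' x + g' x) \<in> flat_products k l m n"
      "\<And>x. ((\<lambda>x. f x + g x) has_real_derivative f' x + g' x) (at x)"
      by (auto intro!: flat_products.intros derivative_intros)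
    then show ?case
      by (intro bexI[of _ "\<lambda>x. f' x + g' x"] allI)
  qed
  then obtain f' where "f'\<in>flat_products k l m n" "\<And>x. (f has_real_derivative f' x) (at x)"
    by blast
  moreover from this have "deriv f = f'"
    by (auto intro!: DERIV_imp_deriv)
  ultimately show "(\<forall>x. f field_differentiable (at x)) \<and> deriv f \<in> flat_products k l m n"
    by (auto simp: field_differentiable_def)
qed

text \<open>The shift by 1 makes the function vanish outside \<open>[c + 1/n, d - 1/n]\<close>, a
  compact part of the open interval, while the pointwise limit in \<open>n\<close> is the indicator
  of \<open>(c,d)\<close>. For \<open>n = 0\<close> it is the zero function.\<close>

definition bump :: "real \<Rightarrow> real \<Rightarrow> nat \<Rightarrow> real \<Rightarrow> real" where
  "bump c d n x = flat 1 (real n * (x - c) - 1) * flat 1 (real n * (d - x) - 1)"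

lemma flat_1_bounds: "0 \<le> flat 1 x" "flat 1 x \<le> 1"
  by (auto simp: flat_def)

lemma bump_bounds: "0 \<le> bump c d n x" "bump c d n x \<le> 1"
  using flat_1_bounds by (auto simp: bump_def intro!: mult_le_one)

lemma bump_smooth: "smooth (bump c d n)"
proof -
  have "(\<lambda>x. flat 1 (real n * x + (- real n * c - 1)) * flat 1 ((- real n) * x + (real n * d - 1)))
      \<in> flat_products (real n) (- real n * c - 1) (- real n) (real n * d - 1)"
    by (rule flat_prod)
  also have "(\<lambda>x. flat 1 (real n * x + (- real n * c - 1)) * flat 1 ((- real n) * x + (real n * d - 1)))
      = bump c d n"
    by (auto simp: bump_def algebra_simps)
  finally show ?thesis by (rule flat_products_smooth)
qed

lemma test_fun_iff: "test_fun a b \<phi> \<longleftrightarrow> smooth \<phi> \<and>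
     (\<exists>K. compact K \<and> K \<subseteq> {a<..<b} \<and> (\<forall>x. x \<notin> K \<longrightarrow> \<phi> x = 0))"
  by (simp add: test_fun_def smooth_def)

lemma test_fun_bump: "test_fun c d (bump c d n)"
proof -
  have "bump c d n x = 0" if "n = 0 \<or> x \<notin> {c + 1/n .. d - 1/n}" for x
  proof (cases "n = 0")
    case False
    then have "real n * (x - c) < 1 \<or> real n * (d - x) < 1"
      using that by (auto simp: field_simps not_le)
    then show ?thesis by (auto simp: bump_def flat_def)
  next
    case True
    then show ?thesis by (simp add: bump_def flat_def)
  qed
  moreover have "{c + 1/n .. d - 1/n} \<subseteq> {c<..<d}" if "n \<noteq> 0"
  proof -
    have "1 / real n > 0" using that by simp
    then show ?thesis by (auto simp del: zero_less_divide_iff zero_less_divide_1_iff)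
  qed
  ultimately show ?thesis
    unfolding test_fun_iff
    by (intro conjI bump_smooth exI[of _ "if n = 0 then {} else {c + 1/n .. d - 1/n}"]) auto
qed

lemma test_fun_mono: "test_fun c d \<phi> \<Longrightarrow> a \<le> c \<Longrightarrow> d \<le> b \<Longrightarrow> test_fun a b \<phi>"
  unfolding test_fun_def by (meson greaterThanLessThan_subseteq_greaterThanLessThan order_trans)

lemma flat_1_tendsto:
  assumes "x > 0"
  shows "(\<lambda>n. flat 1 (real n * x - 1)) \<longlonglongrightarrow> 1"
proof -
  have top: "filterlim (\<lambda>n. real n * x - 1) at_top sequentially"
    using assms by real_asymp
  then have "(\<lambda>n. inverse (real n * x - 1)) \<longlonglongrightarrow> 0"
    by (rule tendsto_inverse_0_at_top)
  then have "(\<lambda>n. exp (- inverse (real n * x - 1))) \<longlonglongrightarrow> exp (- 0)"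
    by (intro tendsto_intros)
  moreover have "eventually (\<lambda>n. real n * x - 1 > 0) sequentially"
    using top unfolding filterlim_at_top_dense by blast
  then have "eventually (\<lambda>n. exp (- inverse (real n * x - 1)) = flat 1 (real n * x - 1)) sequentially"
    by (rule eventually_mono) (auto simp: flat_def divide_inverse)
  ultimately show ?thesis
    by (auto dest: Lim_transform_eventually)
qed

lemma bump_tendsto: "(\<lambda>n. bump c d n x) \<longlonglongrightarrow> indicator {c<..<d} x"
proof (cases "c < x \<and> x < d")
  case True
  then have "(\<lambda>n. bump c d n x) \<longlonglongrightarrow> 1 * 1"
    unfolding bump_def by (intro tendsto_mult flat_1_tendsto) auto
  then show ?thesis using True by simp
next
  case False
  have "bump c d n x = 0" for n
  proof -
    have "real n * (x - c) \<le> 0 \<or> real n * (d - x) \<le> 0"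
      using False by (auto simp: mult_le_0_iff)
    then show ?thesis by (auto simp: bump_def flat_def)
  qed
  then show ?thesis using False by simp
qed

lemma test_fun_zero: "test_fun a b \<phi> \<Longrightarrow> x \<notin> {a<..<b} \<Longrightarrow> \<phi> x = 0"
  unfolding test_fun_iff by blast

lemma test_fun_DERIV: "test_fun a b \<phi> \<Longrightarrow> (\<phi> has_real_derivative deriv \<phi> x) (at x)"
  by (simp add: test_fun_iff smooth_DERIV)

lemma test_fun_support:
  assumes "test_fun a b \<phi>" "a < b"
  obtains c d where "a < c" "c < d" "d < b" "\<And>x. x \<notin> {c<..<d} \<Longrightarrow> \<phi> x = 0"
proof -
  obtain K where K: "compact K" "K \<subseteq> {a<..<b}" "\<And>x. x \<notin> K \<Longrightarrow> \<phi> x = 0"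
    using assms by (auto simp: test_fun_iff)
  show thesis
  proof (cases "K = {}")
    case True
    obtain c where "a < c" "c < b" using dense[OF assms(2)] by blast
    moreover obtain d where "c < d" "d < b" using dense[OF \<open>c < b\<close>] by blast
    ultimately show thesis using that[of c d] K(3) True by simp
  next
    case False
    obtain c where c: "c \<in> K" "\<And>x. x \<in> K \<Longrightarrow> c \<le> x"
      using compact_attains_inf[OF K(1) False] by auto
    obtain d where d: "d \<in> K" "\<And>x. x \<in> K \<Longrightarrow> x \<le> d"
      using compact_attains_sup[OF K(1) False] by auto
    have cd: "a < c" "d < b" "c \<le> d" using c d K(2) by auto
    obtain c' where c': "a < c'" "c' < c" using dense[OF cd(1)] by blast
    obtain d' where d': "d < d'" "d' < b" using dense[OF cd(2)] by blast
    show thesis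
      by (rule that[of c' d']) (use c' d' cd c(2) d(2) K(3) in \<open>force\<close>)+
  qed
qed

lemma test_fun_deriv:
  assumes "test_fun a b \<phi>" shows "test_fun a b (deriv \<phi>)"
proof -
  obtain K where K: "compact K" "K \<subseteq> {a<..<b}" "\<And>x. x \<notin> K \<Longrightarrow> \<phi> x = 0"
    using assms by (auto simp: test_fun_iff)
  have "deriv \<phi> x = 0" if "x \<notin> K" for x
  proof -
    have "((\<lambda>_. 0) has_real_derivative 0) (at x)" by simp
    then have "(\<phi> has_real_derivative 0) (at x)"
      by (rule has_field_derivative_transform_within_open[where S = "- K"])
         (use that K compact_imp_closed in auto)
    then show ?thesis by (rule DERIV_imp_deriv)
  qed
  then show ?thesis
    using K assms by (auto simp: test_fun_iff smooth_deriv)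
qed

lemma test_fun_continuous: "test_fun a b \<phi> \<Longrightarrow> continuous_on A \<phi>"
  by (meson DERIV_isCont continuous_at_imp_continuous_on test_fun_DERIV)

lemma test_fun_bounded:
  assumes "test_fun a b \<phi>" obtains B where "B \<ge> 0" "\<And>x. \<bar>\<phi> x\<bar> \<le> B"
proof -
  obtain K where K: "compact K" "K \<subseteq> {a<..<b}" "\<And>x. x \<notin> K \<Longrightarrow> \<phi> x = 0"
    using assms by (auto simp: test_fun_iff)
  have "bounded (\<phi> ` K)"
    by (intro compact_imp_bounded compact_continuous_image test_fun_continuous[OF assms] K)
  then obtain B where B: "\<And>x. x \<in> K \<Longrightarrow> \<bar>\<phi> x\<bar> \<le> B"
    by (auto simp: bounded_iff)
  show thesis
    by (rule that[of "max B 0"]) (use B K(3) in \<open>fastforce simp: le_max_iff_disj\<close>)+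
qed

lemma test_fun_lincomb:
  assumes "test_fun a b \<phi>" "test_fun a b \<psi>" shows "test_fun a b (\<lambda>x. r * \<phi> x + s * \<psi> x)"
proof -
  obtain K where K: "compact K" "K \<subseteq> {a<..<b}" "\<And>x. x \<notin> K \<Longrightarrow> \<phi> x = 0"
    using assms by (auto simp: test_fun_iff)
  obtain L where L: "compact L" "L \<subseteq> {a<..<b}" "\<And>x. x \<notin> L \<Longrightarrow> \<psi> x = 0"
    using assms by (auto simp: test_fun_iff)
  show ?thesis
    unfolding test_fun_iff
    by (intro conjI smooth_lincomb exI[of _ "K \<union> L"])
       (use K L assms in \<open>auto simp: test_fun_iff intro!: compact_Un\<close>)
qed

subsection \<open>The fundamental lemma of the calculus of variations\<close>

lemma test_fun_measurable: "test_fun a b \<phi> \<Longrightarrow> \<phi> \<in> borel_measurable borel"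
  by (rule borel_measurable_continuous_onI[OF test_fun_continuous])

lemma test_fun_measurable_lebesgue: "test_fun a b \<phi> \<Longrightarrow> \<phi> \<in> borel_measurable lebesgue"
  using test_fun_measurable by (intro measurable_completion) simp

lemma integrable_mult_test_fun:
  assumes "locally_integrable a b h" and \<phi>: "test_fun a b \<phi>"
  shows "integrable lebesgue (\<lambda>x. h x * \<phi> x)"
proof -
  obtain K where K: "compact K" "K \<subseteq> {a<..<b}" "\<And>x. x \<notin> K \<Longrightarrow> \<phi> x = 0"
    using \<phi> by (auto simp: test_fun_iff)
  obtain B where B: "B \<ge> 0" "\<And>x. \<bar>\<phi> x\<bar> \<le> B"
    using test_fun_bounded[OF \<phi>] by metis
  have hK: "integrable lebesgue (\<lambda>x. indicator K x * h x)"
    using assms(1) K by (auto simp: locally_integrable_def set_integrable_def)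
  have eq: "h x * \<phi> x = (indicator K x * h x) * \<phi> x" for x
    using K(3)[of x] by (auto simp: indicator_def)
  show ?thesis
    unfolding eq
  proof (rule Bochner_Integration.integrable_bound[where f = "\<lambda>x. B * (indicator K x * h x)"])
    show "integrable lebesgue (\<lambda>x. B * (indicator K x * h x))"
      using hK by simp
    show "(\<lambda>x. indicator K x * h x * \<phi> x) \<in> borel_measurable lebesgue"
      by (rule borel_measurable_times[OF borel_measurable_integrable[OF hK] test_fun_measurable_lebesgue[OF \<phi>]])
    show "AE x in lebesgue. norm (indicator K x * h x * \<phi> x) \<le> norm (B * (indicator K x * h x))"
    proof (rule AE_I2)
      fix x
      have "\<bar>indicator K x * h x\<bar> * \<bar>\<phi> x\<bar> \<le> \<bar>indicator K x * h x\<bar> * B"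
        using B(2) by (intro mult_left_mono) auto
      then show "norm (indicator K x * h x * \<phi> x) \<le> norm (B * (indicator K x * h x))"
        using B(1) by (simp add: abs_mult mult.commute)
    qed
  qed
qed

lemma set_integral_test_fun:
  "test_fun a b \<phi> \<Longrightarrow> (LINT x:{a<..<b}|lebesgue. h x * \<phi> x) = (LINT x|lebesgue. h x * \<phi> x)"
  unfolding set_lebesgue_integral_def
  by (intro Bochner_Integration.integral_cong refl) (use test_fun_zero in \<open>force simp: indicator_def\<close>)

lemma set_integrable_imp_locally_integrable:
  "set_integrable lebesgue {a<..<b} f \<Longrightarrow> locally_integrable a b f"
  unfolding locally_integrable_def
  by (auto intro: set_integrable_subset compact_imp_closed simp: lmeasurable_compact fmeasurableD)

section \<open>Uniqueness of Lebesgue densities\<close>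

lemma AE_open_interval_exhaust:
  fixes a b :: real
  assumes "\<And>c d. a < c \<Longrightarrow> c < d \<Longrightarrow> d < b \<Longrightarrow> AE x in lebesgue. x \<in> {c<..<d} \<longrightarrow> P x"
  shows "AE x in lebesgue. x \<in> {a<..<b} \<longrightarrow> P x"
proof -
  have "AE x in lebesgue. x \<in> {a + 1 / Suc n<..<b - 1 / Suc n} \<longrightarrow> P x" for n
    using assms[of "a + 1 / Suc n" "b - 1 / Suc n"]
    by (cases "a + 1 / Suc n < b - 1 / Suc n") auto
  then have "AE x in lebesgue. \<forall>n. x \<in> {a + 1 / Suc n<..<b - 1 / Suc n} \<longrightarrow> P x"
    by (subst AE_all_countable) blast
  then show ?thesis
  proof (rule AE_mp, intro AE_I2 impI)
    fix x assume *: "\<forall>n. x \<in> {a + 1 / Suc n<..<b - 1 / Suc n} \<longrightarrow> P x" and "x \<in> {a<..<b}"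
    then have "min (x - a) (b - x) > 0" by auto
    then obtain n where "1 / Suc n < min (x - a) (b - x)"
      using nat_approx_posE by blast
    then show "P x" using *[rule_format, of n] by auto
  qed
qed

text \<open>A pi-lambda argument for signed set functions. A difference of measures is not a
  measure, so the uniqueness theorem for measures on a generator does not apply directly;
  complements and disjoint unions are handled by countable additivity.\<close>

lemma countably_additive_vanishes:
  fixes m :: "real set \<Rightarrow> real"
  assumes add: "\<And>A. range A \<subseteq> sets borel \<Longrightarrow> disjoint_family A \<Longrightarrow> (\<lambda>i::nat. m (A i)) sums m (\<Union>i. A i)"
    and int: "\<And>c d. a \<le> c \<Longrightarrow> c < d \<Longrightarrow> d \<le> b \<Longrightarrow> m {c<..<d} = 0"
    and A: "A \<in> sets borel"
  shows "m (A \<inter> {a<..<b}) = 0"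
proof -
  \<comment> \<open>A convergent series with constant terms has terms 0, which yields the value on
    the empty set.\<close>
  have "(\<lambda>i::nat. m {}) sums m {}"
    using add[of "\<lambda>_. {}"] by (auto simp: disjoint_family_on_def)
  then have empty: "m {} = 0"
    by (metis sums_summable summable_const_iff)
  have I: "m {c<..<d} = 0" if "a \<le> c" "d \<le> b" for c d
    using int[of c d] that empty by (cases "c < d") auto
  have borel: "sets borel = sigma_sets UNIV (range (\<lambda>(c, d). {c<..<d::real}))"
    unfolding borel_eq_box by (simp add: box_real[abs_def] split_def)
  have "Int_stable (range (\<lambda>(c, d). {c<..<d::real}))"
    unfolding Int_stable_def by (auto simp: image_iff)
  moreover have "range (\<lambda>(c, d). {c<..<d::real}) \<subseteq> Pow UNIV" by simp
  moreover have "A \<in> sigma_sets UNIV (range (\<lambda>(c, d). {c<..<d::real}))"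
    using A by (simp add: borel)
  ultimately show ?thesis
  proof (induction rule: sigma_sets_induct_disjoint)
    case (basic A)
    then obtain c d where "A = {c<..<d}" by auto
    then have "A \<inter> {a<..<b} = {max a c<..<min b d}" by auto
    then show ?case using I[of "max a c" "min b d"] by simp
  next
    case empty
    then show ?case using \<open>m {} = 0\<close> by simp
  next
    case (compl A)
    then have [measurable]: "A \<in> sets borel" by (simp add: borel)
    let ?X = "A \<inter> {a<..<b}" and ?Y = "(UNIV - A) \<inter> {a<..<b}"
    have "(\<lambda>i. m (binaryset ?X ?Y i)) sums m (\<Union>i. binaryset ?X ?Y i)"
      by (rule add) (auto simp: binaryset_def disjoint_family_on_def)
    moreover have "(\<lambda>i. m (binaryset ?X ?Y i)) sums (m ?X + m ?Y)"
      by (rule binaryset_sums) fact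
    moreover have "(\<Union>i. binaryset ?X ?Y i) = {a<..<b}"
      by (auto simp: UN_binaryset_eq)
    ultimately have "m ?X + m ?Y = m {a<..<b}"
      by (metis sums_unique2)
    then show ?case using compl I[of a b] by simp
  next
    case (union A)
    have "range A \<subseteq> sets borel"
      using union by (auto simp: borel)
    then have "(\<lambda>i. m (A i \<inter> {a<..<b})) sums m (\<Union>i. A i \<inter> {a<..<b})"
      using union(1) by (intro add) (auto simp: disjoint_family_on_def)
    then show ?case using union by (simp add: sums_iff)
  qed
qed

lemma set_integral_sums:
  fixes u :: "'a \<Rightarrow> real"
  assumes "\<And>i::nat. A i \<in> sets M" "disjoint_family A" "set_integrable M (\<Union>i. A i) u"
  shows "(\<lambda>i. LINT x:A i|M. u x) sums (LINT x:(\<Union>i. A i)|M. u x)"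
proof -
  have "(\<lambda>n. LINT x:(\<Union>i<n. A i)|M. u x) \<longlonglongrightarrow> (LINT x:(\<Union>n. \<Union>i<n. A i)|M. u x)"
  proof (rule set_integral_cont_up)
    have "(\<Union>n. \<Union>i<n. A i) = (\<Union>i. A i)" by auto
    then show "set_integrable M (\<Union>n. \<Union>i<n. A i) u" using assms by simp
  qed (use assms in \<open>fastforce simp: incseq_def\<close>)+
  moreover have "(LINT x:(\<Union>i<n. A i)|M. u x) = (\<Sum>i<n. LINT x:A i|M. u x)" for n
  proof (rule set_integral_finite_Union)
    show "disjoint_family_on A {..<n}"
      using assms(2) by (auto simp: disjoint_family_on_def)
    show "set_integrable M (A i) u" if "i \<in> {..<n}" for i
      using assms by (auto intro: set_integrable_subset)
  qed (use assms in auto)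
  moreover have "(\<Union>n. \<Union>i<n. A i) = (\<Union>i. A i)" by auto
  ultimately show ?thesis by (simp add: sums_def)
qed

text \<open>Uniqueness in the Lebesgue decomposition, for the difference of two candidates:
  \<open>u\<close> is the difference of the densities, and the two pairs of measures are the
  singular parts. The total signed measure vanishes on intervals, hence on Borel sets; off
  \<open>N\<close> only the density is left, so \<open>u\<close> integrates to 0 over every Borel
  subset of the interval.\<close>

lemma density_eq_0:
  assumes u: "set_integrable lebesgue {a<..<b} u"
    and \<nu>: "finite_measure \<nu>" "finite_measure \<nu>'" "finite_measure \<rho>" "finite_measure \<rho>'"
    and s: "sets \<nu> = sets borel" "sets \<nu>' = sets borel" "sets \<rho> = sets borel" "sets \<rho>' = sets borel"
    and N: "N \<in> null_sets lborel" "- N \<in> null_sets \<nu>" "- N \<in> null_sets \<nu>'"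
      "- N \<in> null_sets \<rho>" "- N \<in> null_sets \<rho>'"
    and int: "\<And>c d. a \<le> c \<Longrightarrow> c < d \<Longrightarrow> d \<le> b \<Longrightarrow> (LINT x:{c<..<d}|lebesgue. u x)
      + (measure \<nu> {c<..<d} - measure \<nu>' {c<..<d}) - (measure \<rho> {c<..<d} - measure \<rho>' {c<..<d}) = 0"
  shows "AE x::real in lebesgue. x \<in> {a<..<b} \<longrightarrow> u x = 0"
proof -
  let ?I = "{a<..<b}"
  define m where "m A = (LINT x:A \<inter> ?I|lebesgue. u x)
      + (measure \<nu> A - measure \<nu>' A) - (measure \<rho> A - measure \<rho>' A)" for A :: "real set"
  have m0: "m (A \<inter> ?I) = 0" if "A \<in> sets borel" for A
  proof (rule countably_additive_vanishes[where m = m and a = a and b = b, OF _ _ that])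
    fix A :: "nat \<Rightarrow> real set" assume A: "range A \<subseteq> sets borel" "disjoint_family A"
    have M: "(\<lambda>i. measure \<mu> (A i)) sums measure \<mu> (\<Union>i. A i)"
      if "finite_measure \<mu>" "sets \<mu> = sets borel" for \<mu>
      using A that by (intro measure_UNION) (auto simp: finite_measure.emeasure_finite)
    have "(\<lambda>i. LINT x:A i \<inter> ?I|lebesgue. u x) sums (LINT x:(\<Union>i. A i \<inter> ?I)|lebesgue. u x)"
    proof (rule set_integral_sums)
      show m: "A i \<inter> ?I \<in> sets lebesgue" for i
        using A by (auto intro!: sets_completionI_sets)
      show "set_integrable lebesgue (\<Union>i. A i \<inter> ?I) u"
        by (rule set_integrable_subset[OF u sets.countable_UN]) (use m in auto)
    qed (use A in \<open>auto simp: disjoint_family_on_def\<close>)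
    then show "(\<lambda>i. m (A i)) sums m (\<Union>i. A i)"
      unfolding m_def using \<nu> s by (intro sums_add sums_diff M) auto
  next
    fix c d assume "a \<le> c" "c < d" "d \<le> b"
    moreover from this have "{c<..<d} \<inter> ?I = {c<..<d}" by auto
    ultimately show "m {c<..<d} = 0" using int[of c d] by (simp add: m_def)
  qed
  \<comment> \<open>\<open>u\<close> is only Lebesgue measurable, whereas the set function is
    controlled on Borel sets; a Borel representative gives access to
    \<open>density_unique_real\<close> over \<open>lborel\<close>.\<close>
  obtain u' where u'[measurable]: "u' \<in> borel_measurable lborel"
    and ae: "AE x in lborel. indicator ?I x * u x = u' x"
    using completion_ex_borel_measurable_real[of "\<lambda>x. indicator ?I x * u x" lborel] u
    by (auto simp: set_integrable_def)
  have ae': "AE x in lebesgue. indicator ?I x * u x = u' x"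
    using ae by (rule AE_completion)
  have int_u': "integrable lborel u'"
  proof -
    have "integrable lebesgue u'"
      using u u' ae' unfolding set_integrable_def
      by (subst integrable_cong_AE[symmetric, where f = "\<lambda>x. indicator ?I x * u x"])
         (auto intro: measurable_completion)
    then show ?thesis by (simp add: integrable_completion)
  qed
  have Z: "(LINT x:A|lborel. u' x) = 0" if A[measurable]: "A \<in> sets borel" for A
  proof -
    \<comment> \<open>Removing \<open>N\<close> kills the singular parts and leaves the integral
      unchanged.\<close>
    let ?B = "A \<inter> - N"
    have Nb[measurable]: "N \<in> sets borel" using N(1) by auto
    have B: "?B \<in> sets borel" by measurable
    have sub: "measure \<mu> (?B \<inter> ?I) = 0" if "- N \<in> null_sets \<mu>" "sets \<mu> = sets borel" for \<mu>
    proof -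
      have "?B \<inter> ?I \<in> null_sets \<mu>"
        by (rule null_sets_subset[OF that(1)]) (use B that in auto)
      then show ?thesis by (simp add: null_setsD1 measure_def)
    qed
    have "0 = m (?B \<inter> ?I)" using m0[OF B] by simp
    also have "\<dots> = (LINT x:?B \<inter> ?I|lebesgue. u x)"
      using N s by (simp add: m_def sub Int_assoc[symmetric])
    also have "\<dots> = (LINT x|lebesgue. indicator A x * u' x)"
      unfolding set_lebesgue_integral_def
    proof (rule integral_cong_AE)
      have "AE x in lborel. x \<notin> N" by (rule AE_not_in[OF N(1)])
      then have "AE x in lebesgue. x \<notin> N" by (rule AE_completion)
      with ae' show "AE x in lebesgue. indicator (?B \<inter> ?I) x *\<^sub>R u x = indicator A x * u' x"
        by eventually_elim (auto simp: indicator_def split: if_splits)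
      have "(\<lambda>x. indicator ?B x * (indicator ?I x * u x)) \<in> borel_measurable lebesgue"
        using borel_measurable_integrable[OF u[unfolded set_integrable_def]] B
        by (intro borel_measurable_times[of _ _ "\<lambda>x. indicator ?I x * u x"] borel_measurable_indicator
            sets_completionI_sets) auto
      moreover have "(\<lambda>x. indicator ?B x * (indicator ?I x * u x)) = (\<lambda>x. indicator (?B \<inter> ?I) x *\<^sub>R u x)"
        by (auto simp: indicator_def)
      ultimately show "(\<lambda>x. indicator (?B \<inter> ?I) x *\<^sub>R u x) \<in> borel_measurable lebesgue" by simp
    qed (auto intro!: measurable_completion)
    also have "\<dots> = (LINT x:A|lborel. u' x)"
      unfolding set_lebesgue_integral_def by (subst integral_completion) auto
    finally show ?thesis by simp
  qed
  have "AE x in lborel. u' x = 0"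
    by (rule density_unique_real) (use int_u' Z in \<open>auto simp: set_lebesgue_integral_def\<close>)
  then have "AE x in lebesgue. u' x = 0" by (rule AE_completion)
  with ae' show ?thesis
    by eventually_elim (auto simp: indicator_def)
qed

lemma set_integral_bump_limit:
  assumes "set_integrable lebesgue {a<..<b} u" "a \<le> c" "d \<le> b"
  shows "(\<lambda>n. LINT x:{a<..<b}|lebesgue. u x * bump c d n x) \<longlonglongrightarrow> (LINT x:{c<..<d}|lebesgue. u x)"
proof -
  have eq: "(LINT x:{c<..<d}|lebesgue. u x)
      = (LINT x|lebesgue. (indicator {a<..<b} x *\<^sub>R u x) * indicator {c<..<d} x)"
    unfolding set_lebesgue_integral_def
    by (intro Bochner_Integration.integral_cong refl) (use assms in \<open>auto simp: indicator_def\<close>)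
  have eq': "(LINT x:{a<..<b}|lebesgue. u x * bump c d n x)
      = (LINT x|lebesgue. (indicator {a<..<b} x *\<^sub>R u x) * bump c d n x)" for n
    unfolding set_lebesgue_integral_def by (simp add: mult.assoc)
  have b: "bump c d n \<in> borel_measurable lebesgue" for n
    by (rule test_fun_measurable_lebesgue[OF test_fun_bump])
  note m = borel_measurable_integrable[OF assms(1)[unfolded set_integrable_def]]
  show ?thesis
    unfolding eq eq'
  proof (rule integral_dominated_convergence[where w = "\<lambda>x. norm (indicator {a<..<b} x *\<^sub>R u x)"])
    show "(\<lambda>x. (indicator {a<..<b} x *\<^sub>R u x) * bump c d n x) \<in> borel_measurable lebesgue" for n
      by (rule borel_measurable_times[OF m b])
    show "(\<lambda>x. (indicator {a<..<b} x *\<^sub>R u x) * indicator {c<..<d} x) \<in> borel_measurable lebesgue"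
      by (intro borel_measurable_times[OF m] borel_measurable_indicator) auto
    show "integrable lebesgue (\<lambda>x. norm (indicator {a<..<b} x *\<^sub>R u x))"
      using assms(1) unfolding set_integrable_def by (rule integrable_norm)
    show "AE x in lebesgue. (\<lambda>n. (indicator {a<..<b} x *\<^sub>R u x) * bump c d n x)
        \<longlonglongrightarrow> (indicator {a<..<b} x *\<^sub>R u x) * indicator {c<..<d} x"
      by (intro AE_I2 tendsto_mult tendsto_const bump_tendsto)
    show "AE x in lebesgue. norm ((indicator {a<..<b} x *\<^sub>R u x) * bump c d n x)
        \<le> norm (indicator {a<..<b} x *\<^sub>R u x)" for n
    proof (rule AE_I2)
      fix x
      have "\<bar>bump c d n x\<bar> \<le> 1" using bump_bounds[of c d n x] by simp
      then have "\<bar>indicator {a<..<b} x * u x\<bar> * \<bar>bump c d n x\<bar> \<le> \<bar>indicator {a<..<b} x * u x\<bar> * 1"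
        by (intro mult_left_mono) auto
      then show "norm ((indicator {a<..<b} x *\<^sub>R u x) * bump c d n x) \<le> norm (indicator {a<..<b} x *\<^sub>R u x)"
        by (simp add: abs_mult)
    qed
  qed
qed

text \<open>The bumps converge to the indicator at every point and not just almost everywhere for
  Lebesgue measure, which is essential because \<open>\<nu>\<close> may charge single
  points.\<close>

lemma measure_bump_limit:
  assumes "finite_measure \<nu>" and s: "sets \<nu> = sets borel"
  shows "(\<lambda>n. LINT x|\<nu>. bump c d n x) \<longlonglongrightarrow> measure \<nu> {c<..<d}"
proof -
  interpret finite_measure \<nu> by fact
  have m: "f \<in> borel_measurable \<nu>" if "f \<in> borel_measurable borel" for f :: "real \<Rightarrow> real"
    using that measurable_cong_sets[OF s refl] by blast
  have "(\<lambda>n. LINT x|\<nu>. bump c d n x) \<longlonglongrightarrow> (LINT x|\<nu>. indicator {c<..<d} x)"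
  proof (rule integral_dominated_convergence[where w = "\<lambda>_. 1"])
    show "bump c d n \<in> borel_measurable \<nu>" for n
      by (rule m[OF test_fun_measurable[OF test_fun_bump]])
    show "AE x in \<nu>. (\<lambda>n. bump c d n x) \<longlonglongrightarrow> indicator {c<..<d} x"
      by (intro AE_I2 bump_tendsto)
    show "AE x in \<nu>. norm (bump c d n x) \<le> 1" for n
      using bump_bounds[of c d n] by (intro AE_I2) simp
    show "indicator {c<..<d} \<in> borel_measurable \<nu>"
      by (intro borel_measurable_indicator) (simp add: s)
    show "integrable \<nu> (\<lambda>_. 1::real)" by simp
  qed
  then show ?thesis using s by simp
qed

text \<open>Testing both representations with bumps and passing to the limit shows that the two
  signed measures agree on open intervals, so \<open>density_eq_0\<close> applies. This makes the
  choice in \<open>ac_deriv\<close> computable.\<close>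

lemma has_ac_deriv_unique:
  assumes "has_ac_deriv a b v u" "has_ac_deriv a b v u'"
  shows "AE x in lebesgue. x \<in> {a<..<b} \<longrightarrow> u x = u' x"
proof -
  obtain \<nu> \<nu>' N where \<nu>: "finite_measure \<nu>" "finite_measure \<nu>'"
    "sets \<nu> = sets borel" "sets \<nu>' = sets borel"
    "N \<in> null_sets lborel" "- N \<in> null_sets \<nu>" "- N \<in> null_sets \<nu>'"
    and vu: "\<And>\<phi>. test_fun a b \<phi> \<Longrightarrow> - (LINT x:{a<..<b}|lebesgue. v x * deriv \<phi> x) =
      (LINT x:{a<..<b}|lebesgue. u x * \<phi> x) + (LINT x|\<nu>. \<phi> x) - (LINT x|\<nu>'. \<phi> x)"
    and u: "set_integrable lebesgue {a<..<b} u"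
    using assms(1) unfolding has_ac_deriv_def by blast
  obtain \<rho> \<rho>' M where \<rho>: "finite_measure \<rho>" "finite_measure \<rho>'"
    "sets \<rho> = sets borel" "sets \<rho>' = sets borel"
    "M \<in> null_sets lborel" "- M \<in> null_sets \<rho>" "- M \<in> null_sets \<rho>'"
    and vu': "\<And>\<phi>. test_fun a b \<phi> \<Longrightarrow> - (LINT x:{a<..<b}|lebesgue. v x * deriv \<phi> x) =
      (LINT x:{a<..<b}|lebesgue. u' x * \<phi> x) + (LINT x|\<rho>. \<phi> x) - (LINT x|\<rho>'. \<phi> x)"
    and u': "set_integrable lebesgue {a<..<b} u'"
    using assms(2) unfolding has_ac_deriv_def by blast
  have "AE x in lebesgue. x \<in> {a<..<b} \<longrightarrow> u x - u' x = 0"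
  proof (rule density_eq_0[OF _ \<nu>(1,2) \<rho>(1,2) \<nu>(3,4) \<rho>(3,4)])
    show "set_integrable lebesgue {a<..<b} (\<lambda>x. u x - u' x)"
      using u u' by (rule set_integral_diff)
    show "N \<union> M \<in> null_sets lborel" using \<nu>(5) \<rho>(5) by blast
    have MN: "M \<in> sets borel" "N \<in> sets borel" using \<nu>(5) \<rho>(5) by auto
    show "- (N \<union> M) \<in> null_sets \<nu>" by (rule null_sets_subset[OF \<nu>(6)]) (use MN \<nu>(3,4) in \<open>auto\<close>)
    show "- (N \<union> M) \<in> null_sets \<nu>'" by (rule null_sets_subset[OF \<nu>(7)]) (use MN \<nu>(3,4) in \<open>auto\<close>)
    show "- (N \<union> M) \<in> null_sets \<rho>" by (rule null_sets_subset[OF \<rho>(6)]) (use MN \<rho>(3,4) in \<open>auto\<close>)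
    show "- (N \<union> M) \<in> null_sets \<rho>'" by (rule null_sets_subset[OF \<rho>(7)]) (use MN \<rho>(3,4) in \<open>auto\<close>)
    fix c d assume cd: "a \<le> c" "c < d" "d \<le> b"
    have lim: "(\<lambda>n. ((LINT x:{a<..<b}|lebesgue. u x * bump c d n x)
          + (LINT x|\<nu>. bump c d n x) - (LINT x|\<nu>'. bump c d n x))
        - ((LINT x:{a<..<b}|lebesgue. u' x * bump c d n x)
          + (LINT x|\<rho>. bump c d n x) - (LINT x|\<rho>'. bump c d n x)))
      \<longlonglongrightarrow> ((LINT x:{c<..<d}|lebesgue. u x) + measure \<nu> {c<..<d} - measure \<nu>' {c<..<d})
        - ((LINT x:{c<..<d}|lebesgue. u' x) + measure \<rho> {c<..<d} - measure \<rho>' {c<..<d})"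
      by (intro tendsto_diff tendsto_add set_integral_bump_limit measure_bump_limit u u' cd \<nu>(1-4) \<rho>(1-4))
    have "test_fun a b (bump c d n)" for n
      using test_fun_mono[OF test_fun_bump] cd by simp
    then have "(\<lambda>_. 0) \<longlonglongrightarrow> ((LINT x:{c<..<d}|lebesgue. u x) + measure \<nu> {c<..<d} - measure \<nu>' {c<..<d})
        - ((LINT x:{c<..<d}|lebesgue. u' x) + measure \<rho> {c<..<d} - measure \<rho>' {c<..<d})"
      using lim by (simp add: vu[symmetric] vu'[symmetric])
    then have z: "((LINT x:{c<..<d}|lebesgue. u x) + measure \<nu> {c<..<d} - measure \<nu>' {c<..<d})
        - ((LINT x:{c<..<d}|lebesgue. u' x) + measure \<rho> {c<..<d} - measure \<rho>' {c<..<d}) = 0"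
      using LIMSEQ_const_iff by metis
    have "(LINT x:{c<..<d}|lebesgue. u x - u' x)
        = (LINT x:{c<..<d}|lebesgue. u x) - (LINT x:{c<..<d}|lebesgue. u' x)"
      by (intro set_integral_diff set_integrable_subset[OF u] set_integrable_subset[OF u'])
         (use cd in auto)
    with z show "(LINT x:{c<..<d}|lebesgue. u x - u' x) + (measure \<nu> {c<..<d} - measure \<nu>' {c<..<d})
        - (measure \<rho> {c<..<d} - measure \<rho>' {c<..<d}) = 0"
      by simp
  qed
  then show ?thesis by simp
qed

text \<open>The case of \<open>density_eq_0\<close> without singular parts, applied on subintervals
  away from the ends because \<open>h\<close> is only locally integrable.\<close>

lemma fundamental_lemma:
  assumes h: "locally_integrable a b h"
    and 0: "\<And>\<phi>. test_fun a b \<phi> \<Longrightarrow> (LINT x|lebesgue. h x * \<phi> x) = 0"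
  shows "AE x in lebesgue. x \<in> {a<..<b} \<longrightarrow> h x = 0"
proof (rule AE_open_interval_exhaust)
  fix c d assume cd: "a < c" "c < d" "d < b"
  have "set_integrable lebesgue {c..d} h"
    using h cd unfolding locally_integrable_def by (intro h[unfolded locally_integrable_def, rule_format]) auto
  then have hi: "set_integrable lebesgue {c<..<d} h"
    by (rule set_integrable_subset) auto
  have n: "finite_measure (null_measure borel)" "sets (null_measure borel) = sets borel"
    "- {} \<in> null_sets (null_measure borel)"
    by (auto intro: finite_measureI)
  show "AE x in lebesgue. x \<in> {c<..<d} \<longrightarrow> h x = 0"
  proof (rule density_eq_0[OF hi n(1) n(1) n(1) n(1) n(2) n(2) n(2) n(2) _ n(3) n(3) n(3) n(3)])
    fix e f assume ef: "c \<le> e" "e < f" "f \<le> d"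
    have "test_fun c d (bump e f n)" "test_fun a b (bump e f n)" for n
      using test_fun_mono[OF test_fun_bump] ef cd by auto
    then have "(LINT x:{c<..<d}|lebesgue. h x * bump e f n x) = 0" for n
      by (simp add: set_integral_test_fun 0)
    then show "(LINT x:{e<..<f}|lebesgue. h x)
        + (measure (null_measure borel) {e<..<f} - measure (null_measure borel) {e<..<f})
        - (measure (null_measure borel) {e<..<f} - measure (null_measure borel) {e<..<f}) = 0"
      using set_integral_bump_limit[OF hi ef(1,3)] by (simp add: LIMSEQ_const_iff)
  qed auto
qed

text \<open>The primitive from the left vanishes to the left of the support; to the right of it, it
  equals the total integral, that is 0.\<close>

lemma test_fun_primitive:
  assumes "test_fun a b \<psi>" "a < b" "(LINT x|lebesgue. \<psi> x) = 0"
  obtains \<phi> where "test_fun a b \<phi>" "deriv \<phi> = \<psi>"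
proof -
  obtain c d where cd: "a < c" "c < d" "d < b" "\<And>x. x \<notin> {c<..<d} \<Longrightarrow> \<psi> x = 0"
    using test_fun_support[OF assms(1,2)] by metis
  have cont: "continuous_on A \<psi>" for A by (rule test_fun_continuous[OF assms(1)])
  define \<phi> where "\<phi> x = integral {c..x} \<psi>" for x
  have i: "integral {c..x} \<psi> = 0" if "x \<ge> d" for x
  proof -
    have "integral {c..x} \<psi> = (LINT x:{c..x}|lebesgue. \<psi> x)"
      by (rule set_lebesgue_integral_eq_integral(2)[OF absolutely_integrable_continuous_real[OF cont], symmetric])
    also have "\<dots> = (LINT x|lebesgue. \<psi> x)"
      unfolding set_lebesgue_integral_def
    proof (intro Bochner_Integration.integral_cong refl)
      fix y
      show "indicator {c..x} y *\<^sub>R \<psi> y = \<psi> y"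
        using cd(2) cd(4)[of y] that by (cases "y \<in> {c<..<d}") (auto simp: indicator_def)
    qed
    finally show ?thesis using assms(3) by simp
  qed
  \<comment> \<open>Starting the integral further to the left gives the same function, so that the
    derivative can be taken at points at or below \<open>c\<close> as well.\<close>
  have e: "\<phi> y = integral {e..y} \<psi>" if "e \<le> c" for e y
  proof (cases "y < c")
    case True
    then have "integral {e..y} \<psi> = integral {e..y} (\<lambda>_. 0)"
      using cd(4) by (intro Henstock_Kurzweil_Integration.integral_cong) auto
    then show ?thesis using True by (simp add: \<phi>_def)
  next
    case False
    have "integral {e..c} \<psi> = integral {e..c} (\<lambda>_. 0)"
      using cd(4) by (intro Henstock_Kurzweil_Integration.integral_cong) auto
    moreover have "integral {e..c} \<psi> + integral {c..y} \<psi> = integral {e..y} \<psi>"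
      using False that cont by (intro Henstock_Kurzweil_Integration.integral_combine integrable_continuous_real) auto
    ultimately show ?thesis by (simp add: \<phi>_def)
  qed
  have D: "(\<phi> has_real_derivative \<psi> x) (at x)" for x
  proof -
    define e where "e = min c x - 1"
    have "((\<lambda>y. integral {e..y} \<psi>) has_real_derivative \<psi> x) (at x within {e..x+1})"
      using cont by (intro integral_has_real_derivative) (auto simp: e_def)
    moreover have "at x within {e..x+1} = at x"
      by (rule at_within_interior) (auto simp: e_def)
    moreover have "(\<lambda>y. integral {e..y} \<psi>) = \<phi>"
      by (intro ext e[symmetric]) (simp add: e_def)
    ultimately show ?thesis by simp
  qed
  have "test_fun a b \<phi>"
    unfolding test_fun_iff
  proof (intro conjI exI[of _ "{c..d}"] allI impI)
    show "smooth \<phi>"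
      using assms(1) by (intro smoothI_DERIV[OF D]) (simp add: test_fun_iff)
    show "\<phi> x = 0" if "x \<notin> {c..d}" for x
      using that i[of x] unfolding \<phi>_def by (cases "x < c") auto
  qed (use cd(1-3) in auto)
  moreover have "deriv \<phi> = \<psi>"
    using D by (auto intro!: DERIV_imp_deriv)
  ultimately show thesis by (rule that)
qed

section \<open>Invariance under changes on null sets\<close>

lemma integrable_lebesgue_cong_AE:
  fixes f g :: "real \<Rightarrow> real"
  assumes "AE x in lebesgue. f x = g x" "integrable lebesgue f"
  shows "integrable lebesgue g"
  using assms borel_measurable_AE[OF borel_measurable_integrable[OF assms(2)] assms(1)]
  by (rule_tac integrable_cong_AE_imp[OF assms(2)]) (auto elim: AE_mp)

text \<open>Measurability comes for free: Lebesgue measure is complete, so either both functions are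
  measurable or neither is, and in the latter case both integrals have the default value 0.\<close>

lemma integral_lebesgue_cong_AE:
  fixes f g :: "real \<Rightarrow> real"
  assumes "AE x in lebesgue. f x = g x"
  shows "integral\<^sup>L lebesgue f = integral\<^sup>L lebesgue g"
proof (cases "f \<in> borel_measurable lebesgue")
  case True
  then show ?thesis
    using assms borel_measurable_AE[OF True assms] by (intro integral_cong_AE)
next
  case False
  have "AE x in lebesgue. g x = f x" using assms by eventually_elim simp
  then have "g \<notin> borel_measurable lebesgue"
    using False borel_measurable_AE by blast
  with False show ?thesis
    using not_integrable_integral_eq borel_measurable_integrable by metis
qed

lemma set_integrable_lebesgue_cong_AE:
  fixes f g :: "real \<Rightarrow> real"
  assumes "AE x in lebesgue. x \<in> A \<longrightarrow> f x = g x" "set_integrable lebesgue A f"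
  shows "set_integrable lebesgue A g"
  using assms(2) unfolding set_integrable_def
  by (rule integrable_lebesgue_cong_AE[rotated])
     (rule eventually_mono[OF assms(1)], auto simp: indicator_def)

lemma set_integral_lebesgue_cong_AE:
  fixes f g :: "real \<Rightarrow> real"
  assumes "AE x in lebesgue. x \<in> A \<longrightarrow> f x = g x"
  shows "(LINT x:A|lebesgue. f x) = (LINT x:A|lebesgue. g x)"
  unfolding set_lebesgue_integral_def
  by (rule integral_lebesgue_cong_AE) (rule eventually_mono[OF assms(1)], auto simp: indicator_def)

lemma AE_sym: "AE x in M. P x \<longrightarrow> f x = g x \<Longrightarrow> AE x in M. P x \<longrightarrow> g x = f x"
  by (erule eventually_mono) auto

lemma AE_trans: "AE x in M. P x \<longrightarrow> f x = g x \<Longrightarrow> AE x in M. P x \<longrightarrow> g x = h x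
    \<Longrightarrow> AE x in M. P x \<longrightarrow> f x = h x"
  by (erule (1) eventually_elim2) auto

lemma set_integrable_open_interval:
  "set_integrable lebesgue {a<..<b} f \<longleftrightarrow> set_integrable lebesgue {a..b} f" for f :: "real \<Rightarrow> real"
  using absolutely_integrable_on_open_interval[where f = f and a = a and b = b] by (simp add: box_real)

lemma set_integrable_const_interval: "set_integrable lebesgue {a<..<b} (\<lambda>_. c)" for a b c :: real
  by (rule absolutely_integrable_on_const) simp

lemma locally_integrable_cong_AE:
  assumes "AE x in lebesgue. x \<in> {a<..<b} \<longrightarrow> v x = w x" "locally_integrable a b v"
  shows "locally_integrable a b w"
  unfolding locally_integrable_def
proof (intro allI impI)
  fix K assume K: "compact K" "K \<subseteq> {a<..<b}"
  have "AE x in lebesgue. x \<in> K \<longrightarrow> v x = w x"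
    using assms(1) by (rule eventually_mono) (use K in auto)
  then show "set_integrable lebesgue K w"
    using assms(2) K set_integrable_lebesgue_cong_AE unfolding locally_integrable_def by blast
qed

lemma has_ac_deriv_cong_AE:
  assumes "AE x in lebesgue. x \<in> {a<..<b} \<longrightarrow> v x = w x" "has_ac_deriv a b v u"
  shows "has_ac_deriv a b w u"
proof -
  have "(LINT x:{a<..<b}|lebesgue. w x * deriv \<phi> x) = (LINT x:{a<..<b}|lebesgue. v x * deriv \<phi> x)" for \<phi>
    by (rule set_integral_lebesgue_cong_AE) (rule eventually_mono[OF assms(1)], auto)
  then show ?thesis
    using assms locally_integrable_cong_AE[OF assms(1)] unfolding has_ac_deriv_def by simp
qed

lemma disc_set_cong_AE:
  assumes "AE x in lebesgue. x \<in> {a<..<b} \<longrightarrow> v x = w x"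
  shows "disc_set a b v = disc_set a b w"
proof -
  have "(AE y in lebesgue. y \<in> {a<..<b} \<longrightarrow> g y = v y) \<longleftrightarrow> (AE y in lebesgue. y \<in> {a<..<b} \<longrightarrow> g y = w y)" for g
    by (intro iffI) (erule AE_trans[OF _ assms], erule AE_trans[OF _ AE_sym[OF assms]])
  then show ?thesis unfolding disc_set_def by (simp only:)
qed

lemma AE_interval_ex:
  fixes c d :: real
  assumes "AE x in lebesgue. x \<in> {a<..<b} \<longrightarrow> P x" "a \<le> c" "c < d" "d \<le> b"
  shows "\<exists>x. c < x \<and> x < d \<and> P x"
proof (rule ccontr)
  assume n: "\<not> ?thesis"
  have "AE x in lebesgue. x \<notin> {c<..<d}"
    using assms(1) by (rule eventually_mono) (use assms(2-4) n in auto)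
  then have "{c<..<d} \<in> null_sets lebesgue"
    by (subst (asm) AE_iff_null_sets[symmetric]) auto
  then have "emeasure lebesgue {c<..<d} = 0" by (rule null_setsD1)
  then show False using assms by simp
qed

text \<open>A one-sided limit cannot be moved by a null set, as every interval to the right of
  \<open>y\<close> contains points where \<open>h\<close> has the value \<open>m\<close>.\<close>

lemma AE_tendsto_at_right:
  fixes h :: "real \<Rightarrow> real"
  assumes ae: "AE x in lebesgue. x \<in> {a<..<b} \<longrightarrow> h x = m" and lim: "(h \<longlongrightarrow> k) (at_right y)"
    and y: "a \<le> y" "y < b"
  shows "k = m"
proof (rule ccontr)
  assume "k \<noteq> m"
  then have "eventually (\<lambda>x. h x \<in> - {m}) (at_right y)"
    by (intro topological_tendstoD[OF lim]) auto
  then obtain d where d: "d > y" "\<And>x. y < x \<Longrightarrow> x < d \<Longrightarrow> h x \<noteq> m"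
    by (auto simp: eventually_at_right_field)
  then show False
    using AE_interval_ex[OF ae, of y "min d b"] y by auto
qed

lemma AE_tendsto_at_left:
  fixes h :: "real \<Rightarrow> real"
  assumes ae: "AE x in lebesgue. x \<in> {a<..<b} \<longrightarrow> h x = m" and lim: "(h \<longlongrightarrow> k) (at_left y)"
    and y: "a < y" "y \<le> b"
  shows "k = m"
proof (rule ccontr)
  assume "k \<noteq> m"
  then have "eventually (\<lambda>x. h x \<in> - {m}) (at_left y)"
    by (intro topological_tendstoD[OF lim]) auto
  then obtain d where d: "d < y" "\<And>x. d < x \<Longrightarrow> x < y \<Longrightarrow> h x \<noteq> m"
    by (auto simp: eventually_at_left_field)
  then show False
    using AE_interval_ex[OF ae, of "max d a" y] y by auto
qed

lemma integrable_test_fun: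
  assumes "test_fun a b \<phi>" shows "integrable lebesgue \<phi>"
proof -
  have "locally_integrable a b (\<lambda>_. 1)"
    by (intro set_integrable_imp_locally_integrable set_integrable_const_interval)
  from integrable_mult_test_fun[OF this assms] show ?thesis by simp
qed

text \<open>Fix a test function \<open>\<theta>\<close> with nonzero integral. Subtracting a
  multiple of it gives any test function mean zero and thus makes it a derivative, against which
  \<open>h\<close> integrates to 0. The constant is the mean of \<open>h\<close> weighted by
  \<open>\<theta>\<close>.\<close>

lemma du_bois_reymond:
  assumes h: "set_integrable lebesgue {a<..<b} h" and "a < b"
    and 0: "\<And>\<phi>. test_fun a b \<phi> \<Longrightarrow> (LINT x|lebesgue. h x * deriv \<phi> x) = 0"
  obtains C where "AE x in lebesgue. x \<in> {a<..<b} \<longrightarrow> h x = C"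
proof -
  \<comment> \<open>The integrals of the bumps tend to \<open>b - a > 0\<close>, so one of them is
    positive.\<close>
  have "(\<lambda>n. LINT x:{a<..<b}|lebesgue. 1 * bump a b n x) \<longlonglongrightarrow> (LINT x:{a<..<b}|lebesgue. 1)"
    by (rule set_integral_bump_limit) (auto intro: set_integrable_const_interval)
  moreover have "(LINT x:{a<..<b}|lebesgue. (1::real)) = b - a"
    using \<open>a < b\<close> by (simp add: set_lebesgue_integral_def)
  ultimately have "eventually (\<lambda>n. (LINT x:{a<..<b}|lebesgue. 1 * bump a b n x) > 0) sequentially"
    using \<open>a < b\<close> by (auto intro: order_tendstoD)
  then obtain n where n: "(LINT x:{a<..<b}|lebesgue. 1 * bump a b n x) > 0"
    by (auto simp: eventually_sequentially)
  define \<theta> where "\<theta> = bump a b n"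
  have \<theta>: "test_fun a b \<theta>" unfolding \<theta>_def by (rule test_fun_bump)
  define T where "T = (LINT x|lebesgue. \<theta> x)"
  have T: "T \<noteq> 0"
    using n unfolding set_integral_test_fun[OF test_fun_bump] T_def \<theta>_def by simp
  define C where "C = (LINT x|lebesgue. h x * \<theta> x) / T"
  have lh: "locally_integrable a b h"
    using h by (rule set_integrable_imp_locally_integrable)
  have "AE x in lebesgue. x \<in> {a<..<b} \<longrightarrow> h x - C = 0"
  proof (rule fundamental_lemma)
    show "locally_integrable a b (\<lambda>x. h x - C)"
      by (intro set_integrable_imp_locally_integrable set_integral_diff h set_integrable_const_interval)
    fix \<psi> assume \<psi>: "test_fun a b \<psi>"
    define r where "r = (LINT x|lebesgue. \<psi> x) / T"
    have t: "test_fun a b (\<lambda>x. 1 * \<psi> x + (- r) * \<theta> x)"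
      by (rule test_fun_lincomb[OF \<psi> \<theta>])
    have "(LINT x|lebesgue. 1 * \<psi> x + (- r) * \<theta> x) = (LINT x|lebesgue. \<psi> x) - r * T"
      using integrable_test_fun[OF \<psi>] integrable_test_fun[OF \<theta>] by (simp add: T_def)
    also have "\<dots> = 0" using T by (simp add: r_def)
    finally obtain \<phi> where \<phi>: "test_fun a b \<phi>" "deriv \<phi> = (\<lambda>x. 1 * \<psi> x + (- r) * \<theta> x)"
      using test_fun_primitive[OF t \<open>a < b\<close>] by metis
    have i: "integrable lebesgue (\<lambda>x. h x * \<psi> x)" "integrable lebesgue (\<lambda>x. h x * \<theta> x)"
      using integrable_mult_test_fun lh \<psi> \<theta> by auto
    have "0 = (LINT x|lebesgue. h x * \<psi> x - r * (h x * \<theta> x))"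
      using 0[OF \<phi>(1)] by (simp add: \<phi>(2) algebra_simps)
    also have "\<dots> = (LINT x|lebesgue. h x * \<psi> x) - C * (LINT x|lebesgue. \<psi> x)"
      using i by (simp add: C_def r_def)
    also have "\<dots> = (LINT x|lebesgue. h x * \<psi> x - C * \<psi> x)"
      using i integrable_test_fun[OF \<psi>] by simp
    also have "\<dots> = (LINT x|lebesgue. (h x - C) * \<psi> x)"
      by (simp add: algebra_simps)
    finally show "(LINT x|lebesgue. (h x - C) * \<psi> x) = 0" by simp
  qed
  then show thesis by (intro that[of C]) simp
qed

subsection \<open>Piecewise primitives\<close>

text \<open>In distributional terms, the derivative of the Heaviside step at \<open>s\<close> is the
  Dirac mass at \<open>s\<close>. For \<open>s\<close> outside the interval both sides are
  0.\<close>

lemma test_fun_tail_integral: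
  assumes "test_fun a b \<phi>"
  shows "(LINT x|lebesgue. indicator {s..} x * deriv \<phi> x) = - \<phi> s"
proof -
  define e where "e = max s b + 1"
  have z: "\<phi> e = 0" by (rule test_fun_zero[OF assms]) (simp add: e_def max_def)
  have eq: "indicator {s..} x * deriv \<phi> x = indicator {s..e} x *\<^sub>R deriv \<phi> x" for x
    using test_fun_zero[OF test_fun_deriv[OF assms], of x] by (cases "x < b") (auto simp: e_def indicator_def)
  have "(deriv \<phi> has_integral \<phi> e - \<phi> s) {s..e}"
    by (rule fundamental_theorem_of_calculus)
       (auto simp: e_def intro!: has_real_derivative_iff_has_vector_derivative[THEN iffD1]
         DERIV_subset[OF test_fun_DERIV[OF assms]])
  then have "integral {s..e} (deriv \<phi>) = \<phi> e - \<phi> s" by (rule integral_unique)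
  moreover have "(LINT x:{s..e}|lebesgue. deriv \<phi> x) = integral {s..e} (deriv \<phi>)"
    by (rule set_lebesgue_integral_eq_integral(2)[OF absolutely_integrable_continuous_real])
       (rule test_fun_continuous[OF test_fun_deriv[OF assms]])
  ultimately show ?thesis using z by (simp add: eq set_lebesgue_integral_def)
qed

lemma sigma_finite_lebesgue: "sigma_finite_measure (lebesgue :: real measure)"
proof (rule sigma_finite_measure.intro, intro exI conjI)
  show "countable (range (\<lambda>n. {- real n..real n}))" by simp
  have "\<exists>n. x \<in> {- real n..real n}" for x :: real
  proof -
    obtain n where "\<bar>x\<bar> \<le> real n" using real_arch_simple by blast
    then show ?thesis by (intro exI[of _ n]) auto
  qed
  then show "\<Union> (range (\<lambda>n. {- real n..real n})) = space lebesgue" by auto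
qed auto

text \<open>Integration by parts for a merely integrable \<open>f\<close>, by Fubini: write the
  primitive as an integral of \<open>f s\<close> over \<open>s \<le> x\<close> and integrate in
  \<open>x\<close> first, where \<open>test_fun_tail_integral\<close> gives
  \<open>- \<phi> s\<close>.\<close>

lemma integral_primitive_test_fun:
  assumes f: "set_integrable lebesgue {l..u} f" and ab: "l \<le> a" "b \<le> u" and \<phi>: "test_fun a b \<phi>"
  shows "(LINT x|lebesgue. integral {l..x} f * deriv \<phi> x) = - (LINT x|lebesgue. f x * \<phi> x)"
proof -
  interpret L: sigma_finite_measure "lebesgue :: real measure" by (rule sigma_finite_lebesgue)
  interpret P: pair_sigma_finite "lebesgue :: real measure" "lebesgue :: real measure" ..
  define F where "F s = indicator {l..u} s * f s" for s
  have F: "integrable lebesgue F" using f by (simp add: F_def[abs_def] set_integrable_def)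
  have \<phi>': "test_fun a b (deriv \<phi>)" by (rule test_fun_deriv[OF \<phi>])
  note [measurable] = borel_measurable_integrable[OF F] test_fun_measurable_lebesgue[OF \<phi>']
  have [measurable]: "(\<lambda>x::real. x) \<in> borel_measurable lebesgue"
    by (intro measurable_completion) simp
  let ?K = "\<lambda>s x. F s * (indicator {s..} x * deriv \<phi> x)"
  have K: "?K s x = F s * deriv \<phi> x * (if s \<le> x then 1 else 0)" for s x
    by (simp add: indicator_def)
  have bound: "integrable lebesgue (\<lambda>x. indicator {s..} x * deriv \<phi> x)" for s
  proof (rule Bochner_Integration.integrable_bound[OF integrable_test_fun[OF \<phi>']])
    show "(\<lambda>x. indicator {s..} x * deriv \<phi> x) \<in> borel_measurable lebesgue"
      by (intro borel_measurable_times borel_measurable_indicator) auto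
  qed (auto simp: indicator_def)
  have meas: "(\<lambda>(s, x). ?K s x) \<in> borel_measurable (lebesgue \<Otimes>\<^sub>M lebesgue)"
    unfolding K by measurable
  have "integrable (lebesgue \<Otimes>\<^sub>M lebesgue) (\<lambda>(s, x). ?K s x)"
  proof (rule P.Fubini_integrable[OF meas])
    have le: "(LINT x|lebesgue. norm (?K s x)) \<le> norm (F s) * (LINT x|lebesgue. norm (deriv \<phi> x))" for s
    proof -
      have "(LINT x|lebesgue. norm (?K s x)) \<le> (LINT x|lebesgue. norm (F s) * norm (deriv \<phi> x))"
      proof (rule integral_mono)
        show "integrable lebesgue (\<lambda>x. norm (?K s x))"
          using bound[of s] by (intro integrable_norm) simp
        show "integrable lebesgue (\<lambda>x. norm (F s) * norm (deriv \<phi> x))"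
          using integrable_norm[OF integrable_test_fun[OF \<phi>']] by simp
      qed (auto simp: indicator_def abs_mult)
      then show ?thesis by simp
    qed
    have m: "(\<lambda>s. LINT x|lebesgue. norm (?K s x)) \<in> borel_measurable lebesgue"
      using meas by (intro L.borel_measurable_lebesgue_integral) (simp add: split_def)
    show "integrable lebesgue (\<lambda>x. LINT y|lebesgue. norm (case (x, y) of (s, x) \<Rightarrow> ?K s x))"
      unfolding prod.case
    proof (rule Bochner_Integration.integrable_bound[OF _ m])
      show "integrable lebesgue (\<lambda>s. norm (F s) * (LINT x|lebesgue. norm (deriv \<phi> x)))"
        using integrable_norm[OF F] by simp
      show "AE x in lebesgue. norm (LINT xa|lebesgue. norm (?K x xa))
          \<le> norm (norm (F x) * (LINT x|lebesgue. norm (deriv \<phi> x)))"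
      proof (rule AE_I2)
        fix s
        have "0 \<le> (LINT xa|lebesgue. norm (?K s xa))" by (rule integral_nonneg_AE) simp
        then have "norm (LINT xa|lebesgue. norm (?K s xa)) = (LINT xa|lebesgue. norm (?K s xa))"
          by (simp only: real_norm_def abs_of_nonneg)
        also note le[of s]
        also have "norm (F s) * (LINT x|lebesgue. norm (deriv \<phi> x))
          \<le> norm (norm (F s) * (LINT x|lebesgue. norm (deriv \<phi> x)))"
          by (simp only: real_norm_def abs_ge_self)
        finally show "norm (LINT xa|lebesgue. norm (?K s xa))
          \<le> norm (norm (F s) * (LINT x|lebesgue. norm (deriv \<phi> x)))" .
      qed
    qed
    show "AE x in lebesgue. integrable lebesgue (\<lambda>y. case (x, y) of (s, x) \<Rightarrow> ?K s x)"
      using bound by (intro AE_I2) simp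
  qed
  then have "(LINT x|lebesgue. LINT s|lebesgue. ?K s x) = (LINT s|lebesgue. LINT x|lebesgue. ?K s x)"
    by (rule P.Fubini_integral)
  also have "\<dots> = (LINT s|lebesgue. - (f s * \<phi> s))"
  proof (intro Bochner_Integration.integral_cong refl)
    fix s
    show "(LINT x|lebesgue. ?K s x) = - (f s * \<phi> s)"
      using test_fun_zero[OF \<phi>, of s] ab
      by (cases "s \<in> {a<..<b}") (auto simp: test_fun_tail_integral[OF \<phi>] F_def)
  qed
  also have "(LINT x|lebesgue. LINT s|lebesgue. ?K s x) = (LINT x|lebesgue. integral {l..x} f * deriv \<phi> x)"
  proof (intro Bochner_Integration.integral_cong refl)
    fix x
    show "(LINT s|lebesgue. ?K s x) = integral {l..x} f * deriv \<phi> x"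
    proof (cases "x \<in> {a<..<b}")
      case True
      have "?K s x = indicator {l..x} s *\<^sub>R f s * deriv \<phi> x" for s
        using True ab by (auto simp: F_def indicator_def)
      then have "(LINT s|lebesgue. ?K s x) = (LINT s|lebesgue. indicator {l..x} s *\<^sub>R f s * deriv \<phi> x)"
        by (simp only:)
      also have "\<dots> = (LINT s:{l..x}|lebesgue. f s) * deriv \<phi> x"
        by (simp add: set_lebesgue_integral_def)
      also have "(LINT s:{l..x}|lebesgue. f s) = integral {l..x} f"
        by (rule set_lebesgue_integral_eq_integral, rule set_integrable_subset[OF f]) (use True ab in auto)
      finally show ?thesis .
    qed (simp add: test_fun_zero[OF \<phi>'])
  qed
  finally show ?thesis by simp
qed

text \<open>Nested as \<open>pw_prim l p (pw_prim l q g I t b) I t a\<close>, it describes a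
  piecewise H2 function: \<open>b\<close> holds the jumps of the slope and \<open>a\<close> those of
  the value. Both levels share the points \<open>t\<close>, so single coefficients may be 0.\<close>

definition pw_prim :: "real \<Rightarrow> real \<Rightarrow> (real \<Rightarrow> real) \<Rightarrow> nat set \<Rightarrow> (nat \<Rightarrow> real) \<Rightarrow> (nat \<Rightarrow> real) \<Rightarrow> real \<Rightarrow> real"
  where "pw_prim l p f I t c x = p + integral {l..x} f + (\<Sum>i\<in>I. if t i \<le> x then c i else 0)"

lemma continuous_on_primitive:
  fixes f :: "real \<Rightarrow> real"
  assumes "set_integrable lebesgue {l..u} f"
  shows "continuous_on {l..u} (\<lambda>x. integral {l..x} f)"
  by (rule indefinite_integral_continuous_1) (rule set_lebesgue_integral_eq_integral(1)[OF assms])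

lemma set_integrable_step:
  "set_integrable lebesgue {a<..<b} (\<lambda>x::real. \<Sum>i\<in>I. if t i \<le> x then c i else (0::real))"
proof -
  have "integrable lebesgue (\<lambda>x. indicator ({a<..<b} \<inter> {t i..}) x * c i)" for i
  proof (intro integrable_mult_left integrable_real_indicator)
    have "emeasure lborel ({a<..<b} \<inter> {t i..}) < \<infinity>"
      by (rule emeasure_bounded_finite) (simp add: bounded_Int)
    then show "emeasure lebesgue ({a<..<b} \<inter> {t i..}) < \<infinity>" by simp
  qed auto
  moreover have "indicator {a<..<b} x *\<^sub>R (\<Sum>i\<in>I. if t i \<le> x then c i else (0::real))
    = (\<Sum>i\<in>I. indicator ({a<..<b} \<inter> {t i..}) x * c i)" for x
    by (auto simp: sum_distrib_left indicator_def intro!: sum.cong)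
  ultimately show ?thesis
    unfolding set_integrable_def by simp
qed

lemma set_integrable_pw_prim:
  assumes f: "set_integrable lebesgue {l..u} f" and ab: "l \<le> a" "b \<le> u"
  shows "set_integrable lebesgue {a<..<b} (pw_prim l p f I t c)"
proof -
  have "set_integrable lebesgue {l..u} (\<lambda>x. integral {l..x} f)"
    by (rule absolutely_integrable_continuous_real[OF continuous_on_primitive[OF f]])
  then have "set_integrable lebesgue {a<..<b} (\<lambda>x. integral {l..x} f)"
    by (rule set_integrable_subset) (use ab in auto)
  then show ?thesis
    unfolding pw_prim_def[abs_def]
    by (intro set_integral_add set_integrable_const_interval set_integrable_step)
qed

text \<open>Constants drop out, the integral is handled by parts and each step contributes a Dirac
  mass: the distributional derivative is \<open>f\<close> plus the masses \<open>c i\<close> at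
  \<open>t i\<close>.\<close>

lemma integral_pw_prim_test_fun:
  assumes f: "set_integrable lebesgue {l..u} f" and ab: "l \<le> a" "b \<le> u" and \<phi>: "test_fun a b \<phi>"
  shows "(LINT x|lebesgue. pw_prim l p f I t c x * deriv \<phi> x) =
    - (LINT x|lebesgue. f x * \<phi> x) - (\<Sum>i\<in>I. c i * \<phi> (t i))"
proof -
  have \<phi>': "test_fun a b (deriv \<phi>)" by (rule test_fun_deriv[OF \<phi>])
  have li: "locally_integrable a b (pw_prim l 0 f {} t c)"
    by (rule set_integrable_imp_locally_integrable[OF set_integrable_pw_prim[OF f ab]])
  have i1: "integrable lebesgue (\<lambda>x. integral {l..x} f * deriv \<phi> x)"
    using integrable_mult_test_fun[OF li \<phi>'] by (simp add: pw_prim_def)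
  have i3: "integrable lebesgue (\<lambda>x. indicator {t i..} x * deriv \<phi> x)" for i
  proof -
    have "locally_integrable a b (\<lambda>x. indicator {t i..} x)"
      using set_integrable_imp_locally_integrable[OF set_integrable_step[of a b t "\<lambda>_. 1" "{i}"]]
      by (simp add: indicator_def of_bool_def)
    then show ?thesis by (rule integrable_mult_test_fun[OF _ \<phi>'])
  qed
  have "(LINT x|lebesgue. deriv \<phi> x) = (LINT x|lebesgue. indicator {a..} x * deriv \<phi> x)"
    using test_fun_zero[OF \<phi>'] by (intro Bochner_Integration.integral_cong) (force simp: indicator_def)+
  also have "\<dots> = 0"
    using test_fun_zero[OF \<phi>, of a] by (simp add: test_fun_tail_integral[OF \<phi>])
  finally have z: "(LINT x|lebesgue. deriv \<phi> x) = 0" .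
  have "pw_prim l p f I t c x * deriv \<phi> x = p * deriv \<phi> x + integral {l..x} f * deriv \<phi> x
      + (\<Sum>i\<in>I. c i * (indicator {t i..} x * deriv \<phi> x))" for x
    by (auto simp: pw_prim_def ring_distribs sum_distrib_right indicator_def intro!: sum.cong)
  then show ?thesis
    using integrable_test_fun[OF \<phi>'] i1 i3
    by (simp add: z integral_primitive_test_fun[OF f ab \<phi>] test_fun_tail_integral[OF \<phi>] sum_negf)
qed

text \<open>The singular part is a finite sum of Dirac masses, carried by the finite null set of the
  points \<open>t i\<close>. \<open>m c\<close> and \<open>m (\<lambda>i. - c i)\<close> collect the
  positive and the negative coefficients; they are images of point measures on the index set, so
  that masses at coinciding points add up.\<close>

lemma has_ac_deriv_pw_prim:
  assumes f: "set_integrable lebesgue {l..u} f" and ab: "l \<le> a" "b \<le> u" and I: "finite I"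
  shows "has_ac_deriv a b (pw_prim l p f I t c) f"
proof -
  define m where "m d = distr (point_measure I (\<lambda>i. ennreal (max 0 (d i)))) borel t" for d :: "nat \<Rightarrow> real"
  have t: "t \<in> measurable (point_measure I (\<lambda>i. ennreal (max 0 (d i)))) borel" for d :: "nat \<Rightarrow> real"
    by (simp add: point_measure_def)
  have fin: "finite_measure (point_measure I (\<lambda>i. ennreal (max 0 (d i))))" for d :: "nat \<Rightarrow> real"
    using I by (intro finite_measureI) (auto simp: space_point_measure emeasure_point_measure_finite)
  have m1: "finite_measure (m d)" for d
    unfolding m_def by (rule finite_measure.finite_measure_distr[OF fin t])
  have m2: "sets (m d) = sets borel" for d by (simp add: m_def)
  have N: "t ` I \<in> null_sets lborel"
    using I by (intro countable_imp_null_set_lborel countable_finite) auto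
  then have [measurable]: "t ` I \<in> sets borel" by auto
  have m3: "- (t ` I) \<in> null_sets (m d)" for d
  proof -
    have "t -` (- (t ` I)) \<inter> space (point_measure I (\<lambda>i. ennreal (max 0 (d i)))) = {}"
      by (auto simp: space_point_measure)
    then show ?thesis
      using t[of d] by (auto simp: null_sets_def m_def emeasure_distr)
  qed
  have m4: "(LINT x|m d. \<phi> x) = (\<Sum>i\<in>I. max 0 (d i) * \<phi> (t i))" if "\<phi> \<in> borel_measurable borel" for d \<phi>
    unfolding m_def using I that t
    by (subst integral_distr) (auto simp: lebesgue_integral_point_measure_finite)
  have "- (LINT x:{a<..<b}|lebesgue. pw_prim l p f I t c x * deriv \<phi> x) =
           (LINT x:{a<..<b}|lebesgue. f x * \<phi> x) + (LINT x|m c. \<phi> x) - (LINT x|m (\<lambda>i. - c i). \<phi> x)"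
    if \<phi>: "test_fun a b \<phi>" for \<phi>
  proof -
    have "(\<Sum>i\<in>I. c i * \<phi> (t i)) = (\<Sum>i\<in>I. max 0 (c i) * \<phi> (t i)) - (\<Sum>i\<in>I. max 0 (- c i) * \<phi> (t i))"
      unfolding sum_subtractf[symmetric] by (intro sum.cong refl) (auto simp: max_def algebra_simps)
    then show ?thesis
      unfolding set_integral_test_fun[OF \<phi>] set_integral_test_fun[OF test_fun_deriv[OF \<phi>]]
        integral_pw_prim_test_fun[OF f ab \<phi>] m4[OF test_fun_measurable[OF \<phi>]]
      by simp
  qed
  moreover have "locally_integrable a b (pw_prim l p f I t c)"
    by (rule set_integrable_imp_locally_integrable[OF set_integrable_pw_prim[OF f ab]])
  moreover have "set_integrable lebesgue {a<..<b} f"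
    by (rule set_integrable_subset[OF f]) (use ab in auto)
  ultimately show ?thesis
    unfolding has_ac_deriv_def using m1 m2 m3 N by blast
qed

lemma ac_deriv_pw_prim:
  assumes f: "set_integrable lebesgue {l..u} f" and ab: "l \<le> a" "b \<le> u" and I: "finite I"
    and v: "AE x in lebesgue. x \<in> {a<..<b} \<longrightarrow> v x = pw_prim l p f I t c x"
  shows "AE x in lebesgue. x \<in> {a<..<b} \<longrightarrow> ac_deriv a b v x = f x"
proof -
  have "has_ac_deriv a b v f"
    using has_ac_deriv_cong_AE[OF AE_sym[OF v] has_ac_deriv_pw_prim[OF f ab I]] .
  then show ?thesis
    unfolding ac_deriv_def by (metis has_ac_deriv_unique someI_ex)
qed

lemma isCont_pw_prim:
  assumes f: "set_integrable lebesgue {l..u} f" and x: "l < x" "x < u"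
    and c: "\<And>i. i \<in> I \<Longrightarrow> t i = x \<Longrightarrow> c i = 0"
  shows "isCont (pw_prim l p f I t c) x"
proof -
  have "isCont (\<lambda>x. integral {l..x} f) x"
    using continuous_on_interior[OF continuous_on_primitive[OF f]] x by simp
  moreover have "isCont (\<lambda>x. if t i \<le> x then c i else 0) x" if "i \<in> I" for i
  proof (cases "t i = x")
    case True
    then have "(\<lambda>x. if t i \<le> x then c i else 0) = (\<lambda>_. 0)" using c that by auto
    then show ?thesis by simp
  next
    case False
    have "eventually (\<lambda>y. (t i \<le> y) = (t i \<le> x)) (nhds x)"
    proof (cases "t i \<le> x")
      case True
      then have "eventually (\<lambda>y. y \<in> {t i<..}) (nhds x)"
        using False by (intro eventually_nhds_in_open) auto
      then show ?thesis using True by (auto elim: eventually_mono)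
    next
      case F: False
      then have "eventually (\<lambda>y. y \<in> {..<t i}) (nhds x)"
        by (intro eventually_nhds_in_open) auto
      then show ?thesis using F by (auto elim: eventually_mono)
    qed
    then have "eventually (\<lambda>y. (if t i \<le> y then c i else 0) = (if t i \<le> x then c i else 0)) (nhds x)"
      by (rule eventually_mono) simp
    then have "isCont (\<lambda>y. if t i \<le> y then c i else 0) x \<longleftrightarrow> isCont (\<lambda>y. if t i \<le> x then c i else 0) x"
      by (rule isCont_cong)
    then show ?thesis by simp
  qed
  ultimately show ?thesis
    unfolding pw_prim_def[abs_def] by (intro continuous_intros)
qed

text \<open>A jump is detected by splitting it off: the rest \<open>r\<close> is continuous at
  \<open>x = t j\<close>, so a representative \<open>g\<close> continuous there would make
  \<open>g - r\<close> tend to 0 from the left and to \<open>c j\<close> from the right. Injectivity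
  of \<open>t\<close> prevents jumps at one point from cancelling.\<close>

lemma disc_set_pw_prim:
  assumes f: "set_integrable lebesgue {l..u} f" and ab: "l \<le> a" "b \<le> u"
    and I: "finite I" "inj_on t I"
  shows "disc_set a b (pw_prim l p f I t c) = {t i |i. i \<in> I \<and> c i \<noteq> 0} \<inter> {a<..<b}"
proof (intro subset_antisym subsetI)
  fix x assume x: "x \<in> disc_set a b (pw_prim l p f I t c)"
  then have "a < x" "x < b" "\<not> isCont (pw_prim l p f I t c) x"
    by (auto simp: disc_set_def)
  then show "x \<in> {t i |i. i \<in> I \<and> c i \<noteq> 0} \<inter> {a<..<b}"
    using isCont_pw_prim[OF f, of x I t c p] ab by auto
next
  fix x assume "x \<in> {t i |i. i \<in> I \<and> c i \<noteq> 0} \<inter> {a<..<b}"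
  then obtain j where j: "j \<in> I" "c j \<noteq> 0" "x = t j" and x: "a < x" "x < b" by auto
  define r where "r = pw_prim l p f I t (c(j := 0))"
  have r: "isCont r x"
    unfolding r_def using I j x ab by (intro isCont_pw_prim[OF f]) (auto simp: inj_on_def)
  have eq: "pw_prim l p f I t c y = r y + (if x \<le> y then c j else 0)" for y
  proof -
    have "(\<Sum>i\<in>I. if t i \<le> y then c i else 0) = (if t j \<le> y then c j else 0) + (\<Sum>i\<in>I-{j}. if t i \<le> y then c i else 0)"
      using I j by (simp add: sum.remove)
    moreover have "(\<Sum>i\<in>I. if t i \<le> y then (c(j := 0)) i else 0) = (\<Sum>i\<in>I-{j}. if t i \<le> y then c i else 0)"
    proof -
      have "(\<Sum>i\<in>I-{j}. if t i \<le> y then (c(j := 0)) i else 0) = (\<Sum>i\<in>I-{j}. if t i \<le> y then c i else 0)"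
        by (rule sum.cong[OF refl]) (metis DiffE fun_upd_other singletonI)
      then show ?thesis
        unfolding sum.remove[OF I(1) j(1), of "\<lambda>i. if t i \<le> y then (c(j := 0)) i else 0"] by simp
    qed
    ultimately show ?thesis by (simp add: r_def pw_prim_def j(3))
  qed
  have False if g: "AE y in lebesgue. y \<in> {a<..<b} \<longrightarrow> g y = pw_prim l p f I t c y" "isCont g x" for g
  proof -
    have h: "isCont (\<lambda>y. g y - r y) x" using g(2) r by (intro continuous_intros)
    have "AE y in lebesgue. y \<in> {a<..<x} \<longrightarrow> g y - r y = 0"
      using g(1) by (rule eventually_mono) (use x eq in auto)
    moreover have "((\<lambda>y. g y - r y) \<longlongrightarrow> g x - r x) (at_left x)"
      using h unfolding isCont_def filterlim_at_split by simp
    ultimately have 1: "g x - r x = 0" by (rule AE_tendsto_at_left) (use x in auto)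
    have "AE y in lebesgue. y \<in> {x<..<b} \<longrightarrow> g y - r y = c j"
      using g(1) by (rule eventually_mono) (use x eq in auto)
    moreover have "((\<lambda>y. g y - r y) \<longlongrightarrow> g x - r x) (at_right x)"
      using h unfolding isCont_def filterlim_at_split by simp
    ultimately have "g x - r x = c j" by (rule AE_tendsto_at_right) (use x in auto)
    with 1 j show False by simp
  qed
  then show "x \<in> disc_set a b (pw_prim l p f I t c)"
    using x by (auto simp: disc_set_def)
qed

subsection \<open>Square-integrable functions supported in an interval\<close>

text \<open>The extension by zero is part of the notion: norms become integrals over the whole line,
  and one function can be regarded on (-1,1) and on (-2,2) alike.\<close>

definition L2_supp :: "real \<Rightarrow> real \<Rightarrow> (real \<Rightarrow> real) \<Rightarrow> bool" where
  "L2_supp l u g \<longleftrightarrow> g \<in> borel_measurable lebesgue \<and> integrable lebesgue (\<lambda>x. (g x)\<^sup>2) \<and>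
     (\<forall>x. x \<notin> {l<..<u} \<longrightarrow> g x = 0)"

lemma L2_supp_restrict:
  assumes "f \<in> L2 a b" shows "L2_supp a b (\<lambda>x. indicator {a<..<b} x * f x)"
proof -
  have "(\<lambda>x. (indicator {a<..<b} x * f x)\<^sup>2) = (\<lambda>x. indicator {a<..<b} x *\<^sub>R (f x)\<^sup>2)"
    by (auto simp: indicator_def)
  then show ?thesis
    using assms by (auto simp: L2_def L2_supp_def set_borel_measurable_def set_integrable_def)
qed

lemma L2_supp_mono: "L2_supp a b g \<Longrightarrow> l \<le> a \<Longrightarrow> b \<le> u \<Longrightarrow> L2_supp l u g"
  unfolding L2_supp_def by auto

lemma L2_supp_cmult: "L2_supp l u g \<Longrightarrow> L2_supp l u (\<lambda>x. c * g x)"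
  unfolding L2_supp_def by (auto simp: power_mult_distrib)

lemma L2_supp_mult:
  assumes f: "L2_supp l u f" and g: "L2_supp l u g"
  shows "integrable lebesgue (\<lambda>x. f x * g x)"
proof (rule Bochner_Integration.integrable_bound)
  show "integrable lebesgue (\<lambda>x. (f x)\<^sup>2 + (g x)\<^sup>2)"
    using assms by (auto simp: L2_supp_def)
  show "(\<lambda>x. f x * g x) \<in> borel_measurable lebesgue"
    using assms by (auto simp: L2_supp_def)
  have "\<bar>a * b\<bar> \<le> a\<^sup>2 + b\<^sup>2" for a b :: real
    using sum_squares_bound[of a b] sum_squares_bound[of a "-b"] zero_le_power2[of a] zero_le_power2[of b]
    by (simp add: abs_le_iff)
  then show "AE x in lebesgue. norm (f x * g x) \<le> norm ((f x)\<^sup>2 + (g x)\<^sup>2)"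
    by (intro AE_I2) (simp add: abs_of_nonneg)
qed

lemma L2_supp_add:
  assumes f: "L2_supp l u f" and g: "L2_supp l u g"
  shows "L2_supp l u (\<lambda>x. f x + g x)"
proof -
  have "integrable lebesgue (\<lambda>x. (f x)\<^sup>2 + (g x)\<^sup>2 + 2 * (f x * g x))"
    using assms L2_supp_mult[OF assms] by (auto simp: L2_supp_def)
  then show ?thesis
    using assms by (auto simp: L2_supp_def power2_sum mult.assoc)
qed

lemma L2_supp_diff: "L2_supp l u f \<Longrightarrow> L2_supp l u g \<Longrightarrow> L2_supp l u (\<lambda>x. f x - g x)"
  using L2_supp_add[OF _ L2_supp_cmult[where c = "-1"]] by fastforce

lemma L2_supp_0: "L2_supp l u (\<lambda>_. 0)"
  by (simp add: L2_supp_def)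

lemma L2_supp_sum:
  "finite A \<Longrightarrow> (\<And>i. i \<in> A \<Longrightarrow> L2_supp l u (f i)) \<Longrightarrow> L2_supp l u (\<lambda>x. \<Sum>i\<in>A. f i x)"
  by (induction A rule: finite_induct) (auto intro: L2_supp_0 L2_supp_add)

lemma L2_supp_indicator: "L2_supp l u (indicator {l<..<u})"
proof -
  have "(\<lambda>x. (indicator {l<..<u} x)\<^sup>2) = (\<lambda>x. indicator {l<..<u} x :: real)"
    by (auto simp: indicator_def)
  moreover have "emeasure lebesgue {l<..<u} < \<infinity>"
    using emeasure_bounded_finite[of "{l<..<u}"] by simp
  ultimately show ?thesis
    unfolding L2_supp_def by (auto intro!: borel_measurable_indicator integrable_real_indicator)
qed

lemma L2_supp_integrable:
  assumes "L2_supp l u g" shows "integrable lebesgue g"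
proof -
  have "(\<lambda>x. g x * indicator {l<..<u} x) = g"
    using assms by (auto simp: L2_supp_def indicator_def fun_eq_iff)
  then show ?thesis using L2_supp_mult[OF assms L2_supp_indicator] by simp
qed

lemma L2_supp_set_integrable:
  assumes "L2_supp l u g" "A \<in> sets lebesgue" shows "set_integrable lebesgue A g"
  unfolding set_integrable_def by (rule integrable_mult_indicator[OF assms(2) L2_supp_integrable[OF assms(1)]])

lemma L2_supp_imp_L2:
  assumes "L2_supp l u g" shows "g \<in> L2 a b"
proof -
  have "set_borel_measurable lebesgue {a<..<b} g"
    using L2_supp_set_integrable[OF assms, of "{a<..<b}"]
    by (auto simp: set_borel_measurable_def set_integrable_def)
  moreover have "set_integrable lebesgue {a<..<b} (\<lambda>x. (g x)\<^sup>2)"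
    unfolding set_integrable_def
    by (rule integrable_mult_indicator) (use assms in \<open>auto simp: L2_supp_def\<close>)
  ultimately show ?thesis by (simp add: L2_def)
qed

lemma L2_imp_set_integrable:
  assumes "f \<in> L2 a b" shows "set_integrable lebesgue {a<..<b} f"
  using L2_supp_integrable[OF L2_supp_restrict[OF assms]] by (simp add: set_integrable_def)

lemma L2_mult_set_integrable:
  assumes "f \<in> L2 a b" "g \<in> L2 a b" shows "set_integrable lebesgue {a<..<b} (\<lambda>x. f x * g x)"
proof -
  have "(\<lambda>x. indicator {a<..<b} x * f x * (indicator {a<..<b} x * g x)) =
      (\<lambda>x. indicator {a<..<b} x *\<^sub>R (f x * g x))"
    by (auto simp: indicator_def)
  then show ?thesis
    using L2_supp_mult[OF assms[THEN L2_supp_restrict]] by (simp add: set_integrable_def)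
qed

lemma L2_cong_AE:
  assumes "AE x in lebesgue. x \<in> {a<..<b} \<longrightarrow> f x = g x" "f \<in> L2 a b"
  shows "g \<in> L2 a b"
proof -
  have "AE x in lebesgue. indicator {a<..<b} x *\<^sub>R f x = indicator {a<..<b} x *\<^sub>R g x"
    by (rule eventually_mono[OF assms(1)]) (auto simp: indicator_def)
  then have "set_borel_measurable lebesgue {a<..<b} g"
    using assms(2) unfolding L2_def set_borel_measurable_def by (auto intro: borel_measurable_AE)
  moreover have "set_integrable lebesgue {a<..<b} (\<lambda>x. (g x)\<^sup>2)"
    by (rule set_integrable_lebesgue_cong_AE[of _ "\<lambda>x. (f x)\<^sup>2"])
       (use assms in \<open>auto simp: L2_def elim: eventually_mono\<close>)
  ultimately show ?thesis by (simp add: L2_def)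
qed

lemma bounded_imp_L2:
  assumes "set_borel_measurable lebesgue {a<..<b} f" "\<And>x. x \<in> {a<..<b} \<Longrightarrow> \<bar>f x\<bar> \<le> B"
  shows "f \<in> L2 a b"
proof -
  have "set_integrable lebesgue {a<..<b} (\<lambda>x. (f x)\<^sup>2)"
    unfolding set_integrable_def
  proof (rule Bochner_Integration.integrable_bound)
    show "integrable lebesgue (\<lambda>x. indicator {a<..<b} x *\<^sub>R B\<^sup>2)"
      using set_integrable_const_interval[of a b "B\<^sup>2"] by (simp add: set_integrable_def)
    have "(\<lambda>x. indicator {a<..<b} x *\<^sub>R (f x)\<^sup>2) = (\<lambda>x. (indicator {a<..<b} x *\<^sub>R f x)\<^sup>2)"
      by (auto simp: indicator_def)
    then show "(\<lambda>x. indicator {a<..<b} x *\<^sub>R (f x)\<^sup>2) \<in> borel_measurable lebesgue"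
      using assms(1) by (auto simp: set_borel_measurable_def)
    have "(f x)\<^sup>2 \<le> B\<^sup>2" if "x \<in> {a<..<b}" for x
      using power_mono[OF assms(2)[OF that], of 2] by simp
    then show "AE x in lebesgue. norm (indicator {a<..<b} x *\<^sub>R (f x)\<^sup>2) \<le> norm (indicator {a<..<b} x *\<^sub>R B\<^sup>2)"
      by (intro AE_I2) (auto simp: indicator_def)
  qed
  with assms(1) show ?thesis by (simp add: L2_def)
qed

lemma pw_prim_bounded:
  assumes f: "set_integrable lebesgue {l..u} f" and x: "x \<in> {l..u}"
  shows "\<bar>pw_prim l p f I t c x\<bar> \<le> \<bar>p\<bar> + (LINT x:{l..u}|lebesgue. \<bar>f x\<bar>) + (\<Sum>i\<in>I. \<bar>c i\<bar>)"
proof -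
  have fx: "set_integrable lebesgue {l..x} f"
    by (rule set_integrable_subset[OF f]) (use x in auto)
  have "integral {l..x} f = (LINT x:{l..x}|lebesgue. f x)"
    by (rule set_lebesgue_integral_eq_integral(2)[symmetric, OF fx])
  also have "\<bar>\<dots>\<bar> \<le> (LINT x:{l..x}|lebesgue. \<bar>f x\<bar>)"
    using set_integral_norm_bound[OF fx] by simp
  also have "\<dots> \<le> (LINT x:{l..u}|lebesgue. \<bar>f x\<bar>)"
    unfolding set_lebesgue_integral_def
    by (rule integral_mono)
       (use set_integrable_abs[OF f] set_integrable_abs[OF fx] x in \<open>auto simp: set_integrable_def indicator_def\<close>)
  finally have 1: "\<bar>integral {l..x} f\<bar> \<le> (LINT x:{l..u}|lebesgue. \<bar>f x\<bar>)" .
  have "\<bar>\<Sum>i\<in>I. if t i \<le> x then c i else 0\<bar> \<le> (\<Sum>i\<in>I. \<bar>c i\<bar>)"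
    by (rule order_trans[OF sum_abs]) (auto intro!: sum_mono)
  then show ?thesis
    using 1 by (simp add: pw_prim_def)
qed

lemma pw_prim_L2:
  assumes f: "set_integrable lebesgue {l..u} f" and ab: "l \<le> a" "b \<le> u"
  shows "pw_prim l p f I t c \<in> L2 a b"
proof (rule bounded_imp_L2)
  show "set_borel_measurable lebesgue {a<..<b} (pw_prim l p f I t c)"
    using set_integrable_pw_prim[OF f ab]
    by (auto simp: set_borel_measurable_def set_integrable_def)
qed (rule pw_prim_bounded[OF f], use ab in auto)

lemma set_integrable_pw_prim':
  assumes "set_integrable lebesgue {l..u} f"
  shows "set_integrable lebesgue {l..u} (pw_prim l p f I t c)"
  using set_integrable_pw_prim[OF assms, of l u] by (simp add: set_integrable_open_interval)

subsection \<open>Sobolev functions as iterated primitives\<close>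

lemma has_weak_deriv_unique:
  assumes "has_weak_deriv k a b v w" "has_weak_deriv k a b v w'"
  shows "AE x in lebesgue. x \<in> {a<..<b} \<longrightarrow> w x = w' x"
proof -
  have l: "locally_integrable a b w" "locally_integrable a b w'"
    using assms by (auto simp: has_weak_deriv_def)
  have "AE x in lebesgue. x \<in> {a<..<b} \<longrightarrow> w x - w' x = 0"
  proof (rule fundamental_lemma)
    show "locally_integrable a b (\<lambda>x. w x - w' x)"
      using l unfolding locally_integrable_def by (intro allI impI set_integral_diff(1)) blast+
    fix \<phi> assume \<phi>: "test_fun a b \<phi>"
    have "(-1) ^ k * (LINT x|lebesgue. w x * \<phi> x) = (-1) ^ k * (LINT x|lebesgue. w' x * \<phi> x)"
      using assms \<phi> unfolding has_weak_deriv_def set_integral_test_fun[OF \<phi>, symmetric] by simp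
    then show "(LINT x|lebesgue. (w x - w' x) * \<phi> x) = 0"
      using l[THEN integrable_mult_test_fun, OF \<phi>] by (simp add: left_diff_distrib)
  qed
  then show ?thesis by simp
qed

lemma has_weak_deriv_cong_AE:
  assumes "AE x in lebesgue. x \<in> {a<..<b} \<longrightarrow> v x = v' x" "has_weak_deriv k a b v w"
  shows "has_weak_deriv k a b v' w"
proof -
  have "(LINT x:{a<..<b}|lebesgue. v' x * (deriv ^^ k) \<phi> x) = (LINT x:{a<..<b}|lebesgue. v x * (deriv ^^ k) \<phi> x)" for \<phi>
    by (rule set_integral_lebesgue_cong_AE) (rule eventually_mono[OF assms(1)], auto)
  then show ?thesis
    using assms locally_integrable_cong_AE[OF assms(1)] unfolding has_weak_deriv_def by simp
qed

lemma has_weak_deriv_1_iff: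
  "has_weak_deriv 1 a b v w \<longleftrightarrow> locally_integrable a b v \<and> locally_integrable a b w \<and>
     (\<forall>\<phi>. test_fun a b \<phi> \<longrightarrow> (LINT x|lebesgue. v x * deriv \<phi> x) = - (LINT x|lebesgue. w x * \<phi> x))"
  unfolding has_weak_deriv_def by (simp add: set_integral_test_fun test_fun_deriv)

lemma has_weak_deriv_2_iff:
  "has_weak_deriv 2 a b v w \<longleftrightarrow> locally_integrable a b v \<and> locally_integrable a b w \<and>
     (\<forall>\<phi>. test_fun a b \<phi> \<longrightarrow> (LINT x|lebesgue. v x * deriv (deriv \<phi>) x) = (LINT x|lebesgue. w x * \<phi> x))"
  unfolding has_weak_deriv_def by (simp add: numeral_2_eq_2 set_integral_test_fun test_fun_deriv)

lemma integral_test_fun_cong_AE: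
  assumes "AE x in lebesgue. x \<in> {a<..<b} \<longrightarrow> v x = w x" "test_fun a b \<phi>"
  shows "(LINT x|lebesgue. v x * \<phi> x) = (LINT x|lebesgue. w x * \<phi> x)"
proof (rule integral_lebesgue_cong_AE, rule eventually_mono[OF assms(1)])
  fix x assume "x \<in> {a<..<b} \<longrightarrow> v x = w x"
  then show "v x * \<phi> x = w x * \<phi> x"
    using test_fun_zero[OF assms(2), of x] by (cases "x \<in> {a<..<b}") auto
qed

text \<open>The difference of \<open>v\<close> and a primitive of \<open>f\<close> has zero
  derivative and is constant by \<open>du_bois_reymond\<close>. The primitive starts at
  \<open>l\<close> and not at \<open>a\<close>, so that all pieces of a partition share one
  primitive and differ only in \<open>p\<close>.\<close>

lemma weak_deriv_imp_primitive:
  assumes ab: "a < b" "l \<le> a" "b \<le> u" and f: "set_integrable lebesgue {l..u} f"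
    and v: "set_integrable lebesgue {a<..<b} v"
    and vf: "\<And>\<phi>. test_fun a b \<phi> \<Longrightarrow> (LINT x|lebesgue. v x * deriv \<phi> x) = - (LINT x|lebesgue. f x * \<phi> x)"
  obtains p where "AE x in lebesgue. x \<in> {a<..<b} \<longrightarrow> v x = pw_prim l p f {} t c x"
proof -
  let ?F = "pw_prim l 0 f {} t c"
  have F: "set_integrable lebesgue {a<..<b} ?F"
    by (rule set_integrable_pw_prim[OF f ab(2,3)])
  obtain p where "AE x in lebesgue. x \<in> {a<..<b} \<longrightarrow> v x - ?F x = p"
  proof (rule du_bois_reymond[OF set_integral_diff(1)[OF v F] ab(1)])
    fix \<phi> assume \<phi>: "test_fun a b \<phi>"
    note i = integrable_mult_test_fun[OF set_integrable_imp_locally_integrable test_fun_deriv[OF \<phi>]]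
    show "(LINT x|lebesgue. (v x - ?F x) * deriv \<phi> x) = 0"
      using i[OF v] i[OF F]
      by (simp add: left_diff_distrib vf[OF \<phi>] integral_pw_prim_test_fun[OF f ab(2,3) \<phi>])
  qed blast
  then have "AE x in lebesgue. x \<in> {a<..<b} \<longrightarrow> v x = pw_prim l p f {} t c x"
    by (rule eventually_mono) (auto simp: pw_prim_def)
  then show thesis by (rule that)
qed

lemma Sobolev_H_weak_deriv:
  "v \<in> Sobolev_H m a b \<Longrightarrow> 1 \<le> k \<Longrightarrow> k \<le> m \<Longrightarrow> \<exists>w\<in>L2 a b. has_weak_deriv k a b v w"
  by (simp add: Sobolev_H_def)

lemma Sobolev_H2_primitive:
  assumes ab: "a < b" "l \<le> a" "b \<le> u" and v: "v \<in> Sobolev_H 2 a b"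
    and g: "set_integrable lebesgue {l..u} g"
    and w: "has_weak_deriv 2 a b v w" "AE x in lebesgue. x \<in> {a<..<b} \<longrightarrow> w x = g x"
  obtains p q where "AE x in lebesgue. x \<in> {a<..<b} \<longrightarrow> v x = pw_prim l p (pw_prim l q g {} t c) {} t' c' x"
proof -
  obtain z where z: "z \<in> L2 a b" "has_weak_deriv 1 a b v z"
    using Sobolev_H_weak_deriv[OF v, of 1] by auto
  have "v \<in> L2 a b" using v by (simp add: Sobolev_H_def)
  note vi = L2_imp_set_integrable[OF this] and zi = L2_imp_set_integrable[OF z(1)]
  obtain q where q: "AE x in lebesgue. x \<in> {a<..<b} \<longrightarrow> z x = pw_prim l q g {} t c x"
  proof (rule weak_deriv_imp_primitive[OF ab g zi])
    fix \<phi> assume \<phi>: "test_fun a b \<phi>"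
    \<comment> \<open>\<open>Sobolev_H\<close> provides the weak derivatives of each order of
      \<open>v\<close> separately. Testing the first-order relation with \<open>deriv \<phi>\<close>
      identifies the second derivative of \<open>v\<close> as the weak derivative of
      \<open>z\<close>.\<close>
    have "(LINT x|lebesgue. z x * deriv \<phi> x) = - (LINT x|lebesgue. v x * deriv (deriv \<phi>) x)"
      using z(2) test_fun_deriv[OF \<phi>] by (simp add: has_weak_deriv_1_iff del: One_nat_def)
    also have "\<dots> = - (LINT x|lebesgue. w x * \<phi> x)"
      using w(1) \<phi> by (simp add: has_weak_deriv_2_iff)
    also have "\<dots> = - (LINT x|lebesgue. g x * \<phi> x)"
      using integral_test_fun_cong_AE[OF w(2) \<phi>] by simp
    finally show "(LINT x|lebesgue. z x * deriv \<phi> x) = - (LINT x|lebesgue. g x * \<phi> x)" .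
  qed blast
  show thesis
  proof (rule weak_deriv_imp_primitive[OF ab set_integrable_pw_prim'[OF g] vi])
    fix \<phi> assume \<phi>: "test_fun a b \<phi>"
    show "(LINT x|lebesgue. v x * deriv \<phi> x) = - (LINT x|lebesgue. pw_prim l q g {} t c x * \<phi> x)"
      using z(2) \<phi> integral_test_fun_cong_AE[OF q \<phi>] by (simp add: has_weak_deriv_1_iff del: One_nat_def)
  qed (rule that)
qed

lemma Sobolev_H2_pw_prim:
  assumes ab: "l \<le> a" "b \<le> u" and g: "L2_supp l u g"
    and v: "AE x in lebesgue. x \<in> {a<..<b} \<longrightarrow> v x = pw_prim l p (pw_prim l q g {} t c) {} t' c' x"
  shows "v \<in> Sobolev_H 2 a b" "has_weak_deriv 2 a b v g"
proof -
  have gi: "set_integrable lebesgue {l..u} g" by (rule L2_supp_set_integrable[OF g]) simp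
  let ?z = "pw_prim l q g {} t c"
  let ?v = "pw_prim l p ?z {} t' c'"
  note zi = set_integrable_pw_prim'[OF gi, of q "{}" t c]
  have l: "locally_integrable a b ?v" "locally_integrable a b ?z" "locally_integrable a b g"
    using set_integrable_pw_prim[OF gi ab] set_integrable_pw_prim[OF zi ab] L2_supp_set_integrable[OF g]
    by (auto intro: set_integrable_imp_locally_integrable)
  have 1: "has_weak_deriv 1 a b ?v ?z"
    unfolding has_weak_deriv_1_iff using l integral_pw_prim_test_fun[OF zi ab] by simp
  have 2: "has_weak_deriv 2 a b ?v g"
    unfolding has_weak_deriv_2_iff
    using l integral_pw_prim_test_fun[OF gi ab] integral_pw_prim_test_fun[OF zi ab test_fun_deriv] by simp
  show 3: "has_weak_deriv 2 a b v g"
    by (rule has_weak_deriv_cong_AE[OF AE_sym[OF v] 2])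
  have "v \<in> L2 a b"
    by (rule L2_cong_AE[OF AE_sym[OF v] pw_prim_L2[OF zi ab]])
  moreover have "\<exists>w\<in>L2 a b. has_weak_deriv k a b v w" if "k \<in> {1..2}" for k
  proof -
    have "k = 1 \<or> k = 2" using that by (simp, linarith)
    then show ?thesis
    proof
      assume "k = 1"
      then show ?thesis
        using pw_prim_L2[OF gi ab] has_weak_deriv_cong_AE[OF AE_sym[OF v] 1] by blast
    next
      assume "k = 2"
      then show ?thesis using 3 L2_supp_imp_L2[OF g] by blast
    qed
  qed
  ultimately show "v \<in> Sobolev_H 2 a b" by (simp add: Sobolev_H_def)
qed

lemma integral_step:
  fixes t :: real
  assumes "l \<le> t"
  shows "((\<lambda>y. if t \<le> y then b else 0) has_integral (if t \<le> x then b * (x - t) else 0)) {l..x}"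
proof (cases "t \<le> x")
  case True
  have "((\<lambda>y. b) has_integral b * (x - t)) {t..x}"
    using has_integral_const_real[of b t x] True by (simp add: mult.commute)
  then have "((\<lambda>y. if y \<in> {t..x} then b else 0) has_integral b * (x - t)) {l..x}"
    using assms by (subst has_integral_restrict) auto
  then show ?thesis
    using True by (simp, elim has_integral_eq[rotated]) auto
next
  case False
  then show ?thesis by (auto intro!: has_integral_is_0)
qed

text \<open>Each crease \<open>b i\<close> integrates to \<open>b i * (x - t i)\<close> beyond
  \<open>t i\<close>. Here \<open>l \<le> t i\<close> matters: an earlier crease would be integrated
  from \<open>l\<close> only.\<close>

lemma pw_prim_pw_prim:
  assumes g: "set_integrable lebesgue {l..u} g" and x: "x \<in> {l..u}"
    and I: "finite I" "\<And>i. i \<in> I \<Longrightarrow> l \<le> t i"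
  shows "pw_prim l p (pw_prim l q g I t b) I t a x = p + q * (x - l) + integral {l..x} (\<lambda>y. integral {l..y} g)
    + (\<Sum>i\<in>I. if t i \<le> x then a i + b i * (x - t i) else 0)"
proof -
  have c: "continuous_on {l..x} (\<lambda>y. integral {l..y} g)"
    using x by (intro continuous_on_subset[OF continuous_on_primitive[OF g]]) auto
  have "((\<lambda>y. q + integral {l..y} g + (\<Sum>i\<in>I. if t i \<le> y then b i else 0)) has_integral
     (x - l) * q + integral {l..x} (\<lambda>y. integral {l..y} g) + (\<Sum>i\<in>I. if t i \<le> x then b i * (x - t i) else 0)) {l..x}"
    using has_integral_const_real[of q l x] x I c
    by (intro has_integral_add has_integral_sum integral_step integrable_integral integrable_continuous_real) auto
  then have "integral {l..x} (pw_prim l q g I t b) =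
     (x - l) * q + integral {l..x} (\<lambda>y. integral {l..y} g) + (\<Sum>i\<in>I. if t i \<le> x then b i * (x - t i) else 0)"
    unfolding pw_prim_def[abs_def] by (rule integral_unique)
  moreover have "(\<Sum>i\<in>I. if t i \<le> x then a i + b i * (x - t i) else 0) =
     (\<Sum>i\<in>I. if t i \<le> x then b i * (x - t i) else 0) + (\<Sum>i\<in>I. if t i \<le> x then a i else 0)"
    unfolding sum.distrib[symmetric] by (rule sum.cong) auto
  ultimately show ?thesis
    unfolding pw_prim_def[of l p] by (simp add: mult.commute)
qed

lemma partition_piece:
  fixes s :: "nat \<Rightarrow> real"
  assumes "s 0 < x" "x < s n" "x \<notin> s ` {..n}"
  shows "\<exists>k<n. s k < x \<and> x < s (Suc k)"
  using assms
proof (induction n)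
  case (Suc n)
  show ?case
  proof (cases "x < s n")
    case True
    have "x \<notin> s ` {..n}" using Suc.prems(3) by (auto simp: atMost_Suc)
    then show ?thesis using Suc.IH[OF Suc.prems(1) True] less_SucI by blast
  next
    case False
    then have "s n < x" using Suc.prems(3) by force
    then show ?thesis using Suc.prems by blast
  qed
qed simp

lemma partition_less:
  fixes s :: "nat \<Rightarrow> real"
  assumes "\<And>i. i < n \<Longrightarrow> s i < s (Suc i)" "i < j" "j \<le> n"
  shows "s i < s j"
  using assms(2,3)
proof (induction j)
  case (Suc j)
  then show ?case using assms(1)[of j] by (cases "i = j") auto
qed simp

lemma AE_notin_finite: "finite A \<Longrightarrow> AE x in lebesgue. x \<notin> (A :: real set)"
  by (intro AE_completion AE_not_in countable_imp_null_set_lborel countable_finite)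

text \<open>On each piece \<open>v\<close> is the double primitive of one common \<open>g\<close>
  plus an affine function. The affine function changes from piece to piece; its changes in value and
  in slope at the interior partition points are the jumps and creases.\<close>

lemma piecewise_H2_imp_pw_prim:
  assumes v: "v \<in> piecewise_H2 l u" and "l < u"
  obtains p q g I t a b where "L2_supp l u g" "finite I" "inj_on t I" "t ` I \<subseteq> {l<..<u}"
    "AE x in lebesgue. x \<in> {l<..<u} \<longrightarrow> v x = pw_prim l p (pw_prim l q g I t b) I t a x"
proof -
  obtain n s where s: "s 0 = l" "s n = u" "\<And>i. i < n \<Longrightarrow> s i < s (Suc i)"
    "\<And>i. i < n \<Longrightarrow> v \<in> Sobolev_H 2 (s i) (s (Suc i))"
    using v unfolding piecewise_H2_def by blast
  note lt = partition_less[of n s, OF s(3)]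
  have le: "s i \<le> s j" if "i \<le> j" "j \<le> n" for i j
    using lt[of i j] that by (cases "i = j") auto
  have ends: "l \<le> s i" "s i \<le> u" if "i \<le> n" for i
    using le[of 0 i] le[of i n] that s(1,2) by auto
  have "\<forall>i\<in>{..<n}. \<exists>w. w \<in> L2 (s i) (s (Suc i)) \<and> has_weak_deriv 2 (s i) (s (Suc i)) v w"
  proof
    fix i assume "i \<in> {..<n}"
    then have "\<exists>w\<in>L2 (s i) (s (Suc i)). has_weak_deriv 2 (s i) (s (Suc i)) v w"
      by (intro Sobolev_H_weak_deriv[OF s(4)]) auto
    then show "\<exists>w. w \<in> L2 (s i) (s (Suc i)) \<and> has_weak_deriv 2 (s i) (s (Suc i)) v w"
      by blast
  qed
  then obtain w where w: "\<And>i. i < n \<Longrightarrow> w i \<in> L2 (s i) (s (Suc i))"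
    "\<And>i. i < n \<Longrightarrow> has_weak_deriv 2 (s i) (s (Suc i)) v (w i)"
    using bchoice[of "{..<n}" "\<lambda>i w. w \<in> L2 (s i) (s (Suc i)) \<and> has_weak_deriv 2 (s i) (s (Suc i)) v w"]
    by auto
  define g where "g x = (\<Sum>i<n. indicator {s i<..<s (Suc i)} x * w i x)" for x
  have g: "L2_supp l u g"
    unfolding g_def[abs_def]
  proof (intro L2_supp_sum)
    fix i assume "i \<in> {..<n}"
    then have "i < n" "l \<le> s i" "s (Suc i) \<le> u" using ends[of i] ends[of "Suc i"] by auto
    then show "L2_supp l u (\<lambda>x. indicator {s i<..<s (Suc i)} x * w i x)"
      by (intro L2_supp_mono[OF L2_supp_restrict[OF w(1)]])
  qed simp
  then have gi: "set_integrable lebesgue {l..u} g" by (rule L2_supp_set_integrable) simp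
  have gw: "w i x = g x" if "i < n" "x \<in> {s i<..<s (Suc i)}" for i x
  proof -
    have "indicator {s j<..<s (Suc j)} x * w j x = 0" if j: "j \<in> {..<n} - {i}" for j
    proof (cases "j < i")
      case True
      then have "s (Suc j) \<le> s i" using \<open>i < n\<close> by (intro le) auto
      then show ?thesis using \<open>x \<in> _\<close> by (auto simp: indicator_def)
    next
      case False
      then have "s (Suc i) \<le> s j" using j by (intro le) auto
      then show ?thesis using \<open>x \<in> _\<close> by (auto simp: indicator_def)
    qed
    then have "(\<Sum>j\<in>{..<n}-{i}. indicator {s j<..<s (Suc j)} x * w j x) = 0"
      by (rule sum.neutral[rule_format])
    moreover have "g x = indicator {s i<..<s (Suc i)} x * w i x
        + (\<Sum>j\<in>{..<n}-{i}. indicator {s j<..<s (Suc j)} x * w j x)"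
      unfolding g_def using that(1) by (intro sum.remove) auto
    ultimately show ?thesis
      using that(2) by simp
  qed
  have "\<forall>i\<in>{..<n}. \<exists>r. AE x in lebesgue. x \<in> {s i<..<s (Suc i)} \<longrightarrow>
      v x = pw_prim l (fst r) (pw_prim l (snd r) g {} (\<lambda>_. 0) (\<lambda>_. 0)) {} (\<lambda>_. 0) (\<lambda>_. 0) x"
  proof
    fix i assume i: "i \<in> {..<n}"
    then have i': "i < n" by simp
    have lu: "l \<le> s i" "s (Suc i) \<le> u" using ends[of i] ends[of "Suc i"] i by auto
    have "AE x in lebesgue. x \<in> {s i<..<s (Suc i)} \<longrightarrow> w i x = g x"
      using gw[OF i'] by (intro AE_I2) simp
    from Sobolev_H2_primitive[OF s(3)[OF i'] lu s(4)[OF i'] gi w(2)[OF i'] this]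
    show "\<exists>r. AE x in lebesgue. x \<in> {s i<..<s (Suc i)} \<longrightarrow>
      v x = pw_prim l (fst r) (pw_prim l (snd r) g {} (\<lambda>_. 0) (\<lambda>_. 0)) {} (\<lambda>_. 0) (\<lambda>_. 0) x"
      by (metis fst_conv snd_conv)
  qed
  from bchoice[OF this] obtain r where r: "\<And>i. i < n \<Longrightarrow> AE x in lebesgue. x \<in> {s i<..<s (Suc i)} \<longrightarrow>
      v x = pw_prim l (fst (r i)) (pw_prim l (snd (r i)) g {} (\<lambda>_. 0) (\<lambda>_. 0)) {} (\<lambda>_. 0) (\<lambda>_. 0) x"
    by auto
  define A B where "A i = fst (r i)" and "B i = snd (r i)" for i
  \<comment> \<open>The jump at \<open>s i\<close> is the difference there of the affine functions
    of the pieces \<open>i\<close> and \<open>i - 1\<close>, both expanded at \<open>l\<close>. Only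
    indices from 1 on are used, so the truncated subtraction is harmless.\<close>
  define a where "a i = (A i + B i * (s i - l)) - (A (i - 1) + B (i - 1) * (s i - l))" for i
  define b where "b i = B i - B (i - 1)" for i
  have piece: "pw_prim l (A 0) (pw_prim l (B 0) g {1..<n} s b) {1..<n} s a x =
     pw_prim l (A k) (pw_prim l (B k) g {} (\<lambda>_. 0) (\<lambda>_. 0)) {} (\<lambda>_. 0) (\<lambda>_. 0) x"
    if k: "k < n" "s k < x" "x < s (Suc k)" for k x
  proof -
    have x: "x \<in> {l..u}" using k ends[of k] ends[of "Suc k"] by auto
    have iff: "s i \<le> x \<longleftrightarrow> i \<le> k" if "i \<in> {1..<n}" for i
      using le[of i k] le[of "Suc k" i] k that by (auto simp: not_le) (meson not_le not_less_eq_eq order.strict_trans2 not_less)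
    have "(\<Sum>i\<in>{1..<n}. if s i \<le> x then a i + b i * (x - s i) else 0)
       = (\<Sum>i\<in>{1..<n}. if i \<le> k then a i + b i * (x - s i) else 0)"
      by (rule sum.cong) (auto simp: iff)
    also have "\<dots> = (\<Sum>i\<in>{1..k}. a i + b i * (x - s i))"
      using k(1) by (intro sum.mono_neutral_cong_right) auto
    \<comment> \<open>Each summand becomes the difference of two consecutive affine functions at
      \<open>x\<close>, so the sum telescopes.\<close>
    also have "\<dots> = (\<Sum>i\<in>{1..k}. (A i + B i * (x - l)) - (A (i - 1) + B (i - 1) * (x - l)))"
      by (intro sum.cong refl) (simp add: a_def b_def algebra_simps)
    also have "\<dots> = (A k + B k * (x - l)) - (A 0 + B 0 * (x - l))"
      by (induction k) auto
    finally have e: "(\<Sum>i\<in>{1..<n}. if s i \<le> x then a i + b i * (x - s i) else 0)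
      = (A k + B k * (x - l)) - (A 0 + B 0 * (x - l))" .
    have "pw_prim l (A 0) (pw_prim l (B 0) g {1..<n} s b) {1..<n} s a x
        = A 0 + B 0 * (x - l) + integral {l..x} (\<lambda>y. integral {l..y} g)
          + (\<Sum>i\<in>{1..<n}. if s i \<le> x then a i + b i * (x - s i) else 0)"
      by (intro pw_prim_pw_prim[OF gi x]) (use ends in auto)
    moreover have "pw_prim l (A k) (pw_prim l (B k) g {} (\<lambda>_. 0) (\<lambda>_. 0)) {} (\<lambda>_. 0) (\<lambda>_. 0) x
        = A k + B k * (x - l) + integral {l..x} (\<lambda>y. integral {l..y} g)"
      using pw_prim_pw_prim[OF gi x, where I = "{}" and t = "\<lambda>_. 0" and p = "A k" and q = "B k"
          and a = "\<lambda>_. 0" and b = "\<lambda>_. 0"] by simp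
    ultimately show ?thesis
      unfolding e by simp
  qed
  have "AE x in lebesgue. \<forall>i\<in>{..<n}. x \<in> {s i<..<s (Suc i)} \<longrightarrow>
      v x = pw_prim l (fst (r i)) (pw_prim l (snd (r i)) g {} (\<lambda>_. 0) (\<lambda>_. 0)) {} (\<lambda>_. 0) (\<lambda>_. 0) x"
    using r by (intro AE_finite_allI) auto
  moreover have "AE x in lebesgue. x \<notin> s ` {..n}" by (intro AE_notin_finite) simp
  ultimately have "AE x in lebesgue. x \<in> {l<..<u} \<longrightarrow>
     v x = pw_prim l (A 0) (pw_prim l (B 0) g {1..<n} s b) {1..<n} s a x"
  proof eventually_elim
    case (elim x)
    show ?case
    proof
      assume "x \<in> {l<..<u}"
      then have "s 0 < x" "x < s n" using s(1,2) by auto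
      then obtain k where k: "k < n" "s k < x" "x < s (Suc k)"
        using partition_piece[of s x n] elim(2) by blast
      then show "v x = pw_prim l (A 0) (pw_prim l (B 0) g {1..<n} s b) {1..<n} s a x"
        using elim(1) piece[OF k] by (simp add: A_def B_def)
    qed
  qed
  moreover have "inj_on s {1..<n}"
    using lt by (intro linorder_inj_onI) (auto, metis less_irrefl less_imp_le)
  moreover have "s ` {1..<n} \<subseteq> {l<..<u}"
    using lt[of 0] lt[of _ n] s(1,2) by auto
  ultimately show thesis
    using g by (intro that[of g "{1..<n}" s]) auto
qed

lemma finite_partition:
  fixes l u :: real
  assumes "finite T" "l < u"
  obtains n :: nat and s where "s 0 = l" "s n = u"
    "\<And>i. i < n \<Longrightarrow> s i < s (Suc i) \<and> l \<le> s i \<and> s (Suc i) \<le> u \<and> T \<inter> {s i<..<s (Suc i)} = {}"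
proof -
  define S where "S = insert l (insert u (T \<inter> {l<..<u}))"
  define xs where "xs = sorted_list_of_set S"
  have S: "finite S" "S \<subseteq> {l..u}" using assms by (auto simp: S_def)
  then have set: "set xs = S" by (simp add: xs_def)
  have sort: "xs ! i < xs ! j" if "i < j" "j < length xs" for i j
    using that unfolding xs_def by (intro sorted_wrt_nth_less[OF strict_sorted_list_of_set])
  obtain i where i: "i < length xs" "xs ! i = l" using set in_set_conv_nth[of l xs] by (auto simp: S_def)
  obtain j where j: "j < length xs" "xs ! j = u" using set in_set_conv_nth[of u xs] by (auto simp: S_def)
  have mem: "l \<le> xs ! k" "xs ! k \<le> u" if "k < length xs" for k
    using nth_mem[OF that] set S by auto
  have "xs \<noteq> []" using i by auto
  then have "i = 0" using sort[of 0 i] mem(1)[of 0] i by (cases i) auto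
  moreover have "j = length xs - 1"
    using sort[of j "length xs - 1"] mem(2)[of "length xs - 1"] j \<open>xs \<noteq> []\<close> by (cases "j < length xs - 1") auto
  moreover have "T \<inter> {xs ! k<..<xs ! Suc k} = {}" if k: "k < length xs - 1" for k
  proof (rule ccontr)
    assume "\<not> ?thesis"
    then obtain y where y: "y \<in> T" "xs ! k < y" "y < xs ! Suc k" by auto
    have "l < y" "y < u" using mem(1)[of k] mem(2)[of "Suc k"] k y by linarith+
    then have "y \<in> S" using y by (auto simp: S_def)
    then obtain m where m: "m < length xs" "xs ! m = y" using set in_set_conv_nth[of y xs] by auto
    have kl: "k < length xs" "Suc k < length xs" using k by auto
    consider "m < k" | "m = k" | "m = Suc k" | "Suc k < m" by linarith
    then show False
      by cases (use sort[of m k] sort[of "Suc k" m] m y kl in auto)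
  qed
  ultimately show thesis
    using i j sort mem by (intro that[of "nth xs" "length xs - 1"]) auto
qed

text \<open>Between neighbouring points the set \<open>?J\<close> of active steps does not change,
  so there they add up to an affine function, which goes into the two constants of
  integration.\<close>

lemma pw_prim_imp_piecewise_H2:
  assumes "l < u" and g: "L2_supp l u g" and I: "finite I" "t ` I \<subseteq> {l<..<u}"
    and v: "AE x in lebesgue. x \<in> {l<..<u} \<longrightarrow> v x = pw_prim l p (pw_prim l q g I t b) I t a x"
  shows "v \<in> piecewise_H2 l u"
proof -
  have gi: "set_integrable lebesgue {l..u} g" by (rule L2_supp_set_integrable[OF g]) simp
  obtain n s where s: "s 0 = l" "s n = u"
    "\<And>i. i < n \<Longrightarrow> s i < s (Suc i) \<and> l \<le> s i \<and> s (Suc i) \<le> u \<and> t ` I \<inter> {s i<..<s (Suc i)} = {}"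
    using finite_partition[of "t ` I" l u] I \<open>l < u\<close> by (metis finite_imageI)
  have "v \<in> Sobolev_H 2 (s k) (s (Suc k))" if k: "k < n" for k
  proof -
    let ?J = "{i \<in> I. t i \<le> s k}"
    \<comment> \<open>The active affine terms contribute their total slope to \<open>?q\<close> and
      their value extrapolated back to \<open>l\<close> to \<open>?p\<close>.\<close>
    let ?p = "p + (\<Sum>i\<in>?J. a i + b i * (l - t i))" and ?q = "q + (\<Sum>i\<in>?J. b i)"
    have eq: "pw_prim l p (pw_prim l q g I t b) I t a x = pw_prim l ?p (pw_prim l ?q g {} t b) {} t a x"
      if x: "x \<in> {s k<..<s (Suc k)}" for x
    proof -
      have x': "x \<in> {l..u}" using x s(3)[OF k] by auto
      have "t i \<le> x \<longleftrightarrow> t i \<le> s k" if "i \<in> I" for i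
        using s(3)[OF k] x that by auto
      then have "(\<Sum>i\<in>I. if t i \<le> x then a i + b i * (x - t i) else 0)
         = (\<Sum>i\<in>I. if t i \<le> s k then a i + b i * (x - t i) else 0)"
        by (intro sum.cong) auto
      also have "\<dots> = (\<Sum>i\<in>?J. a i + b i * (x - t i))"
        using I(1) by (simp add: sum.inter_filter)
      also have "\<dots> = (\<Sum>i\<in>?J. (a i + b i * (l - t i)) + b i * (x - l))"
        by (intro sum.cong) (auto simp: algebra_simps)
      also have "\<dots> = (\<Sum>i\<in>?J. a i + b i * (l - t i)) + (\<Sum>i\<in>?J. b i) * (x - l)"
        by (simp add: sum.distrib sum_distrib_right)
      finally have e: "(\<Sum>i\<in>I. if t i \<le> x then a i + b i * (x - t i) else 0) =
        (\<Sum>i\<in>?J. a i + b i * (l - t i)) + (\<Sum>i\<in>?J. b i) * (x - l)" .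
      have "\<And>i. i \<in> I \<Longrightarrow> l \<le> t i" using I(2) by force
      then have "pw_prim l p (pw_prim l q g I t b) I t a x = p + q * (x - l) + integral {l..x} (\<lambda>y. integral {l..y} g)
          + (\<Sum>i\<in>I. if t i \<le> x then a i + b i * (x - t i) else 0)"
        by (intro pw_prim_pw_prim[OF gi x' I(1)])
      moreover have "pw_prim l ?p (pw_prim l ?q g {} t b) {} t a x
          = ?p + ?q * (x - l) + integral {l..x} (\<lambda>y. integral {l..y} g)
          + (\<Sum>i\<in>{}. if t i \<le> x then a i + b i * (x - t i) else 0)"
        by (intro pw_prim_pw_prim[OF gi x']) auto
      ultimately show ?thesis
        unfolding e by (simp only: distrib_right sum.empty add_0_right add.assoc add.left_commute add.commute)
    qed
    have "AE x in lebesgue. x \<in> {s k<..<s (Suc k)} \<longrightarrow> v x = pw_prim l ?p (pw_prim l ?q g {} t b) {} t a x"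
      using v by (rule eventually_mono) (use eq s(3)[OF k] in auto)
    then show ?thesis
      using s(3)[OF k] by (intro Sobolev_H2_pw_prim(1)[OF _ _ g]) auto
  qed
  then show ?thesis
    using s unfolding piecewise_H2_def by blast
qed

subsection \<open>Weak compactness\<close>

text \<open>Fatou's lemma for the squares. The bound is asked for eventually only, so that it can be
  used with a limit of the integrals plus an arbitrary \<open>e\<close>.\<close>

lemma square_integral_le_of_AE_limit:
  fixes f :: "nat \<Rightarrow> 'a \<Rightarrow> real"
  assumes m: "\<And>n. f n \<in> borel_measurable M" "h \<in> borel_measurable M"
    and i: "\<And>n. integrable M (\<lambda>x. (f n x)\<^sup>2)"
    and lim: "AE x in M. (\<lambda>n. f n x) \<longlonglongrightarrow> h x"
    and K: "eventually (\<lambda>n. (LINT x|M. (f n x)\<^sup>2) \<le> K) sequentially"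
  shows "integrable M (\<lambda>x. (h x)\<^sup>2)" "(LINT x|M. (h x)\<^sup>2) \<le> K"
proof -
  note [measurable] = m
  have "eventually (\<lambda>n. (0::real) \<le> K) sequentially"
    using K by (rule eventually_mono) (rule order_trans[rotated], assumption, rule integral_nonneg_AE, simp)
  then have "K \<ge> 0" by simp
  have "(\<integral>\<^sup>+x. ennreal ((h x)\<^sup>2) \<partial>M) = (\<integral>\<^sup>+x. liminf (\<lambda>n. ennreal ((f n x)\<^sup>2)) \<partial>M)"
  proof (rule nn_integral_cong_AE, rule eventually_mono[OF lim])
    fix x assume "(\<lambda>n. f n x) \<longlonglongrightarrow> h x"
    then have "(\<lambda>n. ennreal ((f n x)\<^sup>2)) \<longlonglongrightarrow> ennreal ((h x)\<^sup>2)"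
      by (intro tendsto_ennrealI tendsto_power)
    then show "ennreal ((h x)\<^sup>2) = liminf (\<lambda>n. ennreal ((f n x)\<^sup>2))"
      by (intro lim_imp_Liminf[symmetric]) auto
  qed
  also have "\<dots> \<le> liminf (\<lambda>n. \<integral>\<^sup>+x. ennreal ((f n x)\<^sup>2) \<partial>M)"
    by (rule nn_integral_liminf) measurable
  also have "\<dots> \<le> liminf (\<lambda>n. ennreal K)"
  proof (rule Liminf_mono, rule eventually_mono[OF K])
    fix n assume "(LINT x|M. (f n x)\<^sup>2) \<le> K"
    then show "(\<integral>\<^sup>+x. ennreal ((f n x)\<^sup>2) \<partial>M) \<le> ennreal K"
      using i[of n] by (simp add: nn_integral_eq_integral ennreal_leI)
  qed
  also have "\<dots> = ennreal K" by (simp add: Liminf_const)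
  finally have le: "(\<integral>\<^sup>+x. ennreal ((h x)\<^sup>2) \<partial>M) \<le> ennreal K" .
  show *: "integrable M (\<lambda>x. (h x)\<^sup>2)"
    by (rule integrableI_bounded) (use le in \<open>auto intro: le_less_trans\<close>)
  show "(LINT x|M. (h x)\<^sup>2) \<le> K"
    using le \<open>K \<ge> 0\<close> * by (simp add: nn_integral_eq_integral)
qed

lemma L2_supp_abs: "L2_supp l u g \<Longrightarrow> L2_supp l u (\<lambda>x. \<bar>g x\<bar>)"
  by (auto simp: L2_supp_def)

text \<open>The Cauchy-Schwarz inequality against the constant 1, obtained from the nonnegative
  variance of \<open>\<bar>g\<bar>\<close> about its mean \<open>m\<close>.\<close>

lemma L2_supp_L1_le:
  assumes "l < u" and g: "L2_supp l u g"
  shows "(LINT x|lebesgue. \<bar>g x\<bar>)\<^sup>2 \<le> (u - l) * (LINT x|lebesgue. (g x)\<^sup>2)"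
proof -
  define s where "s = (LINT x|lebesgue. \<bar>g x\<bar>)"
  define m where "m = s / (u - l)"
  let ?one = "indicator {l<..<u} :: real \<Rightarrow> real"
  have i: "integrable lebesgue (\<lambda>x. (g x)\<^sup>2)" "integrable lebesgue (\<lambda>x. \<bar>g x\<bar>)" "integrable lebesgue ?one"
    using g L2_supp_integrable[OF L2_supp_abs[OF g]] L2_supp_integrable[OF L2_supp_indicator]
    by (auto simp: L2_supp_def)
  have e: "(\<bar>g x\<bar> - m * ?one x)\<^sup>2 = (g x)\<^sup>2 - 2 * m * \<bar>g x\<bar> + m\<^sup>2 * ?one x" for x
    using g by (cases "x \<in> {l<..<u}") (auto simp: L2_supp_def power2_diff)
  have "0 \<le> (LINT x|lebesgue. (\<bar>g x\<bar> - m * ?one x)\<^sup>2)"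
    by (rule integral_nonneg_AE) simp
  also have "\<dots> = (LINT x|lebesgue. (g x)\<^sup>2) - 2 * m * s + m\<^sup>2 * (LINT x|lebesgue. ?one x)"
    unfolding e using i by (simp add: s_def)
  also have "(LINT x|lebesgue. ?one x) = u - l"
    using \<open>l < u\<close> by simp
  also have "(LINT x|lebesgue. (g x)\<^sup>2) - 2 * m * s + m\<^sup>2 * (u - l) = (LINT x|lebesgue. (g x)\<^sup>2) - s\<^sup>2 / (u - l)"
  proof -
    have "m * (u - l) = s" using \<open>l < u\<close> by (simp add: m_def)
    then have "m\<^sup>2 * (u - l) = m * s" by (simp add: power2_eq_square mult.assoc)
    moreover have "m * s = s\<^sup>2 / (u - l)" by (simp add: m_def power2_eq_square)
    ultimately show ?thesis by simp
  qed
  finally show ?thesis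
    using \<open>l < u\<close> by (simp add: s_def field_simps)
qed

text \<open>Riesz-Fischer: on a bounded interval an L2 Cauchy sequence is L1 Cauchy and has an
  almost everywhere convergent subsequence; Fatou's lemma with one index fixed returns to L2. The
  limit is defined pointwise by \<open>lim\<close>, so common zeros survive at each point and
  supports can be tracked.\<close>

lemma L2_complete:
  fixes z :: "nat \<Rightarrow> real \<Rightarrow> real"
  assumes "l < u" and z: "\<And>n. L2_supp l u (z n)"
    and cauchy: "\<And>e. e > 0 \<Longrightarrow> \<exists>N. \<forall>i\<ge>N. \<forall>j\<ge>N. (LINT x|lebesgue. (z i x - z j x)\<^sup>2) \<le> e"
  obtains r h where "strict_mono r" "L2_supp l u h" "AE x in lebesgue. (\<lambda>k. z (r k) x) \<longlonglongrightarrow> h x"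
    "\<And>e. e > 0 \<Longrightarrow> \<exists>N. \<forall>i\<ge>N. (LINT x|lebesgue. (z i x - h x)\<^sup>2) \<le> e"
    "\<And>x. (\<And>n. z n x = 0) \<Longrightarrow> h x = 0"
proof -
  have zi: "integrable lebesgue (z n)" for n by (rule L2_supp_integrable[OF z])
  obtain r where r: "strict_mono r" "AE x in lebesgue. Cauchy (\<lambda>i. z (r i) x)"
  proof (rule cauchy_L1_AE_cauchy_subseq[of lebesgue z, OF zi])
    fix e :: real assume "e > 0"
    \<comment> \<open>With this bound the Cauchy-Schwarz inequality gives an L1 norm whose square is
      at most \<open>e\<^sup>2 / 2\<close>.\<close>
    then have "e\<^sup>2 / (2 * (u - l)) > 0" using \<open>l < u\<close> by simp
    then obtain N where N: "\<And>i j. i \<ge> N \<Longrightarrow> j \<ge> N \<Longrightarrow> (LINT x|lebesgue. (z i x - z j x)\<^sup>2) \<le> e\<^sup>2 / (2 * (u - l))"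
      using cauchy by blast
    have "(LINT x|lebesgue. norm (z i x - z j x)) < e" if "i \<ge> N" "j \<ge> N" for i j
    proof (rule power2_less_imp_less)
      have "(LINT x|lebesgue. \<bar>z i x - z j x\<bar>)\<^sup>2 \<le> (u - l) * (LINT x|lebesgue. (z i x - z j x)\<^sup>2)"
        by (rule L2_supp_L1_le[OF \<open>l < u\<close> L2_supp_diff[OF z z]])
      also have "\<dots> \<le> (u - l) * (e\<^sup>2 / (2 * (u - l)))"
        using N[OF that] \<open>l < u\<close> by (intro mult_left_mono) auto
      also have "\<dots> < e\<^sup>2"
      proof -
        have "k * (e\<^sup>2 / (2 * k)) < e\<^sup>2" if "k > 0" for k using that \<open>e > 0\<close> by simp
        then show ?thesis using \<open>l < u\<close> by (metis diff_gt_0_iff_gt)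
      qed
      finally show "(LINT x|lebesgue. norm (z i x - z j x))\<^sup>2 < e\<^sup>2" by simp
    qed (use \<open>e > 0\<close> in simp)
    then show "\<exists>N. \<forall>i\<ge>N. \<forall>j\<ge>N. (LINT x|lebesgue. norm (z i x - z j x)) < e" by blast
  qed blast
  define h where "h x = lim (\<lambda>k. z (r k) x)" for x
  have zm: "z n \<in> borel_measurable lebesgue" for n using z by (simp add: L2_supp_def)
  have hm: "h \<in> borel_measurable lebesgue"
    unfolding h_def by (rule borel_measurable_lim_metric[OF zm])
  have lim: "AE x in lebesgue. (\<lambda>k. z (r k) x) \<longlonglongrightarrow> h x"
    by (rule eventually_mono[OF r(2)]) (simp add: h_def Cauchy_convergent convergent_LIMSEQ_iff[symmetric])
  have i: "integrable lebesgue (\<lambda>x. (z i x - h x)\<^sup>2) \<and> (LINT x|lebesgue. (z i x - h x)\<^sup>2) \<le> e"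
    if N: "\<And>i j. i \<ge> N \<Longrightarrow> j \<ge> N \<Longrightarrow> (LINT x|lebesgue. (z i x - z j x)\<^sup>2) \<le> e" "i \<ge> N" for i N e
  proof -
    note F = square_integral_le_of_AE_limit[where f = "\<lambda>k x. z i x - z (r k) x" and h = "\<lambda>x. z i x - h x"
        and M = lebesgue and K = e]
    have 1: "integrable lebesgue (\<lambda>x. (z i x - z (r k) x)\<^sup>2)" for k
      using L2_supp_diff[OF z z] by (simp add: L2_supp_def)
    have 2: "AE x in lebesgue. (\<lambda>k. z i x - z (r k) x) \<longlonglongrightarrow> z i x - h x"
      using lim by (rule eventually_mono) (intro tendsto_intros)
    have 3: "\<forall>\<^sub>F k in sequentially. (LINT x|lebesgue. (z i x - z (r k) x)\<^sup>2) \<le> e"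
      by (rule eventually_sequentiallyI[of N])
         (use N seq_suble[OF r(1)] order_trans in blast)
    show ?thesis
      using F[OF _ _ 1 2 3] zm hm by auto
  qed
  obtain N1 where N1: "\<And>i j. i \<ge> N1 \<Longrightarrow> j \<ge> N1 \<Longrightarrow> (LINT x|lebesgue. (z i x - z j x)\<^sup>2) \<le> 1"
    using cauchy[of 1] by auto
  have zero: "z n x = 0" if "x \<notin> {l<..<u}" for n x
    using z that unfolding L2_supp_def by blast
  have "h x = 0" if "x \<notin> {l<..<u}" for x
    using zero[OF that] by (simp add: h_def)
  then have "L2_supp l u (\<lambda>x. z N1 x - h x)"
    using i[of N1 1 N1] N1 zm hm zero by (auto simp: L2_supp_def)
  from L2_supp_diff[OF z[of N1] this] have "L2_supp l u h" by simp
  moreover have "\<exists>N. \<forall>i\<ge>N. (LINT x|lebesgue. (z i x - h x)\<^sup>2) \<le> e" if "e > 0" for e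
    using cauchy[OF that] i by blast
  moreover have "h x = 0" if "\<And>n. z n x = 0" for x
    using that by (simp add: h_def)
  ultimately show thesis
    using that[OF r(1) _ lim] by blast
qed

section \<open>Double primitives and midpoint hulls\<close>

definition prim2 :: "real \<Rightarrow> (real \<Rightarrow> real) \<Rightarrow> real \<Rightarrow> real" where
  "prim2 l g x = integral {l..x} (\<lambda>y. integral {l..y} g)"

lemma L2_supp_integrable_on: "L2_supp l u g \<Longrightarrow> g integrable_on {a..b}"
  by (rule set_lebesgue_integral_eq_integral(1)[OF L2_supp_set_integrable]) auto

lemma L2_supp_continuous_primitive: "L2_supp l u g \<Longrightarrow> continuous_on {a..b} (\<lambda>y. integral {a..y} g)"
  by (intro indefinite_integral_continuous_1 L2_supp_integrable_on)

lemma prim2_lincomb: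
  assumes "L2_supp l u f" "L2_supp l u g"
  shows "prim2 l (\<lambda>x. c * f x + d * g x) x = c * prim2 l f x + d * prim2 l g x"
proof -
  have 1: "integral {l..y} (\<lambda>x. c * f x + d * g x) = c * integral {l..y} f + d * integral {l..y} g" for y
    by (intro integral_unique has_integral_add has_integral_mult_right integrable_integral
        assms[THEN L2_supp_integrable_on])
  show ?thesis
    unfolding prim2_def 1
    by (intro integral_unique has_integral_add has_integral_mult_right integrable_integral
        assms[THEN L2_supp_continuous_primitive, THEN integrable_continuous_real])
qed

lemma abs_primitive_le:
  assumes g: "L2_supp l u g"
  shows "\<bar>integral {l..x} g\<bar> \<le> (LINT x|lebesgue. \<bar>g x\<bar>)"
proof -
  have gx: "set_integrable lebesgue {l..x} g" by (rule L2_supp_set_integrable[OF g]) simp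
  have "integral {l..x} g = (LINT x:{l..x}|lebesgue. g x)"
    by (rule set_lebesgue_integral_eq_integral(2)[symmetric, OF gx])
  also have "\<bar>\<dots>\<bar> \<le> (LINT x:{l..x}|lebesgue. \<bar>g x\<bar>)"
    using set_integral_norm_bound[OF gx] by simp
  also have "\<dots> \<le> (LINT x|lebesgue. \<bar>g x\<bar>)"
    unfolding set_lebesgue_integral_def
    by (rule integral_mono)
       (use set_integrable_abs[OF gx] L2_supp_integrable[OF L2_supp_abs[OF g]] in \<open>auto simp: set_integrable_def indicator_def\<close>)
  finally show ?thesis .
qed

text \<open>The slope of \<open>prim2\<close> is a primitive of \<open>g\<close>, which the L1 norm
  bounds. Under an L2 bound the double primitives are thus equicontinuous.\<close>

lemma prim2_Lipschitz:
  assumes g: "L2_supp l u g" and x: "l \<le> x" "x \<le> y"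
  shows "\<bar>prim2 l g y - prim2 l g x\<bar> \<le> (y - x) * (LINT x|lebesgue. \<bar>g x\<bar>)"
proof -
  have i: "(\<lambda>y. integral {l..y} g) integrable_on {l..y}"
    by (rule integrable_continuous_real[OF L2_supp_continuous_primitive[OF g]])
  have "integral {x..y} (\<lambda>y. integral {l..y} g) = prim2 l g y - prim2 l g x"
    using Henstock_Kurzweil_Integration.integral_combine[OF x i] by (simp add: prim2_def)
  moreover have "(\<lambda>y. integral {l..y} g) integrable_on {x..y}"
    by (rule integrable_subinterval_real[OF i]) (use x in auto)
  then have "norm (integral {x..y} (\<lambda>y. integral {l..y} g)) \<le> (LINT x|lebesgue. \<bar>g x\<bar>) * (y - x)"
    using x abs_primitive_le[OF g] by (intro integral_bound) (auto intro: continuous_on_subset[OF L2_supp_continuous_primitive[OF g, of l y]])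
  ultimately show ?thesis by (simp add: mult.commute)
qed

lemma prim2_bound:
  assumes g: "L2_supp l u g" and x: "x \<in> {l..u}"
  shows "\<bar>prim2 l g x\<bar> \<le> (u - l) * (LINT x|lebesgue. \<bar>g x\<bar>)"
proof -
  have "prim2 l g l = 0" by (simp add: prim2_def)
  then have "\<bar>prim2 l g x\<bar> \<le> (x - l) * (LINT x|lebesgue. \<bar>g x\<bar>)"
    using prim2_Lipschitz[OF g, of l x] x by simp
  also have "\<dots> \<le> (u - l) * (LINT x|lebesgue. \<bar>g x\<bar>)"
    using x by (intro mult_right_mono integral_nonneg_AE) auto
  finally show ?thesis .
qed

text \<open>A substitute for the convex hull: midpoints suffice for the parallelogram law, and
  convex conditions, such as a norm bound or closeness of \<open>prim2\<close> to a value, pass to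
  the hull by induction.\<close>

inductive_set midpoint_hull :: "(real \<Rightarrow> real) set \<Rightarrow> (real \<Rightarrow> real) set" for S where
  hull_base: "f \<in> S \<Longrightarrow> f \<in> midpoint_hull S"
| hull_mid: "f \<in> midpoint_hull S \<Longrightarrow> g \<in> midpoint_hull S \<Longrightarrow> (\<lambda>x. (1/2) * f x + (1/2) * g x) \<in> midpoint_hull S"

lemma midpoint_hull_mono:
  assumes "S \<subseteq> T" shows "midpoint_hull S \<subseteq> midpoint_hull T"
proof
  fix f assume "f \<in> midpoint_hull S"
  then show "f \<in> midpoint_hull T"
  proof induction
    case (hull_base f)
    then show ?case using assms by (blast intro: midpoint_hull.hull_base)
  qed (rule midpoint_hull.hull_mid)
qed

lemma midpoint_hull_L2:
  assumes "f \<in> midpoint_hull S" "\<And>g. g \<in> S \<Longrightarrow> L2_supp l u g"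
  shows "L2_supp l u f"
  using assms(1)
proof induction
  case (hull_mid f g)
  then show ?case by (intro L2_supp_add L2_supp_cmult)
qed (rule assms(2))

lemma integral_parallelogram:
  assumes "L2_supp l u f" "L2_supp l u g"
  shows "(LINT x|lebesgue. ((1/2) * f x + (1/2) * g x)\<^sup>2) =
    (1/2) * (LINT x|lebesgue. (f x)\<^sup>2) + (1/2) * (LINT x|lebesgue. (g x)\<^sup>2) - (1/4) * (LINT x|lebesgue. (f x - g x)\<^sup>2)"
proof -
  have "((1/2) * f x + (1/2) * g x)\<^sup>2 = (1/2) * (f x)\<^sup>2 + (1/2) * (g x)\<^sup>2 - (1/4) * (f x - g x)\<^sup>2" for x
    by (simp add: power2_eq_square field_simps)
  then show ?thesis
    using assms L2_supp_diff[OF assms] by (simp add: L2_supp_def)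
qed

lemma midpoint_hull_square_le:
  assumes "f \<in> midpoint_hull S" "\<And>g. g \<in> S \<Longrightarrow> L2_supp l u g"
    "\<And>g. g \<in> S \<Longrightarrow> (LINT x|lebesgue. (g x)\<^sup>2) \<le> K"
  shows "(LINT x|lebesgue. (f x)\<^sup>2) \<le> K"
  using assms(1)
proof induction
  case (hull_mid f g)
  have fg: "L2_supp l u f" "L2_supp l u g"
    using hull_mid midpoint_hull_L2 assms(2) by blast+
  have "(LINT x|lebesgue. (f x - g x)\<^sup>2) \<ge> 0" by (rule integral_nonneg_AE) simp
  then show ?case unfolding integral_parallelogram[OF fg] using hull_mid.IH by linarith
qed (use assms in auto)

lemma midpoint_hull_prim2:
  assumes "f \<in> midpoint_hull S" "\<And>g. g \<in> S \<Longrightarrow> L2_supp l u g"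
    "\<And>g. g \<in> S \<Longrightarrow> \<bar>prim2 l g x - R\<bar> \<le> e"
  shows "\<bar>prim2 l f x - R\<bar> \<le> e"
  using assms(1)
proof induction
  case (hull_mid f g)
  have fg: "L2_supp l u f" "L2_supp l u g"
    using hull_mid midpoint_hull_L2 assms(2) by blast+
  show ?case
    unfolding prim2_lincomb[OF fg] using hull_mid by (simp add: abs_le_iff)
qed (use assms in auto)

text \<open>Elements of almost minimal norm in the midpoint hulls of the tails form a Cauchy sequence,
  by the parallelogram law.\<close>

lemma L2_weak_limit:
  assumes "l < u" and g: "\<And>n. L2_supp l u (g n)"
    and L: "(\<lambda>n. LINT x|lebesgue. (g n x)\<^sup>2) \<longlonglongrightarrow> L"
    and R: "\<And>x. x \<in> {l..u} \<Longrightarrow> (\<lambda>n. prim2 l (g n) x) \<longlonglongrightarrow> R x"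
  obtains h where "L2_supp l u h" "(LINT x|lebesgue. (h x)\<^sup>2) \<le> L" "\<And>x. x \<in> {l..u} \<Longrightarrow> prim2 l h x = R x"
    "\<forall>c d. (\<forall>n. L2_supp c d (g n)) \<longrightarrow> L2_supp c d h"
proof -
  define S where "S n = g ` {n..}" for n
  define sq where "sq f = (LINT x|lebesgue. (f x)\<^sup>2)" for f :: "real \<Rightarrow> real"
  define d where "d n = Inf (sq ` midpoint_hull (S n))" for n
  have sq0: "sq f \<ge> 0" for f unfolding sq_def by (rule integral_nonneg_AE) simp
  have S: "L2_supp l u f" if "f \<in> S n" for f n using that g by (auto simp: S_def)
  have bdd: "bdd_below (sq ` A)" for A using sq0 by (intro bdd_belowI[of _ 0]) auto
  have gn: "g n \<in> midpoint_hull (S n)" for n by (intro hull_base) (simp add: S_def)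
  have dle: "d n \<le> sq f" if "f \<in> midpoint_hull (S n)" for f n
    unfolding d_def using that bdd by (intro cInf_lower) auto
  have hm: "midpoint_hull (S m) \<subseteq> midpoint_hull (S n)" if "n \<le> m" for n m
    using that by (intro midpoint_hull_mono) (auto simp: S_def)
  \<comment> \<open>The hulls of the tails shrink, so the infima \<open>d n\<close> of the squared
    norms increase; they stay below the bound of the sequence itself.\<close>
  have "incseq d"
    unfolding incseq_def d_def using gn bdd by (intro allI impI cInf_superset_mono image_mono hm) blast+
  moreover obtain C where C: "\<And>n. \<bar>sq (g n)\<bar> \<le> C"
    using convergent_imp_Bseq[OF convergentI[OF L]] unfolding Bseq_def sq_def by auto
  have "d n \<le> C" for n using dle[OF gn[of n]] C[of n] by linarith
  ultimately obtain D where D: "d \<longlonglongrightarrow> D" "\<And>n. d n \<le> D"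
    using incseq_convergent[of d C] by blast
  have "\<exists>f. f \<in> midpoint_hull (S n) \<and> sq f < d n + 1 / Suc n" for n
  proof -
    have "d n < d n + 1 / Suc n" by simp
    then have "\<exists>y\<in>sq ` midpoint_hull (S n). y < d n + 1 / Suc n"
      unfolding d_def using gn bdd by (subst (asm) cInf_less_iff) blast+
    then show ?thesis by blast
  qed
  then obtain z where z: "\<And>n. z n \<in> midpoint_hull (S n)" "\<And>n. sq (z n) < d n + 1 / Suc n"
    by metis
  have zL: "L2_supp l u (z n)" for n
    by (rule midpoint_hull_L2[OF z(1) S])
  \<comment> \<open>The midpoint of \<open>z n\<close> and \<open>z m\<close> lies in the hull of
    the tail from \<open>k\<close>, so its squared norm is at least \<open>d k\<close>; the
    parallelogram law turns this into a bound on the distance.\<close>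
  have ineq: "(LINT x|lebesgue. (z n x - z m x)\<^sup>2) \<le> 2 * (d n + 1 / Suc n) + 2 * (d m + 1 / Suc m) - 4 * d k"
    if "k \<le> n" "k \<le> m" for n m k
  proof -
    have "(\<lambda>x. (1/2) * z n x + (1/2) * z m x) \<in> midpoint_hull (S k)"
      using hm[OF that(1)] hm[OF that(2)] z(1) by (intro hull_mid) auto
    from dle[OF this] have "d k \<le> (1/2) * sq (z n) + (1/2) * sq (z m) - (1/4) * (LINT x|lebesgue. (z n x - z m x)\<^sup>2)"
      unfolding sq_def integral_parallelogram[OF zL zL] .
    moreover have "q \<le> 2 * X + 2 * Y - 4 * K" if "K \<le> (1/2) * p + (1/2) * s - (1/4) * q" "p < X" "s < Y"
      for K X Y p q s :: real using that by linarith
    ultimately show ?thesis using z(2)[of n] z(2)[of m] by blast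
  qed
  obtain r h where h: "L2_supp l u h" "AE x in lebesgue. (\<lambda>k. z (r k) x) \<longlonglongrightarrow> h x"
    "\<And>e. e > 0 \<Longrightarrow> \<exists>N. \<forall>i\<ge>N. (LINT x|lebesgue. (z i x - h x)\<^sup>2) \<le> e" and r: "strict_mono r"
    and h0: "\<And>x. (\<And>n. z n x = 0) \<Longrightarrow> h x = 0"
  proof (rule L2_complete[OF \<open>l < u\<close> zL])
    fix e :: real assume e: "e > 0"
    \<comment> \<open>With \<open>D - e/8 < d k\<close>, with \<open>d n\<close> and
      \<open>d m\<close> at most \<open>D\<close> and both excesses below \<open>e/8\<close>, the
      bound of \<open>ineq\<close> is at most
      \<open>4 * (D + e/8) - 4 * (D - e/8) = e\<close>.\<close>
    obtain N1 where N1: "\<And>n. n \<ge> N1 \<Longrightarrow> D - e / 8 < d n"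
      using order_tendstoD(1)[OF D(1), of "D - e/8"] e by (auto simp: eventually_sequentially)
    obtain N2 where N2: "1 / Suc N2 < e / 8" using nat_approx_posE[of "e/8"] e by auto
    have "(LINT x|lebesgue. (z i x - z j x)\<^sup>2) \<le> e" if "i \<ge> max N1 N2" "j \<ge> max N1 N2" for i j
    proof -
      have "1 / Suc i \<le> 1 / Suc N2" "1 / Suc j \<le> 1 / Suc N2"
        using that by (auto simp: frac_le)
      then show ?thesis
        using ineq[OF that] D(2)[of i] D(2)[of j] N1[of "max N1 N2"] N2 by auto
    qed
    then show "\<exists>N. \<forall>i\<ge>N. \<forall>j\<ge>N. (LINT x|lebesgue. (z i x - z j x)\<^sup>2) \<le> e" by blast
  qed blast
  have "(LINT x|lebesgue. (h x)\<^sup>2) \<le> L + e" if e: "e > 0" for e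
  proof (rule square_integral_le_of_AE_limit(2)[OF _ _ _ h(2)])
    obtain N where N: "\<And>n. n \<ge> N \<Longrightarrow> sq (g n) < L + e"
      using order_tendstoD(2)[OF L, of "L + e"] e by (auto simp: eventually_sequentially sq_def)
    show "\<forall>\<^sub>F n in sequentially. (LINT x|lebesgue. (z (r n) x)\<^sup>2) \<le> L + e"
    proof (rule eventually_sequentiallyI[of N])
      fix n assume n: "N \<le> n"
      show "(LINT x|lebesgue. (z (r n) x)\<^sup>2) \<le> L + e"
      proof (rule midpoint_hull_square_le[OF z(1) S])
        fix f assume "f \<in> S (r n)"
        then obtain m where m: "f = g m" "r n \<le> m" by (auto simp: S_def)
        then have "N \<le> m" using seq_suble[OF r, of n] n by linarith
        from N[OF this] show "(LINT x|lebesgue. (f x)\<^sup>2) \<le> L + e" by (simp add: m sq_def)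
      qed
    qed
  qed (use zL h(1) in \<open>auto simp: L2_supp_def\<close>)
  then have "(LINT x|lebesgue. (h x)\<^sup>2) \<le> L"
    by (rule field_le_epsilon)
  moreover have "prim2 l h x = R x" if x: "x \<in> {l..u}" for x
  proof -
    have "\<bar>prim2 l h x - R x\<bar> \<le> e" if e: "e > 0" for e
    proof -
      \<comment> \<open>Chosen for \<open>prim2_bound\<close> followed by
        \<open>L2_supp_L1_le\<close>, which together cost a factor \<open>(u - l) ^ 3\<close> on
        squared norms.\<close>
      have e': "(e / 2)\<^sup>2 / (u - l) ^ 3 > 0" using that \<open>l < u\<close> by simp
      obtain N1 where N1: "\<And>i. i \<ge> N1 \<Longrightarrow> (LINT x|lebesgue. (z i x - h x)\<^sup>2) \<le> (e / 2)\<^sup>2 / (u - l) ^ 3"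
        using h(3)[OF e'] by blast
      obtain N2 where N2: "\<And>n. n \<ge> N2 \<Longrightarrow> \<bar>prim2 l (g n) x - R x\<bar> < e / 2"
        using LIMSEQ_D[OF R[OF x], of "e/2"] e by auto
      define n where "n = max N1 N2"
      have 1: "\<bar>prim2 l (z n) x - R x\<bar> \<le> e / 2"
      proof (rule midpoint_hull_prim2[OF z(1) S])
        fix f assume "f \<in> S n"
        then obtain m where m: "f = g m" "n \<le> m" by (auto simp: S_def)
        then have "N2 \<le> m" by (simp add: n_def)
        from N2[OF this] show "\<bar>prim2 l f x - R x\<bar> \<le> e / 2" by (simp add: m)
      qed
      have dL: "L2_supp l u (\<lambda>x. z n x - h x)" by (rule L2_supp_diff[OF zL h(1)])
      have "\<bar>prim2 l (\<lambda>x. z n x - h x) x\<bar> \<le> e / 2"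
      proof (rule power2_le_imp_le)
        let ?m = "LINT x|lebesgue. \<bar>z n x - h x\<bar>"
        have "\<bar>prim2 l (\<lambda>x. z n x - h x) x\<bar>\<^sup>2 \<le> ((u - l) * ?m)\<^sup>2"
          by (rule power_mono[OF prim2_bound[OF dL x]]) simp
        also have "\<dots> \<le> (u - l)\<^sup>2 * ((u - l) * (LINT x|lebesgue. (z n x - h x)\<^sup>2))"
          unfolding power_mult_distrib by (intro mult_left_mono L2_supp_L1_le[OF \<open>l < u\<close> dL]) simp
        also have "\<dots> \<le> (u - l)\<^sup>2 * ((u - l) * ((e / 2)\<^sup>2 / (u - l) ^ 3))"
          using N1[of n] \<open>l < u\<close> by (intro mult_left_mono) (auto simp: n_def)
        also have "\<dots> = (e / 2)\<^sup>2" using \<open>l < u\<close> by (simp add: power2_eq_square power3_eq_cube)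
        finally show "\<bar>prim2 l (\<lambda>x. z n x - h x) x\<bar>\<^sup>2 \<le> (e / 2)\<^sup>2" .
      qed (use that in simp)
      moreover have "prim2 l (\<lambda>x. z n x - h x) x = prim2 l (z n) x - prim2 l h x"
        using prim2_lincomb[OF zL[of n] h(1), of 1 "-1" x] by simp
      ultimately show ?thesis using 1 by linarith
    qed
    then have "\<bar>prim2 l h x - R x\<bar> \<le> 0" by (rule field_le_epsilon) simp
    then show ?thesis by simp
  qed
  moreover have "\<forall>c d. (\<forall>n. L2_supp c d (g n)) \<longrightarrow> L2_supp c d h"
  proof (intro allI impI)
    fix c d assume cd: "\<forall>n. L2_supp c d (g n)"
    \<comment> \<open>Elements of the hull vanish wherever all \<open>g n\<close> do, and the
      pointwise limit keeps these zeros.\<close>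
    have "L2_supp c d (z n)" for n
      by (rule midpoint_hull_L2[OF z(1)]) (use cd in \<open>auto simp: S_def\<close>)
    then have "h x = 0" if "x \<notin> {c<..<d}" for x
      using h0[of x] that by (auto simp: L2_supp_def)
    then show "L2_supp c d h" using h(1) by (simp add: L2_supp_def)
  qed
  ultimately show thesis by (rule that[OF h(1)])
qed

text \<open>Weak compactness in L2 in a concrete form. Convergence is expressed by the double
  primitives: these are bounded and equicontinuous, so Arzela-Ascoli gives a limit \<open>R\<close>,
  and \<open>L2_weak_limit\<close> realizes \<open>R\<close> as a double primitive. The last clause
  keeps the support in a smaller interval.\<close>

lemma L2_weak_compact:
  assumes "l < u" and g: "\<And>n. L2_supp l u (g n)"
    and L: "(\<lambda>n. LINT x|lebesgue. (g n x)\<^sup>2) \<longlonglongrightarrow> L"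
  obtains r h where "strict_mono r" "L2_supp l u h" "(LINT x|lebesgue. (h x)\<^sup>2) \<le> L"
    "\<And>x. x \<in> {l..u} \<Longrightarrow> (\<lambda>n. prim2 l (g (r n)) x) \<longlonglongrightarrow> prim2 l h x"
    "\<forall>c d. (\<forall>n. L2_supp c d (g n)) \<longrightarrow> L2_supp c d h"
proof -
  obtain C where C: "\<And>n. (LINT x|lebesgue. (g n x)\<^sup>2) \<le> C" "C > 0"
    using convergent_imp_Bseq[OF convergentI[OF L]] unfolding Bseq_def by (auto simp: abs_le_iff)
  define B where "B = sqrt ((u - l) * C)"
  have B0: "B > 0" using C \<open>l < u\<close> by (simp add: B_def)
  have B: "(LINT x|lebesgue. \<bar>g n x\<bar>) \<le> B" for n
  proof -
    have "(LINT x|lebesgue. \<bar>g n x\<bar>)\<^sup>2 \<le> (u - l) * (LINT x|lebesgue. (g n x)\<^sup>2)"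
      by (rule L2_supp_L1_le[OF \<open>l < u\<close> g])
    also have "\<dots> \<le> (u - l) * C" using C(1) \<open>l < u\<close> by (intro mult_left_mono) auto
    finally show ?thesis unfolding B_def by (rule real_le_rsqrt)
  qed
  have lip: "\<bar>prim2 l (g n) x - prim2 l (g n) y\<bar> \<le> \<bar>x - y\<bar> * B" if "x \<in> {l..u}" "y \<in> {l..u}" for n x y
  proof -
    have *: "\<bar>prim2 l (g n) y - prim2 l (g n) x\<bar> \<le> \<bar>y - x\<bar> * B" if "l \<le> x" "x \<le> y" for x y
      using prim2_Lipschitz[OF g that, of n] mult_left_mono[OF B[of n], of "y - x"] that by simp
    show ?thesis
      using *[of x y] *[of y x] that by (cases "x \<le> y") (auto simp: abs_minus_commute)
  qed
  obtain R :: "real \<Rightarrow> real" and r :: "nat \<Rightarrow> nat" where r: "strict_mono r"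
    and R: "\<And>e. 0 < e \<Longrightarrow> \<exists>N. \<forall>n x. n \<ge> N \<and> x \<in> {l..u} \<longrightarrow> norm (prim2 l (g (r n)) x - R x) < e"
  proof (rule Arzela_Ascoli[of "{l..u}" "\<lambda>n. prim2 l (g n)" "(u - l) * B"])
    show "norm (prim2 l (g n) x) \<le> (u - l) * B" if "x \<in> {l..u}" for n x
    proof -
      have "(u - l) * (LINT x|lebesgue. \<bar>g n x\<bar>) \<le> (u - l) * B"
        by (rule mult_left_mono[OF B]) (use \<open>l < u\<close> in simp)
      with prim2_bound[OF g that, of n] show ?thesis unfolding real_norm_def by linarith
    qed
    show "\<exists>d>0. \<forall>n y. y \<in> {l..u} \<and> norm (x - y) < d \<longrightarrow> norm (prim2 l (g n) x - prim2 l (g n) y) < e"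
      if x: "x \<in> {l..u}" and e: "0 < e" for x e
    proof (intro exI[of _ "e / B"] conjI allI impI)
      show "e / B > 0" using e B0 by simp
      fix n y assume y: "y \<in> {l..u} \<and> norm (x - y) < e / B"
      have "\<bar>prim2 l (g n) x - prim2 l (g n) y\<bar> \<le> \<bar>x - y\<bar> * B" using lip x y by blast
      also have "\<dots> < e" using y B0 by (simp add: pos_less_divide_eq)
      finally show "norm (prim2 l (g n) x - prim2 l (g n) y) < e" by simp
    qed
    fix R :: "real \<Rightarrow> real" and r :: "nat \<Rightarrow> nat"
    assume r: "strict_mono r" and R: "\<And>e. 0 < e \<Longrightarrow> \<exists>N. \<forall>n x. n \<ge> N \<and> x \<in> {l..u} \<longrightarrow> norm (prim2 l (g (r n)) x - R x) < e"
    show thesis using that r R by blast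
  qed simp
  have lim: "(\<lambda>n. prim2 l (g (r n)) x) \<longlonglongrightarrow> R x" if x: "x \<in> {l..u}" for x
  proof (rule LIMSEQ_I)
    fix e :: real assume "0 < e"
    from R[OF this] x show "\<exists>N. \<forall>n\<ge>N. norm (prim2 l (g (r n)) x - R x) < e" by blast
  qed
  have Lr: "(\<lambda>n. LINT x|lebesgue. (g (r n) x)\<^sup>2) \<longlonglongrightarrow> L"
    using LIMSEQ_subseq_LIMSEQ[OF L r] by (simp add: comp_def)
  obtain h where h: "L2_supp l u h" "(LINT x|lebesgue. (h x)\<^sup>2) \<le> L" "\<And>x. x \<in> {l..u} \<Longrightarrow> prim2 l h x = R x"
    "\<forall>c d. (\<forall>n. L2_supp c d (g (r n))) \<longrightarrow> L2_supp c d h"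
    by (rule L2_weak_limit[OF \<open>l < u\<close> g Lr lim]) (assumption | rule that)+
  show thesis by (rule that[OF r h(1,2)]) (use lim h(3,4) in auto)
qed

subsection \<open>The functional on iterated piecewise primitives\<close>

definition cost :: "real \<Rightarrow> real \<Rightarrow> real \<Rightarrow> real \<Rightarrow> real" where
  "cost \<alpha> \<beta> a b = (if a \<noteq> 0 then \<alpha> else if b \<noteq> 0 then \<beta> else 0)"

lemma sum_cost:
  assumes "finite I"
  shows "(\<Sum>i\<in>I. cost \<alpha> \<beta> (a i) (b i)) = \<alpha> * card {i \<in> I. a i \<noteq> 0} + \<beta> * card {i \<in> I. a i = 0 \<and> b i \<noteq> 0}"
proof -
  have "(\<Sum>i\<in>I. cost \<alpha> \<beta> (a i) (b i)) =
      (\<Sum>i\<in>I. (if a i \<noteq> 0 then \<alpha> else 0) + (if a i = 0 \<and> b i \<noteq> 0 then \<beta> else 0))"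
    by (intro sum.cong) (auto simp: cost_def)
  also have "\<dots> = (\<Sum>i\<in>{i \<in> I. a i \<noteq> 0}. \<alpha>) + (\<Sum>i\<in>{i \<in> I. a i = 0 \<and> b i \<noteq> 0}. \<beta>)"
    unfolding sum.distrib sum.inter_filter[OF assms] ..
  finally show ?thesis by simp
qed

lemma counting_measure_finite: "finite A \<Longrightarrow> counting_measure A = ereal (card A)"
  by (simp add: emeasure_count_space_finite ereal_of_enat_simps flip: ennreal_of_nat_eq_real_of_nat)

text \<open>Uniqueness replaces the derivatives chosen by \<open>SOME\<close> with \<open>g\<close>
  and \<open>h\<close>, and injectivity of \<open>t\<close> turns counts of points into counts of
  indices. A crease at a point that is also a jump is not counted, as in
  \<open>cost\<close>.\<close>

lemma F1_pw_prim:
  assumes g: "L2_supp (-2) 2 g" and h: "L2_supp (-2) 2 h"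
    and I: "finite I" "inj_on t I" "t ` I \<subseteq> {-2<..<2}"
    and V: "V = pw_prim (-2) p (pw_prim (-2) q g I t b) I t a"
    and P: "P = pw_prim (-2) p' (pw_prim (-2) q' h {} t' c) {} t'' c'"
    and vr: "AE x in lebesgue. x \<in> {-2<..<2} \<longrightarrow> vr x = V x"
    and vp: "AE x in lebesgue. x \<in> {-2<..<2} \<longrightarrow> vp x = P x"
  shows "F1 \<alpha> \<beta> \<eta> \<mu> \<gamma> fr fp vr vp = ereal ((\<Sum>i\<in>I. cost \<alpha> \<beta> (a i) (b i))
    + (LINT x:{-1<..<1}|lebesgue. \<eta> * (g x)\<^sup>2 - fr x * V x)
    + \<mu> * (LINT x:{-1<..<1}|lebesgue. (V x - P x)\<^sup>2)
    + (LINT x:{-1<..<1}|lebesgue. \<gamma> * (h x)\<^sup>2 - fp x * P x))"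
proof -
  let ?D = "ac_deriv (-2) 2 vr"
  have gi: "set_integrable lebesgue {-2..2} g" "set_integrable lebesgue {-2..2} h"
    using g h by (auto intro: L2_supp_set_integrable)
  note si = set_integrable_pw_prim'[OF gi(1), of q I t b]
  have D: "AE x in lebesgue. x \<in> {-2<..<2} \<longrightarrow> ?D x = pw_prim (-2) q g I t b x"
    by (rule ac_deriv_pw_prim[OF si _ _ I(1) vr[unfolded V]]) auto
  have DD: "AE x in lebesgue. x \<in> {-2<..<2} \<longrightarrow> ac_deriv (-2) 2 ?D x = g x"
    by (rule ac_deriv_pw_prim[OF gi(1) _ _ I(1) D]) auto
  have "has_weak_deriv 2 (-2) 2 vp h"
    by (rule Sobolev_H2_pw_prim(2)[OF _ _ h vp[unfolded P]]) auto
  then have vp'': "AE x in lebesgue. x \<in> {-2<..<2} \<longrightarrow> weak_deriv 2 (-2) 2 vp x = h x"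
    unfolding weak_deriv_def by (metis has_weak_deriv_unique someI_ex)
  have d1: "disc_set (-2) 2 vr = t ` {i \<in> I. a i \<noteq> 0}"
    unfolding disc_set_cong_AE[OF vr] V
    by (subst disc_set_pw_prim[OF si _ _ I(1,2)]) (use I(3) in auto)
  have d2: "disc_set (-2) 2 ?D = t ` {i \<in> I. b i \<noteq> 0}"
    unfolding disc_set_cong_AE[OF D]
    by (subst disc_set_pw_prim[OF gi(1) _ _ I(1,2)]) (use I(3) in auto)
  have d3: "disc_set (-2) 2 ?D - disc_set (-2) 2 vr = t ` {i \<in> I. a i = 0 \<and> b i \<noteq> 0}"
    unfolding d1 d2 using I(2) by (auto simp: inj_on_def)
  have inj: "inj_on t J" if "J \<subseteq> I" for J
    using I(2) that by (rule inj_on_subset)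
  have c1: "counting_measure (disc_set (-2) 2 vr) = ereal (card {i \<in> I. a i \<noteq> 0})"
    unfolding d1 using I(1) by (subst counting_measure_finite) (auto simp: card_image inj)
  have c2: "counting_measure (disc_set (-2) 2 ?D - disc_set (-2) 2 vr) = ereal (card {i \<in> I. a i = 0 \<and> b i \<noteq> 0})"
    unfolding d3 using I(1) by (subst counting_measure_finite) (auto simp: card_image inj)
  have i1: "(LINT x:{-1<..<1}|lebesgue. \<eta> * \<bar>ac_deriv (-2) 2 ?D x\<bar>\<^sup>2 - fr x * vr x)
      = (LINT x:{-1<..<1}|lebesgue. \<eta> * (g x)\<^sup>2 - fr x * V x)"
    by (rule set_integral_lebesgue_cong_AE, rule eventually_elim2[OF DD vr]) auto
  have i2: "(LINT x:{-1<..<1}|lebesgue. \<bar>vr x - vp x\<bar>\<^sup>2) = (LINT x:{-1<..<1}|lebesgue. (V x - P x)\<^sup>2)"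
    by (rule set_integral_lebesgue_cong_AE, rule eventually_elim2[OF vp vr]) auto
  have i3: "(LINT x:{-1<..<1}|lebesgue. \<gamma> * \<bar>weak_deriv 2 (-2) 2 vp x\<bar>\<^sup>2 - fp x * vp x)
      = (LINT x:{-1<..<1}|lebesgue. \<gamma> * (h x)\<^sup>2 - fp x * P x)"
    by (rule set_integral_lebesgue_cong_AE, rule eventually_elim2[OF vp'' vp]) auto
  show ?thesis
    unfolding F1_def Let_def c1 c2 i1 i2 i3 sum_cost[OF I(1)] by simp
qed

lemma set_integral_L2_square:
  assumes "f \<in> L2 a b" shows "set_integrable lebesgue {a<..<b} (\<lambda>x. c * (f x)\<^sup>2)"
  using assms by (auto simp: L2_def)

text \<open>Completing the square makes the fidelity term nonnegative.\<close>

lemma integral_complete_square: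
  assumes g: "g \<in> L2 a b" and h: "h \<in> L2 a b" and V: "V \<in> L2 a b" and P: "P \<in> L2 a b"
    and fr: "fr \<in> L2 a b" and fp: "fp \<in> L2 a b" and "\<mu> > (0::real)"
  shows "(LINT x:{a<..<b}|lebesgue. \<eta> * (g x)\<^sup>2 - fr x * V x) + \<mu> * (LINT x:{a<..<b}|lebesgue. (V x - P x)\<^sup>2)
      + (LINT x:{a<..<b}|lebesgue. \<gamma> * (h x)\<^sup>2 - fp x * P x)
    = \<eta> * (LINT x:{a<..<b}|lebesgue. (g x)\<^sup>2) + \<mu> * (LINT x:{a<..<b}|lebesgue. (V x - P x - fr x / (2 * \<mu>))\<^sup>2)
      + \<gamma> * (LINT x:{a<..<b}|lebesgue. (h x)\<^sup>2) - (LINT x:{a<..<b}|lebesgue. (fr x + fp x) * P x)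
      - (LINT x:{a<..<b}|lebesgue. (fr x)\<^sup>2) / (4 * \<mu>)"
proof -
  note m = L2_mult_set_integrable
  have VP: "set_integrable lebesgue {a<..<b} (\<lambda>x. \<mu> * (V x - P x)\<^sup>2)"
  proof -
    have "set_integrable lebesgue {a<..<b} (\<lambda>x. V x * V x + P x * P x - (V x * P x + V x * P x))"
      by (intro set_integral_diff(1) set_integral_add(1) m V P)
    then have "set_integrable lebesgue {a<..<b} (\<lambda>x. \<mu> * (V x * V x + P x * P x - (V x * P x + V x * P x)))"
      by simp
    moreover have "(\<lambda>x. \<mu> * (V x * V x + P x * P x - (V x * P x + V x * P x))) = (\<lambda>x. \<mu> * (V x - P x)\<^sup>2)"
      by (simp add: power2_eq_square algebra_simps)
    ultimately show ?thesis by (simp only:)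
  qed
  have 1: "(LINT x:{a<..<b}|lebesgue. \<eta> * (g x)\<^sup>2 - fr x * V x)
      = \<eta> * (LINT x:{a<..<b}|lebesgue. (g x)\<^sup>2) - (LINT x:{a<..<b}|lebesgue. fr x * V x)"
    using set_integral_diff(2)[OF set_integral_L2_square[OF g, of \<eta>] m[OF fr V]] by simp
  have 2: "(LINT x:{a<..<b}|lebesgue. \<gamma> * (h x)\<^sup>2 - fp x * P x)
      = \<gamma> * (LINT x:{a<..<b}|lebesgue. (h x)\<^sup>2) - (LINT x:{a<..<b}|lebesgue. fp x * P x)"
    using set_integral_diff(2)[OF set_integral_L2_square[OF h, of \<gamma>] m[OF fp P]] by simp
  have 3: "(LINT x:{a<..<b}|lebesgue. (fr x + fp x) * P x)
      = (LINT x:{a<..<b}|lebesgue. fr x * P x) + (LINT x:{a<..<b}|lebesgue. fp x * P x)"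
    using set_integral_add(2)[OF m[OF fr P] m[OF fp P]] by (simp add: distrib_right)
  have "\<mu> * (LINT x:{a<..<b}|lebesgue. (V x - P x - fr x / (2 * \<mu>))\<^sup>2)
      = (LINT x:{a<..<b}|lebesgue. \<mu> * (V x - P x - fr x / (2 * \<mu>))\<^sup>2)" by simp
  also have "\<dots> = (LINT x:{a<..<b}|lebesgue. (\<mu> * (V x - P x)\<^sup>2 - fr x * V x)
      + (fr x * P x + 1 / (4 * \<mu>) * (fr x)\<^sup>2))"
  proof -
    have "\<mu> * (v - p - f / (2 * \<mu>))\<^sup>2 = (\<mu> * (v - p)\<^sup>2 - f * v) + (f * p + 1 / (4 * \<mu>) * f\<^sup>2)" for v p f
    proof -
      have "\<mu> * (v - p - f / (2 * \<mu>))\<^sup>2 = \<mu> * (v - p)\<^sup>2 - (v - p) * (2 * \<mu> * (f / (2 * \<mu>))) + (2 * \<mu> * (f / (2 * \<mu>)))\<^sup>2 / (4 * \<mu>)"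
        using \<open>\<mu> > 0\<close> by (simp add: power2_eq_square algebra_simps)
      also have "2 * \<mu> * (f / (2 * \<mu>)) = f" using \<open>\<mu> > 0\<close> by simp
      finally show ?thesis by (simp add: algebra_simps)
    qed
    then show ?thesis by simp
  qed
  also have "\<dots> = (LINT x:{a<..<b}|lebesgue. \<mu> * (V x - P x)\<^sup>2 - fr x * V x)
      + (LINT x:{a<..<b}|lebesgue. fr x * P x + 1 / (4 * \<mu>) * (fr x)\<^sup>2)"
    by (intro set_integral_add(2) set_integral_add(1) set_integral_diff(1) VP m fr V P set_integral_L2_square)
  also have "(LINT x:{a<..<b}|lebesgue. \<mu> * (V x - P x)\<^sup>2 - fr x * V x)
      = \<mu> * (LINT x:{a<..<b}|lebesgue. (V x - P x)\<^sup>2) - (LINT x:{a<..<b}|lebesgue. fr x * V x)"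
    using set_integral_diff(2)[OF VP m[OF fr V]] by simp
  also have "(LINT x:{a<..<b}|lebesgue. fr x * P x + 1 / (4 * \<mu>) * (fr x)\<^sup>2)
      = (LINT x:{a<..<b}|lebesgue. fr x * P x) + 1 / (4 * \<mu>) * (LINT x:{a<..<b}|lebesgue. (fr x)\<^sup>2)"
    using set_integral_add(2)[OF m[OF fr P] set_integral_L2_square[OF fr, of "1 / (4 * \<mu>)"]] by simp
  finally show ?thesis unfolding 1 2 3 by simp
qed

section \<open>Normal forms of admissible functions\<close>

lemma integral_spike_AE:
  assumes "AE x in lebesgue. x \<in> {c<..<d} \<longrightarrow> f x = g x" "c \<le> l" "x \<le> d"
  shows "integral {l..x} f = integral {l..x::real} (g :: real \<Rightarrow> real)"
proof -
  obtain N where N: "N \<in> null_sets lebesgue" "\<And>x. x \<in> space lebesgue - N \<Longrightarrow> x \<in> {c<..<d} \<longrightarrow> f x = g x"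
    using AE_E3[OF assms(1)] by metis
  have "negligible (N \<union> {c, d})"
    using N(1) by (auto intro!: negligible_Un simp: negligible_iff_null_sets)
  then show ?thesis
  proof (rule integral_spike)
    fix y assume "y \<in> {l..x} - (N \<union> {c, d})"
    then show "g y = f y" using N(2)[of y] assms(2,3) by auto
  qed
qed

text \<open>Two applications of the fundamental theorem of calculus. The step data over the empty
  index set are left arbitrary, to fit every later use.\<close>

lemma C2_on_pw_prim:
  assumes "C2_on {l..u} w" "l < u"
  obtains p q g where "L2_supp l u g"
    "\<And>x t c t' c'. x \<in> {l..u} \<Longrightarrow> w x = pw_prim l p (pw_prim l q g {} t c) {} t' c' x"
proof -
  obtain w' w'' where d: "\<And>x. x \<in> {l..u} \<Longrightarrow> (w has_real_derivative w' x) (at x within {l..u})"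
    "\<And>x. x \<in> {l..u} \<Longrightarrow> (w' has_real_derivative w'' x) (at x within {l..u})"
    and c: "continuous_on {l..u} w''"
    using assms(1) unfolding C2_on_def by blast
  have ftc: "integral {l..x} f' = f x - f l"
    if "\<And>x. x \<in> {l..u} \<Longrightarrow> (f has_real_derivative f' x) (at x within {l..u})" "x \<in> {l..u}" for f f' x
  proof (rule integral_unique, rule fundamental_theorem_of_calculus)
    fix y assume "y \<in> {l..x}"
    then have "y \<in> {l..u}" using that(2) by auto
    from that(1)[OF this] have "(f has_vector_derivative f' y) (at y within {l..u})"
      by (simp add: has_real_derivative_iff_has_vector_derivative)
    then show "(f has_vector_derivative f' y) (at y within {l..x})"
      by (rule has_vector_derivative_within_subset) (use that(2) in auto)
  qed (use that(2) in auto)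
  define g where "g x = indicator {l<..<u} x * w'' x" for x
  have "w'' \<in> L2 l u"
  proof -
    obtain B where B: "\<And>x. x \<in> {l..u} \<Longrightarrow> \<bar>w'' x\<bar> \<le> B"
      using compact_imp_bounded[OF compact_continuous_image[OF c compact_Icc]]
      unfolding bounded_iff by (metis imageI real_norm_def)
    have "set_integrable lebesgue {l<..<u} w''"
      using absolutely_integrable_continuous_real[OF c] by (simp add: set_integrable_open_interval)
    then have "set_borel_measurable lebesgue {l<..<u} w''"
      by (auto simp: set_integrable_def set_borel_measurable_def)
    then show ?thesis by (rule bounded_imp_L2[where B = B]) (use B in auto)
  qed
  then have g: "L2_supp l u g" unfolding g_def by (rule L2_supp_restrict)
  have "AE x in lebesgue. x \<in> {l<..<u} \<longrightarrow> g x = w'' x"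
    by (intro AE_I2) (simp add: g_def)
  then have gw: "integral {l..x} g = integral {l..x} w''" if "x \<in> {l..u}" for x
    by (rule integral_spike_AE) (use that in auto)
  have w': "pw_prim l (w' l) g {} t c x = w' x" if "x \<in> {l..u}" for t c x
    using ftc[OF d(2) that] by (simp add: pw_prim_def gw[OF that])
  have "w x = pw_prim l (w l) (pw_prim l (w' l) g {} t c) {} t' c' x" if x: "x \<in> {l..u}" for x t c t' c'
  proof -
    have "integral {l..x} (pw_prim l (w' l) g {} t c) = integral {l..x} w'"
      by (rule Henstock_Kurzweil_Integration.integral_cong) (use x in \<open>auto intro: w'\<close>)
    then show ?thesis using ftc[OF d(1) x] by (simp add: pw_prim_def)
  qed
  with g show thesis by (rule that)
qed

text \<open>Derivatives and discontinuity sets are local: comparing absolutely continuous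
  derivatives once and twice gives the slopes and the densities, and the right-hand side has no
  discontinuities, so all coefficients at points of \<open>(c,d)\<close> vanish.\<close>

lemma pw_prim_local_unique:
  assumes g: "set_integrable lebesgue {l..u} g" "set_integrable lebesgue {l..u} g'"
    and cd: "l \<le> c" "d \<le> u" and I: "finite I" "inj_on t I"
    and eq: "AE x in lebesgue. x \<in> {c<..<d} \<longrightarrow>
      pw_prim l p (pw_prim l q g I t b) I t a x = pw_prim l p' (pw_prim l q' g' {} s e) {} s' e' x"
  shows "AE x in lebesgue. x \<in> {c<..<d} \<longrightarrow> pw_prim l q g I t b x = pw_prim l q' g' {} s e x"
    "AE x in lebesgue. x \<in> {c<..<d} \<longrightarrow> g x = g' x"
    "\<And>i. i \<in> I \<Longrightarrow> t i \<in> {c<..<d} \<Longrightarrow> a i = 0 \<and> b i = 0"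
proof -
  note s = set_integrable_pw_prim'[OF g(1)] set_integrable_pw_prim'[OF g(2)]
  have f: "finite ({} :: nat set)" "inj_on x ({} :: nat set)" for x :: "nat \<Rightarrow> real" by auto
  show 1: "AE x in lebesgue. x \<in> {c<..<d} \<longrightarrow> pw_prim l q g I t b x = pw_prim l q' g' {} s e x"
    by (rule has_ac_deriv_unique[OF has_ac_deriv_cong_AE[OF eq has_ac_deriv_pw_prim[OF s(1) cd I(1)]]
      has_ac_deriv_pw_prim[OF s(2) cd f(1)]])
  show "AE x in lebesgue. x \<in> {c<..<d} \<longrightarrow> g x = g' x"
    by (rule has_ac_deriv_unique[OF has_ac_deriv_cong_AE[OF 1 has_ac_deriv_pw_prim[OF g(1) cd I(1)]]
      has_ac_deriv_pw_prim[OF g(2) cd f(1)]])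
  have "{t i |i. i \<in> I \<and> a i \<noteq> 0} \<inter> {c<..<d} = {}"
    using disc_set_cong_AE[OF eq] unfolding disc_set_pw_prim[OF s(1) cd I] disc_set_pw_prim[OF s(2) cd f] by simp
  moreover have "{t i |i. i \<in> I \<and> b i \<noteq> 0} \<inter> {c<..<d} = {}"
    using disc_set_cong_AE[OF 1] unfolding disc_set_pw_prim[OF g(1) cd I] disc_set_pw_prim[OF g(2) cd f] by simp
  ultimately show "a i = 0 \<and> b i = 0" if "i \<in> I" "t i \<in> {c<..<d}" for i
    using that by blast
qed

text \<open>No step is switched on before \<open>d\<close> and the integrals agree, so one common
  point determines the constant.\<close>

lemma pw_prim_initial_unique:
  assumes f: "AE x in lebesgue. x \<in> {l<..<d} \<longrightarrow> f x = f' x" and "l < d" and t: "\<And>i. i \<in> I \<Longrightarrow> d \<le> t i"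
    and eq: "AE x in lebesgue. x \<in> {l<..<d} \<longrightarrow> pw_prim l p f I t c x = pw_prim l p' f' {} s e x"
  shows "p = p'"
proof -
  obtain x where x: "l < x" "x < d" "pw_prim l p f I t c x = pw_prim l p' f' {} s e x"
    using AE_interval_ex[OF eq, of l d] \<open>l < d\<close> by auto
  have "(\<Sum>i\<in>I. if t i \<le> x then c i else 0) = 0"
    using t x by (intro sum.neutral) force
  moreover have "integral {l..x} f = integral {l..x} f'"
    by (rule integral_spike_AE[OF f]) (use x in auto)
  ultimately show ?thesis using x(3) by (simp add: pw_prim_def)
qed

lemma pw_prim_drop_zero:
  assumes "finite I" "\<And>i. i \<in> I - J \<Longrightarrow> c i = 0" "J \<subseteq> I"
  shows "pw_prim l p f I t c = pw_prim l p f J t c"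
  unfolding pw_prim_def using assms by (intro ext arg_cong2[where f = "(+)"] refl sum.mono_neutral_right) auto

text \<open>Agreement with \<open>w\<close> near \<open>l\<close> fixes both constants of
  integration, and near both ends it excludes singular points. They may still sit at
  \<open>c\<close> or \<open>d\<close>, whence the closed interval.\<close>

lemma piecewise_H2_normal_form:
  assumes w: "L2_supp l u w2" "\<And>x. x \<in> {l<..<u} \<Longrightarrow> w x = pw_prim l p (pw_prim l q w2 {} s e) {} s' e' x"
    and v: "v \<in> piecewise_H2 l u" and cd: "l < c" "c < d" "d < u"
    and eq: "AE x in lebesgue. x \<in> {l<..<c} \<union> {d<..<u} \<longrightarrow> v x = w x"
  obtains g I t a b where "L2_supp l u g" "finite I" "inj_on t I" "t ` I \<subseteq> {c..d}"
    "\<And>i. i \<in> I \<Longrightarrow> a i \<noteq> 0 \<or> b i \<noteq> 0"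
    "AE x in lebesgue. x \<in> {l<..<u} \<longrightarrow> v x = pw_prim l p (pw_prim l q g I t b) I t a x"
    "AE x in lebesgue. x \<in> {l<..<c} \<union> {d<..<u} \<longrightarrow> g x = w2 x"
proof -
  have "l < u" using cd by simp
  obtain p1 q1 g J t a b where g: "L2_supp l u g" and J: "finite J" "inj_on t J" "t ` J \<subseteq> {l<..<u}"
    and vJ: "AE x in lebesgue. x \<in> {l<..<u} \<longrightarrow> v x = pw_prim l p1 (pw_prim l q1 g J t b) J t a x"
    using piecewise_H2_imp_pw_prim[OF v \<open>l < u\<close>] by metis
  \<comment> \<open>Points with both coefficients 0 are dropped, so that every remaining point is
    paid for.\<close>
  define I where "I = {i \<in> J. a i \<noteq> 0 \<or> b i \<noteq> 0}"
  have I: "finite I" "inj_on t I" "I \<subseteq> J" using J by (auto simp: I_def intro: inj_on_subset)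
  have "pw_prim l q1 g J t b = pw_prim l q1 g I t b"
    by (rule pw_prim_drop_zero) (use J in \<open>auto simp: I_def\<close>)
  moreover have "pw_prim l p1 f J t a = pw_prim l p1 f I t a" for f
    by (rule pw_prim_drop_zero) (use J in \<open>auto simp: I_def\<close>)
  ultimately have vI: "AE x in lebesgue. x \<in> {l<..<u} \<longrightarrow> v x = pw_prim l p1 (pw_prim l q1 g I t b) I t a x"
    using vJ by simp
  have gi: "set_integrable lebesgue {l..u} g" "set_integrable lebesgue {l..u} w2"
    using g w(1) by (auto intro: L2_supp_set_integrable)
  have e: "AE x in lebesgue. x \<in> {y<..<z} \<longrightarrow>
      pw_prim l p1 (pw_prim l q1 g I t b) I t a x = pw_prim l p (pw_prim l q w2 {} s e) {} s' e' x"
    if "{y<..<z} \<subseteq> {l<..<c} \<union> {d<..<u}" for y z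
    by (rule eventually_elim2[OF vI eq]) (use that w(2) cd in \<open>auto simp: subset_iff\<close>)
  have e1: "AE x in lebesgue. x \<in> {l<..<c} \<longrightarrow>
      pw_prim l p1 (pw_prim l q1 g I t b) I t a x = pw_prim l p (pw_prim l q w2 {} s e) {} s' e' x"
    and e2: "AE x in lebesgue. x \<in> {d<..<u} \<longrightarrow>
      pw_prim l p1 (pw_prim l q1 g I t b) I t a x = pw_prim l p (pw_prim l q w2 {} s e) {} s' e' x"
    by (rule e, simp)+
  have cl: "l \<le> l" "c \<le> u" "l \<le> d" "u \<le> u" using cd by auto
  note u1 = pw_prim_local_unique[OF gi cl(1,2) I(1,2) e1]
  note u2 = pw_prim_local_unique[OF gi cl(3,4) I(1,2) e2]
  have t: "t i \<in> {c..d}" if "i \<in> I" for i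
  proof -
    have "a i \<noteq> 0 \<or> b i \<noteq> 0" using that by (simp add: I_def)
    then have "t i \<notin> {l<..<c}" "t i \<notin> {d<..<u}" using u1(3)[OF that] u2(3)[OF that] by blast+
    moreover have "t i \<in> {l<..<u}" using that I(3) J(3) by blast
    ultimately show ?thesis by auto
  qed
  have q: "q1 = q"
    by (rule pw_prim_initial_unique[OF u1(2) cd(1) _ u1(1)]) (use t in auto)
  have p: "p1 = p"
    by (rule pw_prim_initial_unique[OF u1(1) cd(1) _ e1]) (use t in auto)
  have "AE x in lebesgue. x \<in> {l<..<c} \<union> {d<..<u} \<longrightarrow> g x = w2 x"
    by (rule eventually_elim2[OF u1(2) u2(2)]) auto
  moreover have "t ` I \<subseteq> {c..d}" using t by blast
  moreover have "a i \<noteq> 0 \<or> b i \<noteq> 0" if "i \<in> I" for i using that by (simp add: I_def)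
  ultimately show thesis
    using vI unfolding p q by (intro that[OF g I(1,2)])
qed

lemma Sobolev_H2_normal_form:
  assumes w: "L2_supp l u w2" "\<And>x. x \<in> {l<..<u} \<Longrightarrow> w x = pw_prim l p (pw_prim l q w2 {} s e) {} s' e' x"
    and v: "v \<in> Sobolev_H 2 l u" and cd: "l < c" "c < d" "d < u"
    and eq: "AE x in lebesgue. x \<in> {l<..<c} \<union> {d<..<u} \<longrightarrow> v x = w x"
  obtains h where "L2_supp l u h"
    "AE x in lebesgue. x \<in> {l<..<u} \<longrightarrow> v x = pw_prim l p (pw_prim l q h {} s e) {} s' e' x"
    "AE x in lebesgue. x \<in> {l<..<c} \<union> {d<..<u} \<longrightarrow> h x = w2 x"
proof -
  have "l < u" using cd by simp
  obtain z where z: "z \<in> L2 l u" "has_weak_deriv 2 l u v z"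
    using Sobolev_H_weak_deriv[OF v, of 2] by auto
  define h where "h x = indicator {l<..<u} x * z x" for x
  have h: "L2_supp l u h" unfolding h_def by (rule L2_supp_restrict[OF z(1)])
  have gi: "set_integrable lebesgue {l..u} h" "set_integrable lebesgue {l..u} w2"
    using h w(1) by (auto intro: L2_supp_set_integrable)
  have "AE x in lebesgue. x \<in> {l<..<u} \<longrightarrow> z x = h x" by (intro AE_I2) (simp add: h_def)
  then obtain p1 q1 where pq: "AE x in lebesgue. x \<in> {l<..<u} \<longrightarrow> v x = pw_prim l p1 (pw_prim l q1 h {} s e) {} s' e' x"
    using Sobolev_H2_primitive[OF \<open>l < u\<close> order_refl order_refl v gi(1) z(2)] by metis
  have e: "AE x in lebesgue. x \<in> {y<..<z} \<longrightarrow>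
      pw_prim l p1 (pw_prim l q1 h {} s e) {} s' e' x = pw_prim l p (pw_prim l q w2 {} s e) {} s' e' x"
    if "{y<..<z} \<subseteq> {l<..<c} \<union> {d<..<u}" for y z
    by (rule eventually_elim2[OF pq eq]) (use that w(2) cd in \<open>auto simp: subset_iff\<close>)
  \<comment> \<open>Over the empty index set the locations do not matter;
    \<open>pw_prim_local_unique\<close> wants the same ones at both levels.\<close>
  have s0: "pw_prim l p1 (pw_prim l q1 h {} s e) {} s' e' = pw_prim l p1 (pw_prim l q1 h {} s e) {} s e"
    by (simp add: pw_prim_def[abs_def])
  have e1: "AE x in lebesgue. x \<in> {l<..<c} \<longrightarrow>
      pw_prim l p1 (pw_prim l q1 h {} s e) {} s e x = pw_prim l p (pw_prim l q w2 {} s e) {} s' e' x"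
    and e2: "AE x in lebesgue. x \<in> {d<..<u} \<longrightarrow>
      pw_prim l p1 (pw_prim l q1 h {} s e) {} s e x = pw_prim l p (pw_prim l q w2 {} s e) {} s' e' x"
    by (rule e[unfolded s0], simp)+
  have cl: "l \<le> l" "c \<le> u" "l \<le> d" "u \<le> u" using cd by auto
  have em: "finite ({} :: nat set)" "inj_on s ({} :: nat set)" by auto
  note u1 = pw_prim_local_unique[OF gi cl(1,2) em e1]
  note u2 = pw_prim_local_unique[OF gi cl(3,4) em e2]
  have q: "q1 = q" by (rule pw_prim_initial_unique[OF u1(2) cd(1) _ u1(1)]) auto
  have p: "p1 = p" by (rule pw_prim_initial_unique[OF u1(1) cd(1) _ e1]) auto
  have "AE x in lebesgue. x \<in> {l<..<c} \<union> {d<..<u} \<longrightarrow> h x = w2 x"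
    by (rule eventually_elim2[OF u1(2) u2(2)]) auto
  then show thesis
    using that[OF h] pq by (simp add: p q)
qed

subsection \<open>Limits of jumps and creases\<close>

text \<open>The singular part alone, separated from the double primitive because the two converge
  for different reasons.\<close>

definition steps :: "nat set \<Rightarrow> (nat \<Rightarrow> real) \<Rightarrow> (nat \<Rightarrow> real) \<Rightarrow> (nat \<Rightarrow> real) \<Rightarrow> real \<Rightarrow> real" where
  "steps I t a b x = (\<Sum>i\<in>I. if t i \<le> x then a i + b i * (x - t i) else 0)"

lemma pw_prim_eq_steps:
  assumes "L2_supp l u g" "finite I" "\<And>i. i \<in> I \<Longrightarrow> l \<le> t i" "x \<in> {l..u}"
  shows "pw_prim l p (pw_prim l q g I t b) I t a x = p + q * (x - l) + prim2 l g x + steps I t a b x"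
  unfolding prim2_def steps_def
  by (rule pw_prim_pw_prim[OF L2_supp_set_integrable[OF assms(1)] assms(4,2,3)]) simp

text \<open>The choice \<open>c n\<close> may alternate forever, as it does for the location of a
  merged point; a common limit of the two branches suffices.\<close>

lemma tendsto_if:
  assumes "(f \<longlongrightarrow> (L::real)) F" "(g \<longlongrightarrow> L) F"
  shows "((\<lambda>n. if c n then f n else g n) \<longlongrightarrow> L) F"
proof (rule tendstoI)
  fix e :: real assume "0 < e"
  from tendstoD[OF assms(1) this] tendstoD[OF assms(2) this]
  show "\<forall>\<^sub>F n in F. dist (if c n then f n else g n) L < e"
    by eventually_elim simp
qed

lemma eventually_same_side:
  assumes "(\<lambda>n. t n) \<longlonglongrightarrow> \<tau>" "x \<noteq> (\<tau> :: real)"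
  shows "\<forall>\<^sub>F n in sequentially. (t n \<le> x) = (\<tau> \<le> x)"
proof (cases "\<tau> < x")
  case True
  from order_tendstoD(2)[OF assms(1) True] show ?thesis
    by eventually_elim (use True in auto)
next
  case False
  then have "x < \<tau>" using assms(2) by simp
  from order_tendstoD(1)[OF assms(1) this] show ?thesis
    by eventually_elim (use \<open>x < \<tau>\<close> in auto)
qed

lemma cost_nonneg: "0 < \<beta> \<Longrightarrow> \<beta> \<le> \<alpha> \<Longrightarrow> 0 \<le> cost \<alpha> \<beta> a b"
  by (simp add: cost_def)

lemma sum_remove2:
  fixes f :: "'a \<Rightarrow> 'b::comm_monoid_add"
  assumes "finite I" "i \<in> I" "j \<in> I" "i \<noteq> j"
  shows "sum f I = f i + f j + sum f (I - {j} - {i})"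
  using assms by (simp add: sum.remove[of I j] sum.remove[of "I - {j}" i] ac_simps)

text \<open>Singular points with the same limit are merged into one: as \<open>\<alpha> \<le> 2 \<beta>\<close>, a jump costs at most
  as much as the two points it replaces, and the function changes only between them.\<close>

lemma merge_singular_points:
  assumes \<beta>: "0 < \<beta>" "\<beta> \<le> \<alpha>" "\<alpha> \<le> 2 * \<beta>"
    and "finite I" "\<And>i. i \<in> I \<Longrightarrow> (\<lambda>n. t n i) \<longlonglongrightarrow> \<tau> i"
  shows "\<exists>J t' a' b'. finite J \<and> J \<subseteq> I \<and> inj_on \<tau> J \<and> (\<forall>i\<in>J. (\<lambda>n. t' n i) \<longlonglongrightarrow> \<tau> i) \<and>
    (\<forall>n. (\<Sum>i\<in>J. cost \<alpha> \<beta> (a' n i) (b' n i)) \<le> (\<Sum>i\<in>I. cost \<alpha> \<beta> (a n i) (b n i))) \<and>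
    (\<forall>x. x \<notin> \<tau> ` I \<longrightarrow> (\<forall>\<^sub>F n in sequentially. steps J (t' n) (a' n) (b' n) x = steps I (t n) (a n) (b n) x))"
  using assms(4,5)
proof (induction "card I" arbitrary: I t a b rule: less_induct)
  case less
  show ?case
  proof (cases "inj_on \<tau> I")
    case True
    then show ?thesis using less.prems
      by (intro exI[of _ I] exI[of _ t] exI[of _ a] exI[of _ b]) auto
  next
    case False
    then obtain i j where ij: "i \<in> I" "j \<in> I" "i \<noteq> j" "\<tau> i = \<tau> j" by (auto simp: inj_on_def)
    \<comment> \<open>When \<open>i\<close> is idle and \<open>j\<close> is not, the merged point
      must sit at \<open>t n j\<close>: moving a pure crease to \<open>t n i\<close> would create a
      jump and raise the cost from \<open>\<beta>\<close> to \<open>\<alpha>\<close>.\<close>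
    define c where "c n \<longleftrightarrow> a n i = 0 \<and> b n i = 0 \<and> (a n j \<noteq> 0 \<or> b n j \<noteq> 0)" for n
    define t' where "t' n = (t n)(i := if c n then t n j else t n i)" for n
    \<comment> \<open>In the other case the point sits at \<open>t n i\<close>, and the coefficient
      is the value there of the sum of both affine terms, which must be kept to the right of the two
      points.\<close>
    define a' where "a' n = (a n)(i := if c n then a n j else a n i + a n j + b n j * (t n i - t n j))" for n
    define b' where "b' n = (b n)(i := b n i + b n j)" for n
    let ?J = "I - {j}"
    have lt: "card ?J < card I" using less.prems(1) ij by (intro psubset_card_mono) auto
    have fin: "finite ?J" using less.prems(1) by simp
    have lim: "(\<lambda>n. t' n k) \<longlonglongrightarrow> \<tau> k" if "k \<in> ?J" for k
    proof (cases "k = i")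
      case True
      then show ?thesis
        using tendsto_if[OF less.prems(2)[OF ij(2)], of "\<lambda>n. t n i" c] less.prems(2)[OF ij(1)] ij(4)
        by (simp add: t'_def)
    qed (use that less.prems(2) in \<open>simp add: t'_def\<close>)
    have J: "sum f ?J = f i + sum f (I - {j} - {i})" for f :: "nat \<Rightarrow> real"
      using fin ij by (intro sum.remove) auto
    note I2 = sum_remove2[OF less.prems(1) ij(1,2,3)]
    have cost: "(\<Sum>k\<in>?J. cost \<alpha> \<beta> (a' n k) (b' n k)) \<le> (\<Sum>k\<in>I. cost \<alpha> \<beta> (a n k) (b n k))" for n
    proof -
      have "(\<Sum>k\<in>I-{j}-{i}. cost \<alpha> \<beta> (a' n k) (b' n k)) = (\<Sum>k\<in>I-{j}-{i}. cost \<alpha> \<beta> (a n k) (b n k))"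
        by (rule sum.cong) (auto simp: a'_def b'_def)
      \<comment> \<open>Two active points cost at least \<open>2 * \<beta>\<close>, which covers a
        jump; if at most one is active, its cost is kept unchanged.\<close>
      moreover have "cost \<alpha> \<beta> (a' n i) (b' n i) \<le> cost \<alpha> \<beta> (a n i) (b n i) + cost \<alpha> \<beta> (a n j) (b n j)"
        using \<beta> by (auto simp: a'_def b'_def c_def cost_def)
      ultimately show ?thesis unfolding J I2 by linarith
    qed
    have ev: "\<forall>\<^sub>F n in sequentially. steps ?J (t' n) (a' n) (b' n) x = steps I (t n) (a n) (b n) x"
      if x: "x \<notin> \<tau> ` I" for x
    proof -
      have "x \<noteq> \<tau> i" "x \<noteq> \<tau> j" using x ij by auto
      \<comment> \<open>For large \<open>n\<close>, \<open>x\<close> lies on the same side of both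
        points, where the merged term agrees with the sum of the two old ones.\<close>
      from eventually_same_side[OF less.prems(2)[OF ij(1)] this(1)] eventually_same_side[OF less.prems(2)[OF ij(2)] this(2)]
      show ?thesis
      proof eventually_elim
        case (elim n)
        have "(\<Sum>k\<in>I-{j}-{i}. if t' n k \<le> x then a' n k + b' n k * (x - t' n k) else 0)
            = (\<Sum>k\<in>I-{j}-{i}. if t n k \<le> x then a n k + b n k * (x - t n k) else 0)"
          by (rule sum.cong) (auto simp: a'_def b'_def t'_def)
        moreover have "(if t' n i \<le> x then a' n i + b' n i * (x - t' n i) else 0)
            = (if t n i \<le> x then a n i + b n i * (x - t n i) else 0) + (if t n j \<le> x then a n j + b n j * (x - t n j) else 0)"
          using elim ij(4) by (auto simp: a'_def b'_def t'_def c_def algebra_simps)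
        ultimately show ?case unfolding steps_def J I2 by simp
      qed
    qed
    obtain J t2 a2 b2 where *: "finite J" "J \<subseteq> ?J" "inj_on \<tau> J" "\<forall>i\<in>J. (\<lambda>n. t2 n i) \<longlonglongrightarrow> \<tau> i"
      "\<forall>n. (\<Sum>i\<in>J. cost \<alpha> \<beta> (a2 n i) (b2 n i)) \<le> (\<Sum>i\<in>?J. cost \<alpha> \<beta> (a' n i) (b' n i))"
      "\<forall>x. x \<notin> \<tau> ` ?J \<longrightarrow> (\<forall>\<^sub>F n in sequentially. steps J (t2 n) (a2 n) (b2 n) x = steps ?J (t' n) (a' n) (b' n) x)"
      using less.hyps[OF lt fin lim, of a' b'] by blast
    have "\<forall>\<^sub>F n in sequentially. steps J (t2 n) (a2 n) (b2 n) x = steps I (t n) (a n) (b n) x" if x: "x \<notin> \<tau> ` I" for x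
    proof -
      have "x \<notin> \<tau> ` ?J" using x by auto
      with *(6) have "\<forall>\<^sub>F n in sequentially. steps J (t2 n) (a2 n) (b2 n) x = steps ?J (t' n) (a' n) (b' n) x" by blast
      with ev[OF x] show ?thesis by eventually_elim simp
    qed
    moreover have "\<forall>n. (\<Sum>i\<in>J. cost \<alpha> \<beta> (a2 n i) (b2 n i)) \<le> (\<Sum>i\<in>I. cost \<alpha> \<beta> (a n i) (b n i))"
      using *(5) cost order_trans by blast
    moreover have "J \<subseteq> I" using *(2) by blast
    ultimately show ?thesis using *(1,3,4) by blast
  qed
qed

lemma finite_bounded_sequences_subseq:
  assumes "finite S" "\<And>s. s \<in> S \<Longrightarrow> bounded (range (s :: nat \<Rightarrow> real))"
  obtains r :: "nat \<Rightarrow> nat" where "strict_mono r" "\<And>s. s \<in> S \<Longrightarrow> convergent (\<lambda>n. s (r n))"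
proof -
  have "\<exists>r :: nat \<Rightarrow> nat. strict_mono r \<and> (\<forall>s\<in>S. convergent (\<lambda>n. s (r n)))"
    using assms
  proof (induction S rule: finite_induct)
    case empty
    show ?case by (intro exI[of _ id]) (auto simp: strict_mono_def)
  next
    case (insert s S)
    then obtain r where r: "strict_mono r" "\<forall>s\<in>S. convergent (\<lambda>n. s (r n))" by auto
    have "bounded (range (\<lambda>n. s (r n)))"
      using insert.prems[of s] by (auto elim!: bounded_subset)
    then obtain L q where q: "strict_mono q" "((\<lambda>n. s (r n)) \<circ> q) \<longlonglongrightarrow> L"
      using bounded_imp_convergent_subsequence by blast
    have "convergent (\<lambda>n. s' ((r \<circ> q) n))" if s': "s' \<in> insert s S" for s'
    proof (cases "s' = s")
      case True
      then show ?thesis using q(2) by (auto simp: convergent_def comp_def)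
    next
      case False
      then have "convergent (\<lambda>n. s' (r n))" using r(2) s' by blast
      from convergent_subseq_convergent[OF this q(1)] show ?thesis by (simp add: comp_def)
    qed
    then show ?case using strict_mono_o[OF r(1) q(1)] by blast
  qed
  then show thesis using that by blast
qed

lemma steps_tendsto:
  assumes "\<And>i. i \<in> J \<Longrightarrow> (\<lambda>n. t n i) \<longlonglongrightarrow> \<tau> i" "\<And>i. i \<in> J \<Longrightarrow> (\<lambda>n. a n i) \<longlonglongrightarrow> A i"
    "\<And>i. i \<in> J \<Longrightarrow> (\<lambda>n. b n i) \<longlonglongrightarrow> B i" "x \<notin> \<tau> ` J"
  shows "(\<lambda>n. steps J (t n) (a n) (b n) x) \<longlonglongrightarrow> steps J \<tau> A B x"
  unfolding steps_def
proof (rule tendsto_sum)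
  fix i assume i: "i \<in> J"
  then have "x \<noteq> \<tau> i" using assms(4) by auto
  have "(\<lambda>n. if \<tau> i \<le> x then a n i + b n i * (x - t n i) else 0) \<longlonglongrightarrow> (if \<tau> i \<le> x then A i + B i * (x - \<tau> i) else 0)"
    using assms(1-3)[OF i] by (auto intro!: tendsto_intros)
  moreover have "\<forall>\<^sub>F n in sequentially. (if \<tau> i \<le> x then a n i + b n i * (x - t n i) else 0)
      = (if t n i \<le> x then a n i + b n i * (x - t n i) else 0)"
    using eventually_same_side[OF assms(1)[OF i] \<open>x \<noteq> \<tau> i\<close>] by eventually_elim simp
  ultimately show "(\<lambda>n. if t n i \<le> x then a n i + b n i * (x - t n i) else 0)
      \<longlonglongrightarrow> (if \<tau> i \<le> x then A i + B i * (x - \<tau> i) else 0)"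
    by (rule Lim_transform_eventually)
qed

text \<open>Linear independence of the steps at distinct points: regarded as a double primitive of
  0, a vanishing sum has no jumps and no creases.\<close>

lemma steps_eq_0_imp:
  assumes "finite J" "inj_on \<tau> J" "\<tau> ` J \<subseteq> {l<..<u}"
    and 0: "AE x in lebesgue. x \<in> {l<..<u} \<longrightarrow> steps J \<tau> A B x = 0" and i: "i \<in> J"
  shows "A i = 0 \<and> B i = 0"
proof -
  have L0: "L2_supp l u (\<lambda>_. 0)" by (rule L2_supp_0)
  have gi: "set_integrable lebesgue {l..u} (\<lambda>_. 0 :: real)" by (rule L2_supp_set_integrable[OF L0]) simp
  have "AE x in lebesgue. x \<in> {l<..<u} \<longrightarrow>
      pw_prim l 0 (pw_prim l 0 (\<lambda>_. 0) J \<tau> B) J \<tau> A x = pw_prim l 0 (pw_prim l 0 (\<lambda>_. 0) {} \<tau> B) {} \<tau> A x"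
  proof (rule eventually_mono[OF 0], intro impI)
    fix x assume *: "x \<in> {l<..<u} \<longrightarrow> steps J \<tau> A B x = 0" and x: "x \<in> {l<..<u}"
    have "pw_prim l 0 (pw_prim l 0 (\<lambda>_. 0) J \<tau> B) J \<tau> A x = prim2 l (\<lambda>_. 0) x + steps J \<tau> A B x"
      using pw_prim_eq_steps[OF L0 assms(1), of \<tau> x 0 0 B A] assms(3) x by force
    moreover have "pw_prim l 0 (pw_prim l 0 (\<lambda>_. 0) {} \<tau> B) {} \<tau> A x = prim2 l (\<lambda>_. 0) x"
      by (simp add: pw_prim_def[abs_def] prim2_def)
    ultimately show "pw_prim l 0 (pw_prim l 0 (\<lambda>_. 0) J \<tau> B) J \<tau> A x = pw_prim l 0 (pw_prim l 0 (\<lambda>_. 0) {} \<tau> B) {} \<tau> A x"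
      using * x by simp
  qed
  from pw_prim_local_unique(3)[OF gi gi order_refl order_refl assms(1,2) this i] show ?thesis
    using i assms(3) by blast
qed

text \<open>After normalization of the coefficients, an unbounded sequence would yield a nontrivial step
  function vanishing almost everywhere.\<close>

lemma coefficients_subseq_convergent:
  assumes "finite J" "inj_on \<tau> J" "\<tau> ` J \<subseteq> {l<..<u}" and t: "\<And>i. i \<in> J \<Longrightarrow> (\<lambda>n. t n i) \<longlonglongrightarrow> \<tau> i"
    and s: "\<And>n. L2_supp l u (s n)" "\<And>n. (LINT x|lebesgue. (s n x)\<^sup>2) \<le> C"
    and ev: "AE x in lebesgue. x \<in> {l<..<u} \<longrightarrow> (\<forall>\<^sub>F n in sequentially. steps J (t n) (a n) (b n) x = s n x)"
  obtains r :: "nat \<Rightarrow> nat" and A B where "strict_mono r" "\<And>i. i \<in> J \<Longrightarrow> (\<lambda>n. a (r n) i) \<longlonglongrightarrow> A i"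
    "\<And>i. i \<in> J \<Longrightarrow> (\<lambda>n. b (r n) i) \<longlonglongrightarrow> B i"
proof -
  define m where "m n = (\<Sum>i\<in>J. \<bar>a n i\<bar> + \<bar>b n i\<bar>)" for n
  have m0: "m n \<ge> 0" for n unfolding m_def by (intro sum_nonneg) auto
  \<comment> \<open>Dividing by \<open>1 + m n\<close> avoids a division by 0, and the scaled
    coefficients have total size \<open>m n * y n = 1 - y n\<close>. The coefficients are bounded as
    long as \<open>y\<close> stays away from 0.\<close>
  define y where "y n = 1 / (1 + m n)" for n
  have y: "0 < y n" "y n \<le> 1" "m n * y n = 1 - y n" for n using m0[of n] by (auto simp: y_def field_simps)
  have le: "\<bar>a n i\<bar> \<le> m n" "\<bar>b n i\<bar> \<le> m n" if "i \<in> J" for n i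
    using member_le_sum[OF that, of "\<lambda>i. \<bar>a n i\<bar> + \<bar>b n i\<bar>"] assms(1) by (auto simp: m_def)
  have bd: "\<bar>c * y n\<bar> \<le> 1" if "\<bar>c\<bar> \<le> m n" for c n
  proof -
    have "\<bar>c\<bar> * y n \<le> m n * y n" using that y(1)[of n] by (intro mult_right_mono) auto
    then show ?thesis using y(1,3)[of n] by (simp add: abs_mult)
  qed
  let ?S = "insert y ((\<lambda>i n. a n i * y n) ` J \<union> (\<lambda>i n. b n i * y n) ` J)"
  obtain r :: "nat \<Rightarrow> nat" where r: "strict_mono r" "\<And>s. s \<in> ?S \<Longrightarrow> convergent (\<lambda>n. s (r n))"
  proof (rule finite_bounded_sequences_subseq[of ?S])
    fix s assume "s \<in> ?S"
    then have "\<bar>s n\<bar> \<le> 1" for n using y bd le by (auto simp: abs_of_pos)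
    then show "bounded (range s)" by (auto simp: bounded_iff)
  qed (use assms(1) in auto)
  obtain Y where Y: "(\<lambda>n. y (r n)) \<longlonglongrightarrow> Y" using r(2)[of y] by (auto simp: convergent_def)
  define A B where "A i = lim (\<lambda>n. a (r n) i * y (r n))" and "B i = lim (\<lambda>n. b (r n) i * y (r n))" for i
  have A: "(\<lambda>n. a (r n) i * y (r n)) \<longlonglongrightarrow> A i" if "i \<in> J" for i
    using r(2)[of "\<lambda>n. a n i * y n"] that unfolding A_def convergent_LIMSEQ_iff by blast
  have B: "(\<lambda>n. b (r n) i * y (r n)) \<longlonglongrightarrow> B i" if "i \<in> J" for i
    using r(2)[of "\<lambda>n. b n i * y n"] that unfolding B_def convergent_LIMSEQ_iff by blast
  have tr: "(\<lambda>n. t (r n) i) \<longlonglongrightarrow> \<tau> i" if "i \<in> J" for i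
    using LIMSEQ_subseq_LIMSEQ[OF t[OF that] r(1)] by (simp add: comp_def)
  have "Y \<noteq> 0"
  proof
    assume "Y = 0"
    \<comment> \<open>If \<open>y\<close> tends to 0, the scaled steps converge almost everywhere to
      the steps with coefficients \<open>A\<close> and \<open>B\<close>, and to 0 in L2 because the
      norms of \<open>s\<close> are bounded.\<close>
    have lim: "AE x in lebesgue. (\<lambda>n. y (r n) * s (r n) x) \<longlonglongrightarrow> indicator {l<..<u} x * steps J \<tau> A B x"
    proof (rule eventually_elim2[OF ev AE_notin_finite[OF finite_imageI[OF assms(1)]]])
      fix x assume 1: "x \<in> {l<..<u} \<longrightarrow> (\<forall>\<^sub>F n in sequentially. steps J (t n) (a n) (b n) x = s n x)" and 2: "x \<notin> \<tau> ` J"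
      show "(\<lambda>n. y (r n) * s (r n) x) \<longlonglongrightarrow> indicator {l<..<u} x * steps J \<tau> A B x"
      proof (cases "x \<in> {l<..<u}")
        case True
        have "(\<lambda>n. steps J (t (r n)) (\<lambda>i. a (r n) i * y (r n)) (\<lambda>i. b (r n) i * y (r n)) x) \<longlonglongrightarrow> steps J \<tau> A B x"
          by (rule steps_tendsto[OF tr A B 2])
        moreover have "\<forall>\<^sub>F n in sequentially. steps J (t (r n)) (a (r n)) (b (r n)) x = s (r n) x"
          using eventually_subseq[OF r(1) 1[rule_format, OF True]] .
        then have "\<forall>\<^sub>F n in sequentially. steps J (t (r n)) (\<lambda>i. a (r n) i * y (r n)) (\<lambda>i. b (r n) i * y (r n)) x = y (r n) * s (r n) x"
        proof eventually_elim
          case (elim n)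
          have "steps J (t (r n)) (\<lambda>i. a (r n) i * y (r n)) (\<lambda>i. b (r n) i * y (r n)) x = y (r n) * steps J (t (r n)) (a (r n)) (b (r n)) x"
            unfolding steps_def sum_distrib_left by (intro sum.cong) (auto simp: algebra_simps)
          then show ?case using elim by simp
        qed
        ultimately have "(\<lambda>n. y (r n) * s (r n) x) \<longlonglongrightarrow> steps J \<tau> A B x"
          by (rule Lim_transform_eventually)
        then show ?thesis using True by simp
      next
        case False
        then have "s n x = 0" for n using s(1) unfolding L2_supp_def by blast
        then show ?thesis using False by simp
      qed
    qed
    have sm: "(\<lambda>x. y (r n) * s (r n) x) \<in> borel_measurable lebesgue" for n
      using L2_supp_cmult[OF s(1)] by (simp add: L2_supp_def)
    have si: "integrable lebesgue (\<lambda>x. (y (r n) * s (r n) x)\<^sup>2)" for n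
      using L2_supp_cmult[OF s(1)] by (simp add: L2_supp_def)
    have hm: "(\<lambda>x. indicator {l<..<u} x * steps J \<tau> A B x) \<in> borel_measurable lebesgue"
    proof (rule borel_measurable_AE[OF borel_measurable_lim_metric[OF sm]])
      show "AE x in lebesgue. lim (\<lambda>n. y (r n) * s (r n) x) = indicator {l<..<u} x * steps J \<tau> A B x"
        by (rule eventually_mono[OF lim]) (rule limI)
    qed
    have "(LINT x|lebesgue. (indicator {l<..<u} x * steps J \<tau> A B x)\<^sup>2) \<le> 0 + e" if e: "e > 0" for e
    proof (rule square_integral_le_of_AE_limit(2)[OF sm hm si lim])
      have "(\<lambda>n. (y (r n))\<^sup>2 * C) \<longlonglongrightarrow> 0\<^sup>2 * C" using Y \<open>Y = 0\<close> by (intro tendsto_intros) simp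
      then have "\<forall>\<^sub>F n in sequentially. (y (r n))\<^sup>2 * C < e" using e by (intro order_tendstoD) auto
      then show "\<forall>\<^sub>F n in sequentially. (LINT x|lebesgue. (y (r n) * s (r n) x)\<^sup>2) \<le> 0 + e"
      proof eventually_elim
        case (elim n)
        have "(LINT x|lebesgue. (y (r n) * s (r n) x)\<^sup>2) = (y (r n))\<^sup>2 * (LINT x|lebesgue. (s (r n) x)\<^sup>2)"
          by (simp add: power_mult_distrib)
        also have "\<dots> \<le> (y (r n))\<^sup>2 * C" by (intro mult_left_mono s) simp
        finally show ?case using elim by simp
      qed
    qed
    then have "(LINT x|lebesgue. (indicator {l<..<u} x * steps J \<tau> A B x)\<^sup>2) \<le> 0" by (rule field_le_epsilon)
    moreover have hi: "integrable lebesgue (\<lambda>x. (indicator {l<..<u} x * steps J \<tau> A B x)\<^sup>2)"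
    proof (rule square_integral_le_of_AE_limit(1)[OF sm hm si lim])
      show "\<forall>\<^sub>F n in sequentially. (LINT x|lebesgue. (y (r n) * s (r n) x)\<^sup>2) \<le> C"
      proof (rule always_eventually, rule allI)
        fix n
        have "(LINT x|lebesgue. (y (r n) * s (r n) x)\<^sup>2) = (y (r n))\<^sup>2 * (LINT x|lebesgue. (s (r n) x)\<^sup>2)"
          by (simp add: power_mult_distrib)
        also have "\<dots> \<le> 1 * (LINT x|lebesgue. (s (r n) x)\<^sup>2)"
          using y(1,2)[of "r n"] by (intro mult_right_mono integral_nonneg_AE) (auto simp: power_le_one)
        finally show "(LINT x|lebesgue. (y (r n) * s (r n) x)\<^sup>2) \<le> C" using s(2)[of "r n"] by simp
      qed
    qed
    moreover have "(LINT x|lebesgue. (indicator {l<..<u} x * steps J \<tau> A B x)\<^sup>2) \<ge> 0" by (rule integral_nonneg_AE) simp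
    ultimately have "AE x in lebesgue. (indicator {l<..<u} x * steps J \<tau> A B x)\<^sup>2 = 0"
      using integral_nonneg_eq_0_iff_AE[OF hi] by simp
    then have "AE x in lebesgue. x \<in> {l<..<u} \<longrightarrow> steps J \<tau> A B x = 0"
      by (rule eventually_mono) auto
    then have z: "A i = 0" "B i = 0" if "i \<in> J" for i
      using steps_eq_0_imp[OF assms(1-3) _ that] by auto
    \<comment> \<open>The total size of the scaled coefficients tends to 0, as all their limits
      vanish, and to 1, as it equals \<open>1 - y (r n)\<close>.\<close>
    have "(\<lambda>n. \<Sum>i\<in>J. \<bar>a (r n) i * y (r n)\<bar> + \<bar>b (r n) i * y (r n)\<bar>) \<longlonglongrightarrow> (\<Sum>i\<in>J. \<bar>A i\<bar> + \<bar>B i\<bar>)"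
      by (intro tendsto_intros A B)
    moreover have "(\<Sum>i\<in>J. \<bar>a (r n) i * y (r n)\<bar> + \<bar>b (r n) i * y (r n)\<bar>) = 1 - y (r n)" for n
      using y(1,3)[of "r n"] by (simp add: m_def sum_distrib_right abs_mult distrib_right)
    moreover have "(\<Sum>i\<in>J. \<bar>A i\<bar> + \<bar>B i\<bar>) = 0" using z by simp
    ultimately have "(\<lambda>n. 1 - y (r n)) \<longlonglongrightarrow> 0" by simp
    moreover have "(\<lambda>n. 1 - y (r n)) \<longlonglongrightarrow> 1 - 0" using Y \<open>Y = 0\<close> by (intro tendsto_intros) simp
    ultimately show False using LIMSEQ_unique by fastforce
  qed
  \<comment> \<open>The scaling is undone by dividing by the nonzero limit \<open>Y\<close>.\<close>
  have AB: "(\<lambda>n. a (r n) i) \<longlonglongrightarrow> A i / Y" "(\<lambda>n. b (r n) i) \<longlonglongrightarrow> B i / Y" if "i \<in> J" for i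
    using tendsto_divide[OF A[OF that] Y \<open>Y \<noteq> 0\<close>] tendsto_divide[OF B[OF that] Y \<open>Y \<noteq> 0\<close>] y(1)
    by (simp_all add: less_imp_neq[THEN not_sym])
  show thesis by (rule that[OF r(1) AB])
qed

text \<open>A nonzero limit coefficient is eventually nonzero along the sequence, so a limit jump
  comes from jumps. A limit crease may also come from jumps, which are no cheaper as
  \<open>\<beta> \<le> \<alpha>\<close>.\<close>

lemma cost_lsc:
  assumes "(\<lambda>n. a n) \<longlonglongrightarrow> A" "(\<lambda>n. b n) \<longlonglongrightarrow> B" "0 < \<beta>" "\<beta> \<le> \<alpha>"
  shows "\<forall>\<^sub>F n in sequentially. cost \<alpha> \<beta> A B \<le> cost \<alpha> \<beta> (a n) (b n)"
proof (cases "A = 0 \<and> B = 0")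
  case True
  then show ?thesis using assms(3,4) by (simp add: cost_def)
next
  case False
  have "\<forall>\<^sub>F n in sequentially. (A \<noteq> 0 \<longrightarrow> a n \<noteq> 0) \<and> (B \<noteq> 0 \<longrightarrow> b n \<noteq> 0)"
    using assms(1,2) by (cases "A = 0"; cases "B = 0") (auto intro: eventually_conj tendsto_imp_eventually_ne)
  then show ?thesis
    by eventually_elim (use False assms(3,4) in \<open>auto simp: cost_def\<close>)
qed

subsection \<open>Existence of minimizers\<close>

lemma prim2_cong_AE:
  assumes "AE x in lebesgue. x \<in> {l<..<u} \<longrightarrow> f x = g x" "x \<le> u"
  shows "prim2 l f x = prim2 l g x"
  unfolding prim2_def
  by (intro Henstock_Kurzweil_Integration.integral_cong integral_spike_AE[OF assms(1)]) (use assms(2) in auto)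

lemma prim2_L2:
  assumes "L2_supp l u g" "l \<le> a" "b \<le> u" shows "prim2 l g \<in> L2 a b"
proof -
  have gi: "set_integrable lebesgue {l..u} g" by (rule L2_supp_set_integrable[OF assms(1)]) simp
  have "prim2 l g = pw_prim l 0 (pw_prim l 0 g {} (\<lambda>_. 0) (\<lambda>_. 0)) {} (\<lambda>_. 0) (\<lambda>_. 0)"
    by (simp add: pw_prim_def[abs_def] prim2_def[abs_def])
  then show ?thesis using pw_prim_L2[OF set_integrable_pw_prim'[OF gi] assms(2,3)] by simp
qed

lemma steps_L2:
  assumes "finite I" "\<And>i. i \<in> I \<Longrightarrow> l \<le> t i" shows "steps I t a b \<in> L2 l u"
proof (rule L2_cong_AE)
  have L0: "L2_supp l u (\<lambda>_. 0)" by (rule L2_supp_0)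
  have gi: "set_integrable lebesgue {l..u} (\<lambda>_. 0 :: real)" by (rule L2_supp_set_integrable[OF L0]) simp
  show "pw_prim l 0 (pw_prim l 0 (\<lambda>_. 0) I t b) I t a \<in> L2 l u"
    by (rule pw_prim_L2[OF set_integrable_pw_prim'[OF gi]]) auto
  have "prim2 l (\<lambda>_. 0) x = 0" for x by (simp add: prim2_def)
  then show "AE x in lebesgue. x \<in> {l<..<u} \<longrightarrow> pw_prim l 0 (pw_prim l 0 (\<lambda>_. 0) I t b) I t a x = steps I t a b x"
    using pw_prim_eq_steps[OF L0 assms, where p = 0 and q = 0 and a = a and b = b] by (intro AE_I2) simp
qed

text \<open>Padding with trivial points makes the index set the same for all members of a sequence.\<close>

lemma steps_reindex:
  assumes "finite I" "card I \<le> N" "t ` I \<subseteq> {l..u}" "l \<le> u"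
  obtains t' a' b' where "\<And>i. t' i \<in> {l..u}" "steps {..<N} t' a' b' = steps I t a b"
    "(\<Sum>i<N. cost \<alpha> \<beta> (a' i) (b' i)) = (\<Sum>i\<in>I. cost \<alpha> \<beta> (a i) (b i))"
proof -
  obtain e where e: "bij_betw e {0..<card I} I" using ex_bij_betw_nat_finite[OF assms(1)] by blast
  have S: "(\<Sum>i<N. if i < card I then f (e i) else 0) = sum f I" for f :: "nat \<Rightarrow> real"
  proof -
    have "(\<Sum>i<N. if i < card I then f (e i) else 0) = (\<Sum>i\<in>{0..<card I}. f (e i))"
      using assms(2) by (intro sum.mono_neutral_cong_right) auto
    also have "\<dots> = sum f I" by (rule sum.reindex_bij_betw[OF e])
    finally show ?thesis .
  qed
  let ?c = "\<lambda>f z i. if i < card I then f (e i) else z"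
  show thesis
  proof (rule that[of "?c t l" "?c a 0" "?c b 0"])
    fix i
    have "i < card I \<Longrightarrow> e i \<in> I" using e by (auto simp: bij_betw_def)
    then have "i < card I \<Longrightarrow> t (e i) \<in> {l..u}" using assms(3) by blast
    then show "?c t l i \<in> {l..u}" using assms(4) by auto
    show "steps {..<N} (?c t l) (?c a 0) (?c b 0) = steps I t a b"
    proof
      fix x
      have "steps {..<N} (?c t l) (?c a 0) (?c b 0) x
          = (\<Sum>i<N. if i < card I then (if t (e i) \<le> x then a (e i) + b (e i) * (x - t (e i)) else 0) else 0)"
        unfolding steps_def by (rule sum.cong) auto
      then show "steps {..<N} (?c t l) (?c a 0) (?c b 0) x = steps I t a b x"
        unfolding S[of "\<lambda>i. if t i \<le> x then a i + b i * (x - t i) else 0"] by (simp add: steps_def)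
    qed
    have "(\<Sum>i<N. cost \<alpha> \<beta> (?c a 0 i) (?c b 0 i)) = (\<Sum>i<N. if i < card I then cost \<alpha> \<beta> (a (e i)) (b (e i)) else 0)"
      by (rule sum.cong) (auto simp: cost_def)
    then show "(\<Sum>i<N. cost \<alpha> \<beta> (?c a 0 i) (?c b 0 i)) = (\<Sum>i\<in>I. cost \<alpha> \<beta> (a i) (b i))"
      unfolding S[of "\<lambda>i. cost \<alpha> \<beta> (a i) (b i)"] .
  qed
qed

lemma L2_weak_compact2:
  assumes "l < u" and g: "\<And>n. L2_supp l u (g n)" and h: "\<And>n. L2_supp l u (h n)"
    and L: "(\<lambda>n. LINT x|lebesgue. (g n x)\<^sup>2) \<longlonglongrightarrow> L" "(\<lambda>n. LINT x|lebesgue. (h n x)\<^sup>2) \<longlonglongrightarrow> L'"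
  obtains r :: "nat \<Rightarrow> nat" and G H where "strict_mono r" "L2_supp l u G" "(LINT x|lebesgue. (G x)\<^sup>2) \<le> L"
    "L2_supp l u H" "(LINT x|lebesgue. (H x)\<^sup>2) \<le> L'"
    "\<And>x. x \<in> {l..u} \<Longrightarrow> (\<lambda>n. prim2 l (g (r n)) x) \<longlonglongrightarrow> prim2 l G x"
    "\<And>x. x \<in> {l..u} \<Longrightarrow> (\<lambda>n. prim2 l (h (r n)) x) \<longlonglongrightarrow> prim2 l H x"
    "\<forall>c d. (\<forall>n. L2_supp c d (g n)) \<longrightarrow> L2_supp c d G" "\<forall>c d. (\<forall>n. L2_supp c d (h n)) \<longrightarrow> L2_supp c d H"
proof -
  obtain r1 :: "nat \<Rightarrow> nat" and G where r1: "strict_mono r1" "L2_supp l u G" "(LINT x|lebesgue. (G x)\<^sup>2) \<le> L"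
    "\<And>x. x \<in> {l..u} \<Longrightarrow> (\<lambda>n. prim2 l (g (r1 n)) x) \<longlonglongrightarrow> prim2 l G x"
    "\<forall>c d. (\<forall>n. L2_supp c d (g n)) \<longrightarrow> L2_supp c d G"
    by (rule L2_weak_compact[OF assms(1) g L(1)]) (assumption | rule that)+
  have L': "(\<lambda>n. LINT x|lebesgue. (h (r1 n) x)\<^sup>2) \<longlonglongrightarrow> L'"
    using LIMSEQ_subseq_LIMSEQ[OF L(2) r1(1)] by (simp add: comp_def)
  obtain r2 :: "nat \<Rightarrow> nat" and H where r2: "strict_mono r2" "L2_supp l u H" "(LINT x|lebesgue. (H x)\<^sup>2) \<le> L'"
    "\<And>x. x \<in> {l..u} \<Longrightarrow> (\<lambda>n. prim2 l (h (r1 (r2 n))) x) \<longlonglongrightarrow> prim2 l H x"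
    "\<forall>c d. (\<forall>n. L2_supp c d (h (r1 n))) \<longrightarrow> L2_supp c d H"
    by (rule L2_weak_compact[OF assms(1) h L']) (assumption | rule that)+
  have "(\<lambda>n. prim2 l (g ((r1 \<circ> r2) n)) x) \<longlonglongrightarrow> prim2 l G x" if "x \<in> {l..u}" for x
    using LIMSEQ_subseq_LIMSEQ[OF r1(4)[OF that] r2(1)] by (simp add: comp_def)
  moreover have "(\<lambda>n. prim2 l (h ((r1 \<circ> r2) n)) x) \<longlonglongrightarrow> prim2 l H x" if "x \<in> {l..u}" for x
    using r2(4)[OF that] by simp
  ultimately show thesis
    by (rule that[OF strict_mono_o[OF r1(1) r2(1)] r1(2,3) r2(2,3)]) (use r1(5) r2(5) in auto)
qed

text \<open>The function \<open>w0\<close> is \<open>w''\<close> outside \<open>(-1,1)\<close> and zero inside, and \<open>p\<close>, \<open>q\<close> are the values of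
  \<open>w\<close> and \<open>w'\<close> at \<open>-2\<close>. Admissible functions then differ from \<open>base\<close> by a double primitive of a
  function supported in \<open>[-1,1]\<close> and, for the first component, by jumps and creases in \<open>[-1,1]\<close>.\<close>

locale fitting_problem =
  fixes \<alpha> \<beta> \<eta> \<mu> \<gamma> :: real and fr fp w w0 :: "real \<Rightarrow> real" and p q :: real
  assumes \<beta>: "0 < \<beta>" "\<beta> \<le> \<alpha>" "\<alpha> \<le> 2 * \<beta>" and \<eta>: "\<eta> > 0" and \<mu>: "\<mu> > 0" and \<gamma>: "\<gamma> > 0"
    and fr: "fr \<in> L2 (-1) 1" and fp: "fp \<in> L2 (-1) 1"
    and w0: "L2_supp (-2) 2 w0" "\<And>x. x \<in> {-1<..<1} \<Longrightarrow> w0 x = 0"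
begin

section \<open>The functional in reduced unknowns\<close>

definition base :: "real \<Rightarrow> real" where "base x = p + q * (x + 2) + prim2 (-2) w0 x"

text \<open>The function squared in \<open>integral_complete_square\<close>. Both components contain
  \<open>base\<close>, which cancels in their difference.\<close>

definition fidelity :: "(real \<Rightarrow> real) \<Rightarrow> (real \<Rightarrow> real) \<Rightarrow> (real \<Rightarrow> real) \<Rightarrow> real \<Rightarrow> real" where
  "fidelity g h s x = indicator {-1<..<1} x * (prim2 (-2) g x + s x - prim2 (-2) h x - fr x / (2 * \<mu>))"

text \<open>After the completion of the square the load \<open>fr\<close> acts on the second
  component, together with \<open>fp\<close>.\<close>

definition load :: "(real \<Rightarrow> real) \<Rightarrow> real" where
  "load h = (LINT x:{-1<..<1}|lebesgue. (fr x + fp x) * (base x + prim2 (-2) h x))"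

text \<open>The price of the singular points enters as a parameter \<open>\<kappa>\<close>, because
  along a sequence it is bounded and passed to the limit separately. The last term is the constant
  left by the completed square.\<close>

definition energy :: "real \<Rightarrow> (real \<Rightarrow> real) \<Rightarrow> (real \<Rightarrow> real) \<Rightarrow> (real \<Rightarrow> real) \<Rightarrow> real" where
  "energy \<kappa> g h s = \<kappa> + \<eta> * (LINT x|lebesgue. (g x)\<^sup>2) + \<mu> * (LINT x|lebesgue. (fidelity g h s x)\<^sup>2)
    + \<gamma> * (LINT x|lebesgue. (h x)\<^sup>2) - load h - (LINT x:{-1<..<1}|lebesgue. (fr x)\<^sup>2) / (4 * \<mu>)"

text \<open>Beyond 1 the density \<open>g\<close> vanishes but its double primitive need not, so the
  prescribed values constrain \<open>g\<close> and the steps jointly. In this form the condition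
  passes to pointwise limits.\<close>

definition boundary :: "(real \<Rightarrow> real) \<Rightarrow> (real \<Rightarrow> real) \<Rightarrow> bool" where
  "boundary g s \<longleftrightarrow> L2_supp (-1) 1 g \<and>
     (AE x in lebesgue. x \<in> {-2<..<-1} \<union> {1<..<2} \<longrightarrow> base x + prim2 (-2) g x + s x = w x)"

lemma L2_supp_12: "L2_supp (-1) 1 g \<Longrightarrow> L2_supp (-2) 2 g"
  by (erule L2_supp_mono) auto

lemma prim2_add_w0: "L2_supp (-1) 1 g \<Longrightarrow> prim2 (-2) (\<lambda>x. w0 x + g x) x = prim2 (-2) w0 x + prim2 (-2) g x"
  using prim2_lincomb[OF w0(1) L2_supp_12, of g 1 1 x] by simp

lemma set_integral_square_inner:
  assumes "L2_supp (-1) 1 g"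
  shows "(LINT x:{-1<..<1}|lebesgue. (w0 x + g x)\<^sup>2) = (LINT x|lebesgue. (g x)\<^sup>2)"
  unfolding set_lebesgue_integral_def
proof (intro Bochner_Integration.integral_cong refl)
  fix x
  show "indicator {-1<..<1} x *\<^sub>R (w0 x + g x)\<^sup>2 = (g x)\<^sup>2"
    using w0(2)[of x] assms by (cases "x \<in> {-1<..<1}") (auto simp: L2_supp_def)
qed

lemma energy_eq_F1:
  assumes g: "L2_supp (-1) 1 g" and h: "L2_supp (-1) 1 h"
    and I: "finite I" "inj_on t I" "t ` I \<subseteq> {-1..1}"
    and vr: "AE x in lebesgue. x \<in> {-2<..<2} \<longrightarrow> vr x = base x + prim2 (-2) g x + steps I t a b x"
    and vp: "AE x in lebesgue. x \<in> {-2<..<2} \<longrightarrow> vp x = base x + prim2 (-2) h x"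
  shows "F1 \<alpha> \<beta> \<eta> \<mu> \<gamma> fr fp vr vp = ereal (energy (\<Sum>i\<in>I. cost \<alpha> \<beta> (a i) (b i)) g h (steps I t a b))"
    "vr \<in> piecewise_H2 (-2) 2" "vp \<in> Sobolev_H 2 (-2) 2"
proof -
  let ?z = "\<lambda>_::nat. 0::real"
  let ?g = "\<lambda>x. w0 x + g x" and ?h = "\<lambda>x. w0 x + h x"
  define V where "V = pw_prim (-2) p (pw_prim (-2) q ?g I t b) I t a"
  define P where "P = pw_prim (-2) p (pw_prim (-2) q ?h {} ?z ?z) {} ?z ?z"
  have gh: "L2_supp (-2) 2 ?g" "L2_supp (-2) 2 ?h"
    by (rule L2_supp_add[OF w0(1) L2_supp_12[OF g]], rule L2_supp_add[OF w0(1) L2_supp_12[OF h]])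
  have I2: "t ` I \<subseteq> {-2<..<2}" using I(3) by force
  have tI: "-2 \<le> t i" if "i \<in> I" for i using I(3) that by force
  have V: "V x = base x + prim2 (-2) g x + steps I t a b x" if "x \<in> {-2..2}" for x
    using pw_prim_eq_steps[OF gh(1) I(1) tI that, where p = p and q = q and a = a and b = b]
    by (simp add: V_def prim2_add_w0[OF g] base_def)
  have P: "P x = base x + prim2 (-2) h x" if "x \<in> {-2..2}" for x
    using pw_prim_eq_steps[OF gh(2), of "{}" ?z x p q ?z ?z] that
    by (simp add: P_def prim2_add_w0[OF h] base_def steps_def)
  have vrV: "AE x in lebesgue. x \<in> {-2<..<2} \<longrightarrow> vr x = V x"
    using vr by (rule eventually_mono) (simp add: V)
  have vpP: "AE x in lebesgue. x \<in> {-2<..<2} \<longrightarrow> vp x = P x"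
    using vp by (rule eventually_mono) (simp add: P)
  show "vr \<in> piecewise_H2 (-2) 2"
    by (rule pw_prim_imp_piecewise_H2[OF _ gh(1) I(1) I2 vrV[unfolded V_def]]) simp
  show "vp \<in> Sobolev_H 2 (-2) 2"
    by (rule Sobolev_H2_pw_prim(1)[OF _ _ gh(2) vpP[unfolded P_def]]) auto
  have gi: "set_integrable lebesgue {-2..2} ?g" "set_integrable lebesgue {-2..2} ?h"
    using gh by (auto intro: L2_supp_set_integrable)
  have L2: "?g \<in> L2 (-1) 1" "?h \<in> L2 (-1) 1" "V \<in> L2 (-1) 1" "P \<in> L2 (-1) 1"
    using gh[THEN L2_supp_imp_L2] pw_prim_L2[OF set_integrable_pw_prim'[OF gi(1)]]
      pw_prim_L2[OF set_integrable_pw_prim'[OF gi(2)]] unfolding V_def P_def by auto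
  have 1: "(LINT x:{-1<..<1}|lebesgue. (V x - P x - fr x / (2 * \<mu>))\<^sup>2) = (LINT x|lebesgue. (fidelity g h (steps I t a b) x)\<^sup>2)"
    unfolding set_lebesgue_integral_def
    by (intro Bochner_Integration.integral_cong refl) (auto simp: V P fidelity_def indicator_def add_diff_eq)
  have 2: "(LINT x:{-1<..<1}|lebesgue. (fr x + fp x) * P x) = load h"
    unfolding load_def set_lebesgue_integral_def
    by (intro Bochner_Integration.integral_cong refl) (auto simp: P indicator_def)
  have "F1 \<alpha> \<beta> \<eta> \<mu> \<gamma> fr fp vr vp = ereal ((\<Sum>i\<in>I. cost \<alpha> \<beta> (a i) (b i))
    + ((LINT x:{-1<..<1}|lebesgue. \<eta> * (?g x)\<^sup>2 - fr x * V x)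
    + \<mu> * (LINT x:{-1<..<1}|lebesgue. (V x - P x)\<^sup>2)
    + (LINT x:{-1<..<1}|lebesgue. \<gamma> * (?h x)\<^sup>2 - fp x * P x)))"
    unfolding F1_pw_prim[OF gh I(1,2) I2 V_def P_def vrV vpP] by (simp add: add.assoc)
  then show "F1 \<alpha> \<beta> \<eta> \<mu> \<gamma> fr fp vr vp = ereal (energy (\<Sum>i\<in>I. cost \<alpha> \<beta> (a i) (b i)) g h (steps I t a b))"
    unfolding integral_complete_square[OF L2 fr fp \<mu>] 1 2 set_integral_square_inner[OF g] set_integral_square_inner[OF h]
    by (simp add: energy_def)
qed

lemma energy_admissible:
  assumes "boundary g (steps I t a b)" "boundary h (\<lambda>_. 0)" "finite I" "inj_on t I" "t ` I \<subseteq> {-1..1}"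
  obtains vr vp where "(vr, vp) \<in> admissible w"
    "F1 \<alpha> \<beta> \<eta> \<mu> \<gamma> fr fp vr vp = ereal (energy (\<Sum>i\<in>I. cost \<alpha> \<beta> (a i) (b i)) g h (steps I t a b))"
proof -
  define vr vp where "vr x = base x + prim2 (-2) g x + steps I t a b x" and "vp x = base x + prim2 (-2) h x" for x
  have gh: "L2_supp (-1) 1 g" "L2_supp (-1) 1 h" using assms by (auto simp: boundary_def)
  note E = energy_eq_F1[OF gh assms(3-5), of vr a b vp]
  have "AE x in lebesgue. x \<in> {-2<..<-1} \<union> {1<..<2} \<longrightarrow> vr x = w x \<and> vp x = w x"
    using assms(1,2) unfolding boundary_def by (auto simp: vr_def vp_def elim: eventually_elim2)
  then show thesis
    using E by (intro that[of vr vp]) (auto simp: admissible_def vr_def vp_def)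
qed

text \<open>The converse of \<open>energy_admissible\<close>; together they reduce minimizing
  \<open>F1\<close> to minimizing \<open>energy\<close>. Nontrivial coefficients are recorded
  because they bound the number of points by the cost.\<close>

lemma energy_of_admissible:
  assumes w: "L2_supp (-2) 2 w2" "\<And>x. x \<in> {-2<..<2} \<Longrightarrow> w x = pw_prim (-2) p (pw_prim (-2) q w2 {} s e) {} s e x"
    and w02: "\<And>x. x \<in> {-2<..<-1} \<union> {1<..<2} \<Longrightarrow> w0 x = w2 x"
    and v: "(vr, vp) \<in> admissible w"
  obtains g h I t a b where "boundary g (steps I t a b)" "boundary h (\<lambda>_. 0)" "finite I" "inj_on t I" "t ` I \<subseteq> {-1..1}"
    "\<forall>i\<in>I. a i \<noteq> 0 \<or> b i \<noteq> 0"
    "F1 \<alpha> \<beta> \<eta> \<mu> \<gamma> fr fp vr vp = ereal (energy (\<Sum>i\<in>I. cost \<alpha> \<beta> (a i) (b i)) g h (steps I t a b))"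
proof -
  have v': "vr \<in> piecewise_H2 (-2) 2" "vp \<in> Sobolev_H 2 (-2) 2"
    and o: "AE x in lebesgue. x \<in> {-2<..<-1} \<union> {1<..<2} \<longrightarrow> vr x = w x"
      "AE x in lebesgue. x \<in> {-2<..<-1} \<union> {1<..<2} \<longrightarrow> vp x = w x"
    using v by (auto simp: admissible_def elim: eventually_mono)
  have lt: "(-2::real) < -1" "(-1::real) < 1" "(1::real) < 2" by auto
  obtain g' I t a b where g': "L2_supp (-2) 2 g'" and I: "finite I" "inj_on t I" "t ` I \<subseteq> {-1..1}"
    "\<And>i. i \<in> I \<Longrightarrow> a i \<noteq> 0 \<or> b i \<noteq> 0"
    and vr: "AE x in lebesgue. x \<in> {-2<..<2} \<longrightarrow> vr x = pw_prim (-2) p (pw_prim (-2) q g' I t b) I t a x"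
    and g'o: "AE x in lebesgue. x \<in> {-2<..<-1} \<union> {1<..<2} \<longrightarrow> g' x = w2 x"
    by (rule piecewise_H2_normal_form[OF w v'(1) lt o(1)]) (assumption | rule that)+
  obtain h' where h': "L2_supp (-2) 2 h'"
    and vp: "AE x in lebesgue. x \<in> {-2<..<2} \<longrightarrow> vp x = pw_prim (-2) p (pw_prim (-2) q h' {} s e) {} s e x"
    and h'o: "AE x in lebesgue. x \<in> {-2<..<-1} \<union> {1<..<2} \<longrightarrow> h' x = w2 x"
    by (rule Sobolev_H2_normal_form[OF w v'(2) lt o(2)]) (assumption | rule that)+
  define inner where "inner g x = indicator {-1<..<1} x * g x" for g :: "real \<Rightarrow> real" and x
  have inner: "L2_supp (-1) 1 (inner g)" if "L2_supp (-2) 2 g" for g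
    unfolding inner_def[abs_def] by (rule L2_supp_restrict[OF L2_supp_imp_L2[OF that]])
  \<comment> \<open>Outside (-1,1) the density is that of \<open>w\<close>, which \<open>w0\<close>
    already holds, so only the inner part is free. The points -1 and 1 form a null set.\<close>
  have pr: "prim2 (-2) g x = prim2 (-2) w0 x + prim2 (-2) (inner g) x"
    if g: "L2_supp (-2) 2 g" and "AE x in lebesgue. x \<in> {-2<..<-1} \<union> {1<..<2} \<longrightarrow> g x = w2 x" and "x \<le> 2" for g x
  proof -
    have "AE x in lebesgue. x \<notin> {-1, 1::real}" by (rule AE_notin_finite) simp
    with that(2) have "AE x in lebesgue. x \<in> {-2<..<2} \<longrightarrow> g x = w0 x + inner g x"
    proof eventually_elim
      case (elim x)
      show ?case
      proof
        assume "x \<in> {-2<..<2}"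
        then show "g x = w0 x + inner g x"
          using elim w0(2)[of x] w02[of x] by (cases "x \<in> {-1<..<1}") (auto simp: inner_def)
      qed
    qed
    from prim2_cong_AE[OF this that(3)] show ?thesis unfolding prim2_add_w0[OF inner[OF g]] .
  qed
  have tI: "-2 \<le> t i" if "i \<in> I" for i using I(3) that by force
  have vr': "AE x in lebesgue. x \<in> {-2<..<2} \<longrightarrow> vr x = base x + prim2 (-2) (inner g') x + steps I t a b x"
    using vr by (rule eventually_mono) (auto simp: pw_prim_eq_steps[OF g' I(1) tI] pr[OF g' g'o] base_def)
  have "pw_prim (-2) p (pw_prim (-2) q h' {} s e) {} s e x = base x + prim2 (-2) (inner h') x" if "x \<in> {-2<..<2}" for x
    using pw_prim_eq_steps[OF h', of "{}" s x p q e e] that by (simp add: pr[OF h' h'o] base_def steps_def)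
  then have vp': "AE x in lebesgue. x \<in> {-2<..<2} \<longrightarrow> vp x = base x + prim2 (-2) (inner h') x"
    using vp by (auto elim: eventually_mono)
  have "boundary (inner g') (steps I t a b)"
    unfolding boundary_def
  proof (intro conjI inner g')
    show "AE x in lebesgue. x \<in> {-2<..<-1} \<union> {1<..<2} \<longrightarrow> base x + prim2 (-2) (inner g') x + steps I t a b x = w x"
      using o(1) vr' by eventually_elim force
  qed
  moreover have "boundary (inner h') (\<lambda>_. 0)"
    unfolding boundary_def
  proof (intro conjI inner h')
    show "AE x in lebesgue. x \<in> {-2<..<-1} \<union> {1<..<2} \<longrightarrow> base x + prim2 (-2) (inner h') x + 0 = w x"
      using o(2) vp' by eventually_elim force
  qed
  ultimately show thesis
    using energy_eq_F1(1)[OF inner[OF g'] inner[OF h'] I(1-3) vr' vp'] I by (intro that) auto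
qed

section \<open>Coercivity and continuity of the terms of the energy\<close>

lemma sq_nonneg: "0 \<le> (LINT x|lebesgue. (f x)\<^sup>2)" for f :: "real \<Rightarrow> real"
  by (rule integral_nonneg_AE) simp

lemma fidelity_L2:
  assumes g: "L2_supp (-1) 1 g" and h: "L2_supp (-1) 1 h" and s: "s \<in> L2 (-1) 1"
  shows "L2_supp (-1) 1 (fidelity g h s)"
proof -
  have "prim2 (-2) g \<in> L2 (-1) 1" "prim2 (-2) h \<in> L2 (-1) 1"
    using prim2_L2[OF L2_supp_12[OF g]] prim2_L2[OF L2_supp_12[OF h]] by auto
  note r = this[THEN L2_supp_restrict] s[THEN L2_supp_restrict] fr[THEN L2_supp_restrict]
  have "L2_supp (-1) 1 (\<lambda>x. indicator {-1<..<1} x * prim2 (-2) g x + indicator {-1<..<1} x * s x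
     - indicator {-1<..<1} x * prim2 (-2) h x - (1 / (2 * \<mu>)) * (indicator {-1<..<1} x * fr x))"
    by (intro L2_supp_diff L2_supp_add L2_supp_cmult r)
  moreover have "(\<lambda>x. indicator {-1<..<1} x * prim2 (-2) g x + indicator {-1<..<1} x * s x
     - indicator {-1<..<1} x * prim2 (-2) h x - (1 / (2 * \<mu>)) * (indicator {-1<..<1} x * fr x)) = fidelity g h s"
    by (auto simp: fidelity_def indicator_def)
  ultimately show ?thesis by simp
qed

definition force_in :: "real \<Rightarrow> real" where
  "force_in x = indicator {-1<..<1} x * fr x + indicator {-1<..<1} x * fp x"

definition state_in :: "(real \<Rightarrow> real) \<Rightarrow> real \<Rightarrow> real" where
  "state_in h x = indicator {-1<..<1} x * (base x + prim2 (-2) h x)"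

lemma force_in_L2: "L2_supp (-1) 1 force_in"
  unfolding force_in_def[abs_def] by (intro L2_supp_add L2_supp_restrict fr fp)

lemma state_in_L2:
  assumes h: "L2_supp (-1) 1 h" shows "L2_supp (-1) 1 (state_in h)"
proof -
  let ?z = "\<lambda>_::nat. 0::real"
  have gi: "set_integrable lebesgue {-2..2} w0" by (rule L2_supp_set_integrable[OF w0(1)]) simp
  have "pw_prim (-2) p (pw_prim (-2) q w0 {} ?z ?z) {} ?z ?z \<in> L2 (-1) 1"
    by (rule pw_prim_L2[OF set_integrable_pw_prim'[OF gi]]) auto
  moreover have "AE x in lebesgue. x \<in> {-1<..<1} \<longrightarrow> pw_prim (-2) p (pw_prim (-2) q w0 {} ?z ?z) {} ?z ?z x = base x"
    using pw_prim_eq_steps[OF w0(1), where I = "{}" and p = p and q = q and t = ?z and a = ?z and b = ?z]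
    by (intro AE_I2) (auto simp: base_def steps_def)
  ultimately have "base \<in> L2 (-1) 1" by (rule L2_cong_AE[rotated])
  moreover have "prim2 (-2) h \<in> L2 (-1) 1" by (rule prim2_L2[OF L2_supp_12[OF h]]) auto
  ultimately have "L2_supp (-1) 1 (\<lambda>x. indicator {-1<..<1} x * base x + indicator {-1<..<1} x * prim2 (-2) h x)"
    by (intro L2_supp_add L2_supp_restrict)
  then show ?thesis by (simp add: state_in_def[abs_def] distrib_left)
qed

lemma load_eq: "load h = (LINT x|lebesgue. force_in x * state_in h x)"
  unfolding load_def set_lebesgue_integral_def force_in_def state_in_def
  by (intro Bochner_Integration.integral_cong refl) (auto simp: indicator_def)

lemma prim2_le_4:
  assumes "L2_supp (-1) 1 g" "x \<in> {-2..2}" shows "\<bar>prim2 (-2) g x\<bar> \<le> 4 * (LINT x|lebesgue. \<bar>g x\<bar>)"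
  using prim2_bound[OF L2_supp_12[OF assms(1)] assms(2)] by simp

text \<open>The second component has no jumps and fixed initial value and slope, so its size is
  governed by the L1 norm of its density. The factor 4 is the length of (-2,2).\<close>

lemma state_in_bound:
  obtains C where "C \<ge> 0" "\<And>h x. L2_supp (-1) 1 h \<Longrightarrow> \<bar>state_in h x\<bar> \<le> C + 4 * (LINT x|lebesgue. \<bar>h x\<bar>)"
proof -
  define C where "C = \<bar>p\<bar> + 4 * \<bar>q\<bar> + 4 * (LINT x|lebesgue. \<bar>w0 x\<bar>)"
  have "0 \<le> (LINT x|lebesgue. \<bar>w0 x\<bar>)" by (rule integral_nonneg_AE) simp
  then have C: "C \<ge> 0" by (simp add: C_def)
  have "\<bar>state_in h x\<bar> \<le> C + 4 * (LINT x|lebesgue. \<bar>h x\<bar>)" if h: "L2_supp (-1) 1 h" for h x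
  proof (cases "x \<in> {-1<..<1}")
    case True
    then have x: "x \<in> {-2..2}" by auto
    have "\<bar>q * (x + 2)\<bar> \<le> \<bar>q\<bar> * 4"
      unfolding abs_mult using x by (intro mult_left_mono) auto
    then have "\<bar>base x\<bar> \<le> C"
      using prim2_bound[OF w0(1) x] by (simp add: base_def C_def)
    then show ?thesis
      using prim2_le_4[OF h x] True by (simp add: state_in_def)
  next
    case False
    have "0 \<le> (LINT x|lebesgue. \<bar>h x\<bar>)" by (rule integral_nonneg_AE) simp
    then show ?thesis using False C by (simp add: state_in_def)
  qed
  with C show thesis by (rule that)
qed

text \<open>The load grows linearly with the L2 norm of \<open>h\<close>, so by Young's inequality
  half of the bending term absorbs it; the other half is left for compactness.\<close>

lemma load_le:
  obtains K where "\<And>h. L2_supp (-1) 1 h \<Longrightarrow> load h \<le> \<gamma> / 2 * (LINT x|lebesgue. (h x)\<^sup>2) + K"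
proof -
  obtain C where C: "C \<ge> 0" "\<And>h x. L2_supp (-1) 1 h \<Longrightarrow> \<bar>state_in h x\<bar> \<le> C + 4 * (LINT x|lebesgue. \<bar>h x\<bar>)"
    using state_in_bound by blast
  define k where "k = (LINT x|lebesgue. \<bar>force_in x\<bar>)"
  have "load h \<le> \<gamma> / 2 * (LINT x|lebesgue. (h x)\<^sup>2) + (k * C + 16 * k\<^sup>2 / \<gamma>)" if h: "L2_supp (-1) 1 h" for h
  proof -
    define s where "s = (LINT x|lebesgue. \<bar>h x\<bar>)"
    have "load h \<le> (LINT x|lebesgue. \<bar>force_in x\<bar> * (C + 4 * s))"
      unfolding load_eq
    proof (rule integral_mono)
      show "integrable lebesgue (\<lambda>x. force_in x * state_in h x)"
        by (rule L2_supp_mult[OF force_in_L2 state_in_L2[OF h]])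
      show "integrable lebesgue (\<lambda>x. \<bar>force_in x\<bar> * (C + 4 * s))"
        using L2_supp_integrable[OF L2_supp_abs[OF force_in_L2]] by simp
      show "force_in x * state_in h x \<le> \<bar>force_in x\<bar> * (C + 4 * s)" for x
      proof -
        have "\<bar>force_in x\<bar> * \<bar>state_in h x\<bar> \<le> \<bar>force_in x\<bar> * (C + 4 * s)"
          using C(2)[OF h, of x] by (intro mult_left_mono) (auto simp: s_def)
        then show ?thesis using abs_ge_self[of "force_in x * state_in h x"] by (simp add: abs_mult)
      qed
    qed
    also have "\<dots> = k * (C + 4 * s)" by (simp add: k_def)
    also have "\<dots> = k * C + 4 * k * s" by (simp add: algebra_simps)
    \<comment> \<open>The square \<open>\<gamma> / 4 * (s - 8 * k / \<gamma>)\<^sup>2\<close> is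
      nonnegative. The coefficient \<open>\<gamma> / 4\<close> becomes \<open>\<gamma> / 2\<close>
      below, since \<open>s\<^sup>2\<close> is at most twice the squared L2 norm, 2 being the length
      of (-1,1).\<close>
    also have "4 * k * s \<le> \<gamma> / 4 * s\<^sup>2 + 16 * k\<^sup>2 / \<gamma>"
    proof -
      have "0 \<le> \<gamma> / 4 * (s - 8 * k / \<gamma>)\<^sup>2" using \<gamma> by simp
      also have "\<dots> = \<gamma> / 4 * s\<^sup>2 + 16 * k\<^sup>2 / \<gamma> - 4 * k * s"
        using \<gamma> by (simp add: power2_eq_square field_simps)
      finally show ?thesis by simp
    qed
    also have "\<gamma> / 4 * s\<^sup>2 \<le> \<gamma> / 4 * (2 * (LINT x|lebesgue. (h x)\<^sup>2))"
      using L2_supp_L1_le[OF _ h] \<gamma> by (intro mult_left_mono) (auto simp: s_def)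
    finally show ?thesis by simp
  qed
  then show thesis by (rule that)
qed

text \<open>Dominated convergence; the L1 bound \<open>S\<close> on the densities bounds the states
  uniformly.\<close>

lemma load_tendsto:
  assumes h: "\<And>n. L2_supp (-1) 1 (h n)" and H: "L2_supp (-1) 1 H"
    and S: "\<And>n. (LINT x|lebesgue. \<bar>h n x\<bar>) \<le> S"
    and lim: "\<And>x. x \<in> {-2..2} \<Longrightarrow> (\<lambda>n. prim2 (-2) (h n) x) \<longlonglongrightarrow> prim2 (-2) H x"
  shows "(\<lambda>n. load (h n)) \<longlonglongrightarrow> load H"
proof -
  obtain C where "C \<ge> 0" and C: "\<And>h x. L2_supp (-1) 1 h \<Longrightarrow> \<bar>state_in h x\<bar> \<le> C + 4 * (LINT x|lebesgue. \<bar>h x\<bar>)"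
    using state_in_bound by blast
  show ?thesis
    unfolding load_eq
  proof (rule integral_dominated_convergence[where w = "\<lambda>x. \<bar>force_in x\<bar> * (C + 4 * S)"])
    show "(\<lambda>x. force_in x * state_in H x) \<in> borel_measurable lebesgue"
      "(\<lambda>x. force_in x * state_in (h n) x) \<in> borel_measurable lebesgue" for n
      using L2_supp_mult[OF force_in_L2 state_in_L2[OF H]] L2_supp_mult[OF force_in_L2 state_in_L2[OF h]] by auto
    show "integrable lebesgue (\<lambda>x. \<bar>force_in x\<bar> * (C + 4 * S))"
      using L2_supp_integrable[OF L2_supp_abs[OF force_in_L2]] by simp
    show "AE x in lebesgue. (\<lambda>n. force_in x * state_in (h n) x) \<longlonglongrightarrow> force_in x * state_in H x"
    proof (rule AE_I2)
      fix x
      show "(\<lambda>n. force_in x * state_in (h n) x) \<longlonglongrightarrow> force_in x * state_in H x"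
        unfolding state_in_def by (cases "x \<in> {-1<..<1}") (auto intro!: tendsto_intros lim)
    qed
    show "AE x in lebesgue. norm (force_in x * state_in (h n) x) \<le> \<bar>force_in x\<bar> * (C + 4 * S)" for n
    proof (rule AE_I2)
      fix x
      have "\<bar>state_in (h n) x\<bar> \<le> C + 4 * S" using C[OF h[of n], of x] S[of n] by linarith
      then show "norm (force_in x * state_in (h n) x) \<le> \<bar>force_in x\<bar> * (C + 4 * S)"
        by (simp add: abs_mult mult_left_mono)
    qed
  qed
qed

text \<open>Inside (-1,1) the steps are \<open>fidelity\<close> plus \<open>fr / (2 * \<mu>)\<close>
  up to bounded double primitives; outside they are determined by \<open>w\<close>,
  \<open>base\<close> and the double primitive of \<open>g\<close>. This bounds them in L2 before
  anything is known about their coefficients. In the constant, the double primitives of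
  \<open>g\<close> and \<open>h\<close> are each at most 4 times an L1 norm
  \<open>sqrt (2 * C)\<close>, and the factor 4 of the square is the length of (-2,2).\<close>

lemma steps_square_integral_bounded:
  assumes g: "L2_supp (-1) 1 g" "(LINT x|lebesgue. (g x)\<^sup>2) \<le> C" and h: "L2_supp (-1) 1 h" "(LINT x|lebesgue. (h x)\<^sup>2) \<le> C"
    and s: "finite I" "\<And>i. i \<in> I \<Longrightarrow> t i \<in> {-1..1}"
    and w: "L2_supp (-2) 2 w2" "\<And>x. x \<in> {-2<..<2} \<Longrightarrow> w x = p + q * (x + 2) + prim2 (-2) w2 x"
    and bd: "boundary g (steps I t a b)"
    and f: "(LINT x|lebesgue. (fidelity g h (steps I t a b) x)\<^sup>2) \<le> C"
  shows "(LINT x|lebesgue. (indicator {-2<..<2} x * steps I t a b x)\<^sup>2) \<le>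
    3 * (C + 4 * (8 * sqrt (2 * C) + 4 * (LINT x|lebesgue. \<bar>w2 x\<bar>) + 4 * (LINT x|lebesgue. \<bar>w0 x\<bar>))\<^sup>2
      + (LINT x|lebesgue. (1 / (2 * \<mu>) * (indicator {-1<..<1} x * fr x))\<^sup>2))"
proof -
  let ?s = "steps I t a b"
  define B where "B = 8 * sqrt (2 * C) + 4 * (LINT x|lebesgue. \<bar>w2 x\<bar>) + 4 * (LINT x|lebesgue. \<bar>w0 x\<bar>)"
  define \<phi> where "\<phi> x = 1 / (2 * \<mu>) * (indicator {-1<..<1} x * fr x)" for x
  have sq: "(LINT x|lebesgue. \<bar>k x\<bar>) \<le> sqrt (2 * C)" if k: "L2_supp (-1) 1 k" "(LINT x|lebesgue. (k x)\<^sup>2) \<le> C" for k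
  proof (rule real_le_rsqrt)
    have "(LINT x|lebesgue. \<bar>k x\<bar>)\<^sup>2 \<le> 2 * (LINT x|lebesgue. (k x)\<^sup>2)" using L2_supp_L1_le[OF _ k(1)] by simp
    then show "(LINT x|lebesgue. \<bar>k x\<bar>)\<^sup>2 \<le> 2 * C" using k(2) by simp
  qed
  have P: "\<bar>prim2 (-2) g x\<bar> \<le> 4 * sqrt (2 * C)" "\<bar>prim2 (-2) h x\<bar> \<le> 4 * sqrt (2 * C)"
    "\<bar>prim2 (-2) w2 x\<bar> \<le> 4 * (LINT x|lebesgue. \<bar>w2 x\<bar>)" "\<bar>prim2 (-2) w0 x\<bar> \<le> 4 * (LINT x|lebesgue. \<bar>w0 x\<bar>)"
    if "x \<in> {-2..2}" for x
    using prim2_le_4[OF g(1) that] prim2_le_4[OF h(1) that] sq[OF g] sq[OF h] prim2_bound[OF w(1) that]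
      prim2_bound[OF w0(1) that] by auto
  have fL: "L2_supp (-1) 1 (fidelity g h ?s)"
  proof (rule fidelity_L2[OF g(1) h(1)])
    have "?s \<in> L2 (-1) 1 " by (rule steps_L2[OF s(1)]) (use s(2) in auto)
    then show "?s \<in> L2 (-1) 1" .
  qed
  have \<phi>L: "L2_supp (-1) 1 \<phi>" unfolding \<phi>_def[abs_def] by (intro L2_supp_cmult L2_supp_restrict fr)
  have sL: "L2_supp (-2) 2 (\<lambda>x. indicator {-2<..<2} x * ?s x)"
    by (intro L2_supp_restrict steps_L2[OF s(1)]) (use s(2) in force)
  have ae: "AE x in lebesgue. (indicator {-2<..<2} x * ?s x)\<^sup>2 \<le>
      3 * ((fidelity g h ?s x)\<^sup>2 + B\<^sup>2 * indicator {-2<..<2} x + (\<phi> x)\<^sup>2)"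
  proof -
    have "AE x in lebesgue. x \<notin> {-1, 1::real}" by (rule AE_notin_finite) simp
    moreover have "AE x in lebesgue. x \<in> {-2<..<-1} \<union> {1<..<2} \<longrightarrow> base x + prim2 (-2) g x + ?s x = w x"
      using bd by (simp add: boundary_def)
    ultimately show ?thesis
    proof eventually_elim
      case (elim x)
      \<comment> \<open>Convexity of the square, for the splitting of \<open>u\<close> into
        \<open>a\<close>, \<open>c\<close> and a remainder of size at most \<open>B\<close>.\<close>
      have three: "u\<^sup>2 \<le> 3 * (a\<^sup>2 + B\<^sup>2 + c\<^sup>2)" if "\<bar>u - a - c\<bar> \<le> B" for u a c :: real
      proof -
        define d where "d = u - a - c"
        have dB: "d\<^sup>2 \<le> B\<^sup>2" using that by (simp add: d_def abs_le_square_iff[symmetric])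
        have "u = a + d + c" by (simp add: d_def)
        moreover have "(a + d + c)\<^sup>2 \<le> 3 * (a\<^sup>2 + d\<^sup>2 + c\<^sup>2)"
          using sum_squares_ge_zero[of "a - d" "d - c"] zero_le_square[of "a - c"]
          by (simp add: power2_eq_square algebra_simps)
        ultimately have "u\<^sup>2 \<le> 3 * (a\<^sup>2 + d\<^sup>2 + c\<^sup>2)" by simp
        also have "\<dots> \<le> 3 * (a\<^sup>2 + B\<^sup>2 + c\<^sup>2)" using dB by simp
        finally show ?thesis .
      qed
      show ?case
      proof (cases "x \<in> {-2<..<2}")
        case True
        then have x: "x \<in> {-2..2}" by auto
        have "\<bar>?s x - fidelity g h ?s x - \<phi> x\<bar> \<le> B"
        proof (cases "x \<in> {-1<..<1}")
          case True
          then have "?s x - fidelity g h ?s x - \<phi> x = prim2 (-2) h x - prim2 (-2) g x"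
            by (simp add: fidelity_def \<phi>_def)
          moreover have "0 \<le> (LINT x|lebesgue. \<bar>w2 x\<bar>)" "0 \<le> (LINT x|lebesgue. \<bar>w0 x\<bar>)"
            by (rule integral_nonneg_AE, simp)+
          ultimately show ?thesis using P[OF x] unfolding B_def by linarith
        next
          case False
          then have "x \<in> {-2<..<-1} \<union> {1<..<2}" using True elim(1) by auto
          then have "base x + prim2 (-2) g x + ?s x = w x" using elim(2) by blast
          then have "?s x = prim2 (-2) w2 x - prim2 (-2) w0 x - prim2 (-2) g x"
            using w(2)[OF True] by (simp add: base_def)
          moreover have "fidelity g h ?s x = 0" "\<phi> x = 0" using False by (auto simp: fidelity_def \<phi>_def)
          ultimately show ?thesis using P[OF x] unfolding B_def by linarith
        qed
        from three[OF this] show ?thesis using True by simp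
      qed (simp add: sq_nonneg)
    qed
  qed
  have i: "integrable lebesgue (\<lambda>x. (fidelity g h ?s x)\<^sup>2)" "integrable lebesgue (\<lambda>x. (\<phi> x)\<^sup>2)"
    "integrable lebesgue (indicator {-2<..<2} :: real \<Rightarrow> real)"
    using fL \<phi>L L2_supp_integrable[OF L2_supp_indicator] by (auto simp: L2_supp_def)
  have "(LINT x|lebesgue. (indicator {-2<..<2} x * ?s x)\<^sup>2) \<le>
      (LINT x|lebesgue. 3 * ((fidelity g h ?s x)\<^sup>2 + B\<^sup>2 * indicator {-2<..<2} x + (\<phi> x)\<^sup>2))"
    by (rule integral_mono_AE[OF _ _ ae]) (use sL i in \<open>auto simp: L2_supp_def\<close>)
  also have "\<dots> = 3 * ((LINT x|lebesgue. (fidelity g h ?s x)\<^sup>2) + B\<^sup>2 * 4 + (LINT x|lebesgue. (\<phi> x)\<^sup>2))"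
    using i by simp
  also have "\<dots> \<le> 3 * (C + B\<^sup>2 * 4 + (LINT x|lebesgue. (\<phi> x)\<^sup>2))" using f by simp
  finally show ?thesis by (simp add: B_def \<phi>_def mult.commute)
qed

text \<open>The direct method. Competitors carry only nontrivial coefficients, so each point costs
  at least \<open>\<beta>\<close> and their number is bounded along a minimizing sequence. The index
  set \<open>J\<close> of the minimizer comes from merging, so its points are distinct, as
  \<open>energy_admissible\<close> requires.\<close>

lemma energy_minimizer:
  assumes w: "L2_supp (-2) 2 w2" "\<And>x. x \<in> {-2<..<2} \<Longrightarrow> w x = p + q * (x + 2) + prim2 (-2) w2 x"
    and start: "boundary g0 (\<lambda>_. 0)"
  obtains G H J \<tau> A B where "boundary G (steps J \<tau> A B)" "boundary H (\<lambda>_. 0)" "finite J" "inj_on \<tau> J" "\<tau> ` J \<subseteq> {-1..1}"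
    "\<forall>g h I t a b. boundary g (steps I t a b) \<and> boundary h (\<lambda>_. 0) \<and> finite I \<and> t ` I \<subseteq> {-1..1} \<and>
      (\<forall>i\<in>I. a i \<noteq> 0 \<or> b i \<noteq> 0) \<longrightarrow>
      energy (\<Sum>i\<in>J. cost \<alpha> \<beta> (A i) (B i)) G H (steps J \<tau> A B) \<le>
      energy (\<Sum>i\<in>I. cost \<alpha> \<beta> (a i) (b i)) g h (steps I t a b)"
proof -
  define sq where "sq f = (LINT x|lebesgue. (f x)\<^sup>2)" for f :: "real \<Rightarrow> real"
  have sq0: "sq f \<ge> 0" for f unfolding sq_def by (rule sq_nonneg)
  define kr where "kr = (LINT x:{-1<..<1}|lebesgue. (fr x)\<^sup>2) / (4 * \<mu>)"
  have E: "energy \<kappa> g h s = \<kappa> + \<eta> * sq g + \<mu> * sq (fidelity g h s) + \<gamma> * sq h - load h - kr" for \<kappa> g h s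
    by (simp add: energy_def sq_def kr_def)
  obtain K where K: "\<And>h. L2_supp (-1) 1 h \<Longrightarrow> load h \<le> \<gamma> / 2 * sq h + K"
    using load_le unfolding sq_def by blast
  have low: "\<kappa> + \<eta> * sq g + \<mu> * sq (fidelity g h s) + \<gamma> / 2 * sq h - K - kr \<le> energy \<kappa> g h s" if "L2_supp (-1) 1 h" for \<kappa> g h s
    using K[OF that] by (simp add: E)
  define adm where "adm g h I t a b \<longleftrightarrow> boundary g (steps I t a b) \<and> boundary h (\<lambda>_. 0) \<and> finite I \<and> t ` I \<subseteq> {-1..1} \<and>
    (\<forall>i\<in>I. a i \<noteq> 0 \<or> b i \<noteq> 0)" for g h and I :: "nat set" and t a b :: "nat \<Rightarrow> real"
  define val where "val I a b g h t = energy (\<Sum>i\<in>I. cost \<alpha> \<beta> (a i) (b i)) g h (steps I t a b)"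
    for g h and I :: "nat set" and t a b :: "nat \<Rightarrow> real"
  define X where "X = {val I a b g h t |g h I t a b. adm g h I t a b}"
  define m where "m = Inf X"
  have cs: "0 \<le> (\<Sum>i\<in>I. cost \<alpha> \<beta> (a i) (b i))" for I :: "nat set" and a b
    by (intro sum_nonneg cost_nonneg \<beta>)
  have pos: "0 \<le> \<eta> * sq f" "0 \<le> \<mu> * sq f" "0 \<le> \<gamma> / 2 * sq f" for f using \<eta> \<mu> \<gamma> sq0 by auto
  have "- K - kr \<le> v" if v: "v \<in> X" for v
  proof -
    obtain g h I t a b where "adm g h I t a b" "v = val I a b g h t" using v by (auto simp: X_def)
    then have "L2_supp (-1) 1 h" "v = val I a b g h t" by (auto simp: adm_def boundary_def)
    with low[of h "\<Sum>i\<in>I. cost \<alpha> \<beta> (a i) (b i)" g "steps I t a b"] cs[where I = I and a = a and b = b] pos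
    show ?thesis unfolding val_def by (smt (verit))
  qed
  then have bdd: "bdd_below X" by (rule bdd_belowI)
  have "adm g0 g0 {} t a b" for t a b using start by (simp add: adm_def steps_def[abs_def])
  then have "val {} z z g0 g0 z \<in> X" for z unfolding X_def by blast
  then have ne: "X \<noteq> {}" by blast
  \<comment> \<open>Almost minimal energies are below \<open>m + 1\<close>; adding the constants of
    the lower bound \<open>low\<close> gives a common bound for the cost and the weighted squared
    norms. Dividing it by \<open>\<beta>\<close> bounds the number of points.\<close>
  define K2 where "K2 = m + 1 + K + kr"
  define N where "N = nat \<lceil>K2 / \<beta>\<rceil>"
  \<comment> \<open>After padding to \<open>N\<close> indices coefficients may vanish and points may
    coincide, so \<open>Q\<close> asks for neither nontriviality nor injectivity.\<close>
  define Q where "Q n g h t a b \<longleftrightarrow> boundary g (steps {..<N} t a b) \<and> boundary h (\<lambda>_. 0) \<and> (\<forall>i. t i \<in> {-1..1}) \<and>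
    val {..<N} a b g h t < m + 1 / Suc n" for n g h and t a b :: "nat \<Rightarrow> real"
  have "\<exists>g h t a b. Q n g h t a b" for n
  proof -
    have "Inf X < m + 1 / Suc n" by (simp add: m_def)
    then obtain v where v: "v \<in> X" "v < m + 1 / Suc n" using cInf_lessD[OF ne] by blast
    obtain g h I t a b where A: "adm g h I t a b" and vv: "v = val I a b g h t" using v(1) by (auto simp: X_def)
    have hL: "L2_supp (-1) 1 h" using A by (simp add: adm_def boundary_def)
    have "v < m + 1" using v(2) by (smt (verit) divide_le_eq_1_pos of_nat_0_less_iff of_nat_Suc of_nat_0_le_iff zero_less_Suc)
    then have "(\<Sum>i\<in>I. cost \<alpha> \<beta> (a i) (b i)) \<le> K2"
      using low[OF hL, of "\<Sum>i\<in>I. cost \<alpha> \<beta> (a i) (b i)" g "steps I t a b"] pos(1)[of g] pos(2)[of "fidelity g h (steps I t a b)"] pos(3)[of h]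
      by (simp add: vv val_def K2_def)
    moreover have "(\<Sum>i\<in>I. \<beta>) \<le> (\<Sum>i\<in>I. cost \<alpha> \<beta> (a i) (b i))"
      using A \<beta> by (intro sum_mono) (auto simp: adm_def cost_def)
    ultimately have "card I * \<beta> \<le> K2" by simp
    then have "card I \<le> K2 / \<beta>" using \<beta> by (simp add: pos_le_divide_eq)
    then have "card I \<le> N" unfolding N_def by linarith
    then obtain t' a' b' where "\<And>i. t' i \<in> {-1..1::real}" "steps {..<N} t' a' b' = steps I t a b"
      "(\<Sum>i<N. cost \<alpha> \<beta> (a' i) (b' i)) = (\<Sum>i\<in>I. cost \<alpha> \<beta> (a i) (b i))"
      using A steps_reindex[of I N t "-1" 1 a b \<alpha> \<beta>] by (auto simp: adm_def)
    then have "Q n g h t' a' b'" using A v(2) by (simp add: Q_def adm_def vv val_def)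
    then show ?thesis by blast
  qed
  then obtain g h t a b where Q: "\<And>n. Q n (g n) (h n) (t n) (a n) (b n)" by metis
  define \<kappa> where "\<kappa> n = (\<Sum>i<N. cost \<alpha> \<beta> (a n i) (b n i))" for n
  define s where "s n = steps {..<N} (t n) (a n) (b n)" for n
  define \<delta> where "\<delta> n = fidelity (g n) (h n) (s n)" for n
  have bd: "boundary (g n) (s n)" "boundary (h n) (\<lambda>_. 0)" and t: "t n i \<in> {-1..1}" for n i
    using Q[of n] by (auto simp: Q_def s_def)
  have gL: "L2_supp (-1) 1 (g n)" and hL: "L2_supp (-1) 1 (h n)" for n using bd[of n] by (auto simp: boundary_def)
  have en: "\<kappa> n + \<eta> * sq (g n) + \<mu> * sq (\<delta> n) + \<gamma> * sq (h n) - load (h n) - kr < m + 1 / Suc n" for n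
    using Q[of n] by (simp add: Q_def val_def E \<kappa>_def s_def \<delta>_def)
  have \<kappa>0: "\<kappa> n \<ge> 0" for n unfolding \<kappa>_def by (rule cs)
  have K2: "\<kappa> n + \<eta> * sq (g n) + \<mu> * sq (\<delta> n) + \<gamma> / 2 * sq (h n) \<le> K2" for n
  proof -
    have "1 / real (Suc n) \<le> 1" by simp
    then show ?thesis using low[OF hL, of "\<kappa> n" "g n" n "s n"] en[of n] unfolding E K2_def \<delta>_def[symmetric] by linarith
  qed
  define C where "C = Max {K2 / \<eta>, K2 / \<mu>, 2 * K2 / \<gamma>, K2}"
  have CI: "x \<le> C" if "x \<in> {K2 / \<eta>, K2 / \<mu>, 2 * K2 / \<gamma>, K2}" for x unfolding C_def by (rule Max_ge) (use that in auto)
  have \<kappa>C: "\<kappa> n \<le> C" and gC: "sq (g n) \<le> C" and \<delta>C: "sq (\<delta> n) \<le> C" and hC: "sq (h n) \<le> C" for n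
  proof -
    note 1 = K2[of n] \<kappa>0[of n] pos(1)[of "g n"] pos(2)[of "\<delta> n"] pos(3)[of "h n"]
    have "\<kappa> n \<le> K2" using 1 by linarith
    then show "\<kappa> n \<le> C" using CI[of K2] by simp
    have "\<eta> * sq (g n) \<le> K2" using 1 by linarith
    then have "sq (g n) \<le> K2 / \<eta>" using \<eta> by (simp add: pos_le_divide_eq mult.commute)
    then show "sq (g n) \<le> C" using CI[of "K2 / \<eta>"] by simp
    have "\<mu> * sq (\<delta> n) \<le> K2" using 1 by linarith
    then have "sq (\<delta> n) \<le> K2 / \<mu>" using \<mu> by (simp add: pos_le_divide_eq mult.commute)
    then show "sq (\<delta> n) \<le> C" using CI[of "K2 / \<mu>"] by simp
    have "\<gamma> / 2 * sq (h n) \<le> K2" using 1 by linarith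
    then have "sq (h n) \<le> 2 * K2 / \<gamma>" using \<gamma> by (simp add: pos_le_divide_eq mult.commute)
    then show "sq (h n) \<le> C" using CI[of "2 * K2 / \<gamma>"] by simp
  qed
  \<comment> \<open>All these bounded scalar sequences converge along one subsequence. The
    coefficients are not among them, as no bound on them is known.\<close>
  let ?S = "{\<kappa>, \<lambda>n. sq (g n), \<lambda>n. sq (\<delta> n), \<lambda>n. sq (h n)} \<union> (\<lambda>i n. t n i) ` {..<N}"
  obtain r1 :: "nat \<Rightarrow> nat" where r1: "strict_mono r1" "\<And>s. s \<in> ?S \<Longrightarrow> convergent (\<lambda>n. s (r1 n))"
  proof (rule finite_bounded_sequences_subseq[of ?S])
    have "\<bar>s n\<bar> \<le> max C 1" if "s \<in> ?S" for s n
      using that \<kappa>C[of n] gC[of n] \<delta>C[of n] hC[of n] \<kappa>0[of n] sq0[of "g n"] sq0[of "\<delta> n"] sq0[of "h n"] t[of n]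
      by (auto simp: le_max_iff_disj abs_of_nonneg) (auto simp: abs_le_iff)
    then show "bounded (range s)" if "s \<in> ?S" for s using that unfolding bounded_iff by (metis rangeE real_norm_def)
  qed auto
  obtain Lg Lh where Lg: "(\<lambda>n. sq (g (r1 n))) \<longlonglongrightarrow> Lg" and Lh: "(\<lambda>n. sq (h (r1 n))) \<longlonglongrightarrow> Lh"
    using r1(2)[of "\<lambda>n. sq (g n)"] r1(2)[of "\<lambda>n. sq (h n)"] by (auto simp: convergent_def)
  obtain L\<kappa> L\<delta> where L\<kappa>: "(\<lambda>n. \<kappa> (r1 n)) \<longlonglongrightarrow> L\<kappa>" and L\<delta>: "(\<lambda>n. sq (\<delta> (r1 n))) \<longlonglongrightarrow> L\<delta>"
    using r1(2)[of \<kappa>] r1(2)[of "\<lambda>n. sq (\<delta> n)"] by (auto simp: convergent_def)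
  define \<tau> where "\<tau> i = lim (\<lambda>n. t (r1 n) i)" for i
  have \<tau>1: "(\<lambda>n. t (r1 n) i) \<longlonglongrightarrow> \<tau> i" if "i < N" for i
    using r1(2)[of "\<lambda>n. t n i"] that unfolding \<tau>_def convergent_LIMSEQ_iff by blast
  have \<tau>b: "\<tau> i \<in> {-1..1}" if "i < N" for i
    using closed_sequentially[OF closed_real_atLeastAtMost _ \<tau>1[OF that]] t by blast
  \<comment> \<open>Compactness is used on (-2,2), because the boundary condition needs convergence
    of the double primitives up to 2. The support in (-1,1) is recovered from the last clauses of
    \<open>L2_weak_compact2\<close>.\<close>
  have G2: "L2_supp (-2) 2 (g (r1 n))" "L2_supp (-2) 2 (h (r1 n))" for n using gL hL by (auto intro: L2_supp_12)
  obtain r2 :: "nat \<Rightarrow> nat" and G H where r2: "strict_mono r2" and G: "L2_supp (-1) 1 G" "sq G \<le> Lg"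
    and H: "L2_supp (-1) 1 H" "sq H \<le> Lh"
    and pg: "\<And>x. x \<in> {-2..2} \<Longrightarrow> (\<lambda>n. prim2 (-2) (g (r1 (r2 n))) x) \<longlonglongrightarrow> prim2 (-2) G x"
    and ph: "\<And>x. x \<in> {-2..2} \<Longrightarrow> (\<lambda>n. prim2 (-2) (h (r1 (r2 n))) x) \<longlonglongrightarrow> prim2 (-2) H x"
  proof -
    have lt: "(-2::real) < 2" by simp
    obtain r2 :: "nat \<Rightarrow> nat" and G H where r2: "strict_mono r2" and GH: "(LINT x|lebesgue. (G x)\<^sup>2) \<le> Lg" "(LINT x|lebesgue. (H x)\<^sup>2) \<le> Lh"
      and p: "\<And>x. x \<in> {-2..2} \<Longrightarrow> (\<lambda>n. prim2 (-2) (g (r1 (r2 n))) x) \<longlonglongrightarrow> prim2 (-2) G x"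
        "\<And>x. x \<in> {-2..2} \<Longrightarrow> (\<lambda>n. prim2 (-2) (h (r1 (r2 n))) x) \<longlonglongrightarrow> prim2 (-2) H x"
      and S: "\<forall>c d. (\<forall>n. L2_supp c d (g (r1 n))) \<longrightarrow> L2_supp c d G" "\<forall>c d. (\<forall>n. L2_supp c d (h (r1 n))) \<longrightarrow> L2_supp c d H"
      by (rule L2_weak_compact2[OF lt G2 Lg[unfolded sq_def] Lh[unfolded sq_def]]) (assumption | rule that)+
    show thesis by (rule that[OF r2 S(1)[rule_format, OF gL] GH(1)[folded sq_def] S(2)[rule_format, OF hL] GH(2)[folded sq_def] p])
  qed
  have \<tau>2: "(\<lambda>n. t (r1 (r2 n)) i) \<longlonglongrightarrow> \<tau> i" if "i \<in> {..<N}" for i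
    using LIMSEQ_subseq_LIMSEQ[OF \<tau>1 r2, of i] that by (simp add: comp_def)
  have "\<exists>J t' a' b'. finite J \<and> J \<subseteq> {..<N} \<and> inj_on \<tau> J \<and> (\<forall>i\<in>J. (\<lambda>n. t' n i) \<longlonglongrightarrow> \<tau> i) \<and>
    (\<forall>n. (\<Sum>i\<in>J. cost \<alpha> \<beta> (a' n i) (b' n i)) \<le> \<kappa> (r1 (r2 n))) \<and>
    (\<forall>x. x \<notin> \<tau> ` {..<N} \<longrightarrow> (\<forall>\<^sub>F n in sequentially. steps J (t' n) (a' n) (b' n) x = s (r1 (r2 n)) x))"
    unfolding \<kappa>_def s_def by (rule merge_singular_points[OF \<beta> finite_lessThan \<tau>2])
  then obtain J t' a' b' where J: "finite J" "J \<subseteq> {..<N}" "inj_on \<tau> J" and M': "\<forall>i\<in>J. (\<lambda>n. t' n i) \<longlonglongrightarrow> \<tau> i"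
      "\<forall>n. (\<Sum>i\<in>J. cost \<alpha> \<beta> (a' n i) (b' n i)) \<le> \<kappa> (r1 (r2 n))"
      "\<forall>x. x \<notin> \<tau> ` {..<N} \<longrightarrow> (\<forall>\<^sub>F n in sequentially. steps J (t' n) (a' n) (b' n) x = s (r1 (r2 n)) x)"
    by (elim exE conjE) (rule that)
  have t': "\<And>i. i \<in> J \<Longrightarrow> (\<lambda>n. t' n i) \<longlonglongrightarrow> \<tau> i" using M'(1) by (rule bspec)
  have ck: "\<And>n. (\<Sum>i\<in>J. cost \<alpha> \<beta> (a' n i) (b' n i)) \<le> \<kappa> (r1 (r2 n))" using M'(2) by (rule spec)
  have st: "\<And>x. x \<notin> \<tau> ` {..<N} \<Longrightarrow> \<forall>\<^sub>F n in sequentially. steps J (t' n) (a' n) (b' n) x = s (r1 (r2 n)) x"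
    using M'(3) by simp
  have \<tau>J: "\<tau> ` J \<subseteq> {-1..1}" using J(2) \<tau>b by blast
  have aeN: "AE x in lebesgue. x \<notin> \<tau> ` {..<N}" by (rule AE_notin_finite) simp
  define D where "D = 3 * (C + 4 * (8 * sqrt (2 * C) + 4 * (LINT x|lebesgue. \<bar>w2 x\<bar>) + 4 * (LINT x|lebesgue. \<bar>w0 x\<bar>))\<^sup>2
      + (LINT x|lebesgue. (1 / (2 * \<mu>) * (indicator {-1<..<1} x * fr x))\<^sup>2))"
  define sI where "sI n x = indicator {-2<..<2} x * s (r1 (r2 n)) x" for n x
  have t2: "-1 \<le> t n i" "-2 \<le> t n i" for n i using t[of n i] by auto
  have sL2: "s n \<in> L2 (-2) 2" for n unfolding s_def by (rule steps_L2) (auto intro: t2)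
  have sI: "L2_supp (-2) 2 (sI n)" "sq (sI n) \<le> D" for n
  proof -
    show "L2_supp (-2) 2 (sI n)" unfolding sI_def[abs_def] by (rule L2_supp_restrict[OF sL2])
    show "sq (sI n) \<le> D"
      unfolding sq_def D_def sI_def s_def
      by (rule steps_square_integral_bounded[OF gL gC[unfolded sq_def] hL hC[unfolded sq_def] finite_lessThan t w
            bd(1)[unfolded s_def] \<delta>C[unfolded sq_def \<delta>_def s_def]])
  qed
  \<comment> \<open>The L2 bound is known for the original steps; at almost every point the merged
    ones eventually agree with them, which is what \<open>coefficients_subseq_convergent\<close>
    asks for.\<close>
  have ev: "AE x in lebesgue. x \<in> {-2<..<2} \<longrightarrow> (\<forall>\<^sub>F n in sequentially. steps J (t' n) (a' n) (b' n) x = sI n x)"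
    using aeN by (rule eventually_mono) (use st in \<open>simp add: sI_def\<close>)
  have \<tau>J2: "\<tau> ` J \<subseteq> {-2<..<2}" using \<tau>J by force
  obtain r3 :: "nat \<Rightarrow> nat" and A B where r3: "strict_mono r3"
    and A: "\<And>i. i \<in> J \<Longrightarrow> (\<lambda>n. a' (r3 n) i) \<longlonglongrightarrow> A i" and B: "\<And>i. i \<in> J \<Longrightarrow> (\<lambda>n. b' (r3 n) i) \<longlonglongrightarrow> B i"
    using coefficients_subseq_convergent[OF J(1,3) \<tau>J2 t' sI(1) sI(2)[unfolded sq_def] ev] by blast
  define \<psi> where "\<psi> n = r1 (r2 (r3 n))" for n
  have \<psi>r: "strict_mono (r2 \<circ> r3)" by (rule strict_mono_o[OF r2 r3])
  have sub: "(\<lambda>n. f (\<psi> n)) \<longlonglongrightarrow> L" if "(\<lambda>n. f (r1 n)) \<longlonglongrightarrow> L" for f :: "nat \<Rightarrow> real" and L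
    using LIMSEQ_subseq_LIMSEQ[OF that \<psi>r] by (simp add: comp_def \<psi>_def)
  have t3: "(\<lambda>n. t' (r3 n) i) \<longlonglongrightarrow> \<tau> i" if "i \<in> J" for i
    using LIMSEQ_subseq_LIMSEQ[OF t'[OF that] r3] by (simp add: comp_def)
  have pg3: "(\<lambda>n. prim2 (-2) (g (\<psi> n)) x) \<longlonglongrightarrow> prim2 (-2) G x"
    and ph3: "(\<lambda>n. prim2 (-2) (h (\<psi> n)) x) \<longlonglongrightarrow> prim2 (-2) H x" if "x \<in> {-2..2}" for x
    using LIMSEQ_subseq_LIMSEQ[OF pg[OF that] r3] LIMSEQ_subseq_LIMSEQ[OF ph[OF that] r3] by (simp_all add: comp_def \<psi>_def)
  have sl: "(\<lambda>n. s (\<psi> n) x) \<longlonglongrightarrow> steps J \<tau> A B x" if x: "x \<notin> \<tau> ` {..<N}" for x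
  proof (rule Lim_transform_eventually)
    show "(\<lambda>n. steps J (t' (r3 n)) (a' (r3 n)) (b' (r3 n)) x) \<longlonglongrightarrow> steps J \<tau> A B x"
      by (rule steps_tendsto[OF t3 A B]) (use x J(2) in auto)
    show "\<forall>\<^sub>F n in sequentially. steps J (t' (r3 n)) (a' (r3 n)) (b' (r3 n)) x = s (\<psi> n) x"
      using eventually_subseq[OF r3 st[OF x]] by (simp add: \<psi>_def)
  qed
  have bG: "boundary G (steps J \<tau> A B)"
    unfolding boundary_def
  proof (intro conjI G(1))
    have "AE x in lebesgue. \<forall>n. x \<in> {-2<..<-1} \<union> {1<..<2} \<longrightarrow> base x + prim2 (-2) (g (\<psi> n)) x + s (\<psi> n) x = w x"
      using bd(1) unfolding boundary_def by (subst AE_all_countable) blast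
    with aeN show "AE x in lebesgue. x \<in> {-2<..<-1} \<union> {1<..<2} \<longrightarrow> base x + prim2 (-2) G x + steps J \<tau> A B x = w x"
    proof eventually_elim
      case (elim x)
      show ?case
      proof
        assume x: "x \<in> {-2<..<-1} \<union> {1<..<2}"
        then have x': "x \<in> {-2..2}" by auto
        have "(\<lambda>n. base x + prim2 (-2) (g (\<psi> n)) x + s (\<psi> n) x) \<longlonglongrightarrow> base x + prim2 (-2) G x + steps J \<tau> A B x"
          by (intro tendsto_intros pg3[OF x'] sl[OF elim(1)])
        moreover have "(\<lambda>n. base x + prim2 (-2) (g (\<psi> n)) x + s (\<psi> n) x) = (\<lambda>_. w x)" using elim(2) x by blast
        ultimately show "base x + prim2 (-2) G x + steps J \<tau> A B x = w x" by (simp add: LIMSEQ_const_iff)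
      qed
    qed
  qed
  have bH: "boundary H (\<lambda>_. 0)"
    unfolding boundary_def
  proof (intro conjI H(1))
    have "AE x in lebesgue. \<forall>n. x \<in> {-2<..<-1} \<union> {1<..<2} \<longrightarrow> base x + prim2 (-2) (h (\<psi> n)) x + 0 = w x"
      using bd(2) unfolding boundary_def by (subst AE_all_countable) blast
    then show "AE x in lebesgue. x \<in> {-2<..<-1} \<union> {1<..<2} \<longrightarrow> base x + prim2 (-2) H x + 0 = w x"
    proof (rule eventually_mono, intro impI)
      fix x assume *: "\<forall>n. x \<in> {-2<..<-1} \<union> {1<..<2} \<longrightarrow> base x + prim2 (-2) (h (\<psi> n)) x + 0 = w x"
        and x: "x \<in> {-2<..<-1} \<union> {1<..<2}"
      then have x': "x \<in> {-2..2}" by auto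
      have "(\<lambda>n. base x + prim2 (-2) (h (\<psi> n)) x + 0) \<longlonglongrightarrow> base x + prim2 (-2) H x + 0"
        by (intro tendsto_intros ph3[OF x'])
      moreover have "(\<lambda>n. base x + prim2 (-2) (h (\<psi> n)) x + 0) = (\<lambda>_. w x)" using * x by blast
      ultimately show "base x + prim2 (-2) H x + 0 = w x" by (simp add: LIMSEQ_const_iff)
    qed
  qed
  have sJ: "steps J \<tau> A B \<in> L2 (-1) 1" by (rule steps_L2[OF J(1)]) (use \<tau>J in auto)
  have s1: "s n \<in> L2 (-1) 1" for n unfolding s_def by (rule steps_L2) (auto intro: t2)
  have lsc: "sq (fidelity G H (steps J \<tau> A B)) \<le> L\<delta>"
  proof -
    have fL: "L2_supp (-1) 1 (fidelity G H (steps J \<tau> A B))" by (rule fidelity_L2[OF G(1) H(1) sJ])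
    have \<delta>L: "L2_supp (-1) 1 (\<delta> n)" for n unfolding \<delta>_def by (rule fidelity_L2[OF gL hL s1])
    have lim: "AE x in lebesgue. (\<lambda>n. \<delta> (\<psi> n) x) \<longlonglongrightarrow> fidelity G H (steps J \<tau> A B) x"
    proof (rule eventually_mono[OF aeN])
      fix x assume x: "x \<notin> \<tau> ` {..<N}"
      show "(\<lambda>n. \<delta> (\<psi> n) x) \<longlonglongrightarrow> fidelity G H (steps J \<tau> A B) x"
        unfolding \<delta>_def fidelity_def
        by (cases "x \<in> {-1<..<1}") (auto intro!: tendsto_intros pg3 ph3 sl[OF x])
    qed
    have "sq (fidelity G H (steps J \<tau> A B)) \<le> L\<delta> + e" if "e > 0" for e
      unfolding sq_def
    proof (rule square_integral_le_of_AE_limit(2)[OF _ _ _ lim])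
      have "\<forall>\<^sub>F n in sequentially. sq (\<delta> (\<psi> n)) < L\<delta> + e"
        using sub[OF L\<delta>] that by (intro order_tendstoD) auto
      then show "\<forall>\<^sub>F n in sequentially. (LINT x|lebesgue. (\<delta> (\<psi> n) x)\<^sup>2) \<le> L\<delta> + e"
        by (rule eventually_mono) (simp add: sq_def)
    qed (use fL \<delta>L in \<open>auto simp: L2_supp_def\<close>)
    then show ?thesis by (rule field_le_epsilon)
  qed
  have lc: "(\<Sum>i\<in>J. cost \<alpha> \<beta> (A i) (B i)) \<le> L\<kappa>"
  proof (rule tendsto_lowerbound[OF sub[OF L\<kappa>]])
    have "\<forall>\<^sub>F n in sequentially. \<forall>i\<in>J. cost \<alpha> \<beta> (A i) (B i) \<le> cost \<alpha> \<beta> (a' (r3 n) i) (b' (r3 n) i)"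
      by (intro eventually_ball_finite J(1) ballI cost_lsc A B \<beta>(1,2))
    then show "\<forall>\<^sub>F n in sequentially. (\<Sum>i\<in>J. cost \<alpha> \<beta> (A i) (B i)) \<le> \<kappa> (\<psi> n)"
    proof (rule eventually_mono)
      fix n assume "\<forall>i\<in>J. cost \<alpha> \<beta> (A i) (B i) \<le> cost \<alpha> \<beta> (a' (r3 n) i) (b' (r3 n) i)"
      then have "(\<Sum>i\<in>J. cost \<alpha> \<beta> (A i) (B i)) \<le> (\<Sum>i\<in>J. cost \<alpha> \<beta> (a' (r3 n) i) (b' (r3 n) i))" by (intro sum_mono) auto
      then show "(\<Sum>i\<in>J. cost \<alpha> \<beta> (A i) (B i)) \<le> \<kappa> (\<psi> n)" using ck[of "r3 n"] by (simp add: \<psi>_def)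
    qed
  qed simp
  have hS: "(LINT x|lebesgue. \<bar>h n x\<bar>) \<le> sqrt (2 * C)" for n
  proof (rule real_le_rsqrt)
    have "(LINT x|lebesgue. \<bar>h n x\<bar>)\<^sup>2 \<le> 2 * sq (h n)" using L2_supp_L1_le[OF _ hL[of n]] by (simp add: sq_def)
    then show "(LINT x|lebesgue. \<bar>h n x\<bar>)\<^sup>2 \<le> 2 * C" using hC[of n] by simp
  qed
  have ll: "(\<lambda>n. load (h (\<psi> n))) \<longlonglongrightarrow> load H" by (rule load_tendsto[OF hL H(1) hS ph3])
  \<comment> \<open>The near-minimality \<open>en\<close> passes to the limit term by term; the
    limits of the cost and of the squared norms dominate the corresponding values at the limit
    functions.\<close>
  have "L\<kappa> + \<eta> * Lg + \<mu> * L\<delta> + \<gamma> * Lh - load H - kr \<le> m + 0"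
  proof (rule LIMSEQ_le)
    show "(\<lambda>n. \<kappa> (\<psi> n) + \<eta> * sq (g (\<psi> n)) + \<mu> * sq (\<delta> (\<psi> n)) + \<gamma> * sq (h (\<psi> n)) - load (h (\<psi> n)) - kr)
        \<longlonglongrightarrow> L\<kappa> + \<eta> * Lg + \<mu> * L\<delta> + \<gamma> * Lh - load H - kr"
      by (intro tendsto_intros ll sub[OF L\<kappa>] sub[OF Lg] sub[OF L\<delta>] sub[OF Lh])
    have "(\<lambda>n. 1 / real (Suc n)) \<longlonglongrightarrow> 0" using LIMSEQ_inverse_real_of_nat by (simp add: inverse_eq_divide)
    then have "(\<lambda>n. 1 / real (Suc (\<psi> n))) \<longlonglongrightarrow> 0"
      using LIMSEQ_subseq_LIMSEQ[OF _ strict_mono_o[OF r1(1) \<psi>r]] by (fastforce simp: comp_def \<psi>_def)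
    then show "(\<lambda>n. m + 1 / real (Suc (\<psi> n))) \<longlonglongrightarrow> m + 0" by (intro tendsto_intros)
    show "\<exists>N. \<forall>n\<ge>N. \<kappa> (\<psi> n) + \<eta> * sq (g (\<psi> n)) + \<mu> * sq (\<delta> (\<psi> n)) + \<gamma> * sq (h (\<psi> n)) - load (h (\<psi> n)) - kr
        \<le> m + 1 / real (Suc (\<psi> n))"
      using en less_imp_le by blast
  qed
  moreover have "\<eta> * sq G \<le> \<eta> * Lg" "\<gamma> * sq H \<le> \<gamma> * Lh" "\<mu> * sq (fidelity G H (steps J \<tau> A B)) \<le> \<mu> * L\<delta>"
    using G(2) H(2) lsc \<eta> \<gamma> \<mu> by (auto intro: mult_left_mono)
  ultimately have em: "energy (\<Sum>i\<in>J. cost \<alpha> \<beta> (A i) (B i)) G H (steps J \<tau> A B) \<le> m"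
    using lc unfolding E by linarith
  have "energy (\<Sum>i\<in>J. cost \<alpha> \<beta> (A i) (B i)) G H (steps J \<tau> A B) \<le> val I a b g h t"
    if "adm g h I t a b" for g h I t a b
  proof -
    have "val I a b g h t \<in> X" using that unfolding X_def by blast
    then have "m \<le> val I a b g h t" unfolding m_def using bdd by (rule cInf_lower)
    then show ?thesis using em by simp
  qed
  then show thesis
    unfolding adm_def val_def by (intro that[OF bG bH J(1,3) \<tau>J] allI impI)
qed

end

theorem theorem3p2:
  fixes w f\<^sub>r f\<^sub>p :: "real \<Rightarrow> real" and \<alpha> \<beta> \<eta> \<mu> \<gamma> :: real
  assumes "C2_on {-2..2} w"
    and "\<eta> > 0" and "\<mu> > 0" and "\<gamma> > 0"
    and "f\<^sub>r \<in> L2 (-1) 1" and "f\<^sub>p \<in> L2 (-1) 1"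
    and "0 < \<beta>" and "\<beta> \<le> \<alpha>" and "\<alpha> \<le> 2 * \<beta>"
  shows "\<exists>(v\<^sub>r, v\<^sub>p) \<in> admissible w.
           \<bar>F1 \<alpha> \<beta> \<eta> \<mu> \<gamma> f\<^sub>r f\<^sub>p v\<^sub>r v\<^sub>p\<bar> \<noteq> \<infinity> \<and>
           (\<forall>(u\<^sub>r, u\<^sub>p) \<in> admissible w.
              F1 \<alpha> \<beta> \<eta> \<mu> \<gamma> f\<^sub>r f\<^sub>p v\<^sub>r v\<^sub>p \<le> F1 \<alpha> \<beta> \<eta> \<mu> \<gamma> f\<^sub>r f\<^sub>p u\<^sub>r u\<^sub>p)"
proof -
  let ?z = "\<lambda>_::nat. 0::real"
  obtain p q w2 where w2: "L2_supp (-2) 2 w2"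
    and w: "\<And>x t c t' c'. x \<in> {-2..2} \<Longrightarrow> w x = pw_prim (-2) p (pw_prim (-2) q w2 {} t c) {} t' c' x"
    by (rule C2_on_pw_prim[OF assms(1)]) (simp | assumption | rule that)+
  \<comment> \<open>The second derivative of \<open>w\<close> is split at -1 and 1:
    \<open>w0\<close> is the prescribed outer part, \<open>w1\<close> the inner part, which
    competitors may change.\<close>
  define w1 w0 where "w1 x = indicator {-1<..<1} x * w2 x" and "w0 x = w2 x - w1 x" for x
  have w1: "L2_supp (-1) 1 w1" unfolding w1_def[abs_def] by (rule L2_supp_restrict[OF L2_supp_imp_L2[OF w2]])
  have w0: "L2_supp (-2) 2 w0" unfolding w0_def[abs_def] by (rule L2_supp_diff[OF w2 L2_supp_mono[OF w1]]) auto
  interpret fitting_problem \<alpha> \<beta> \<eta> \<mu> \<gamma> f\<^sub>r f\<^sub>p w w0 p q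
    by unfold_locales (use assms w0 in \<open>auto simp: w0_def w1_def\<close>)
  have wp: "w x = p + q * (x + 2) + prim2 (-2) w2 x" if "x \<in> {-2<..<2}" for x
    using pw_prim_eq_steps[OF w2, where I = "{}" and p = p and q = q and t = ?z and a = ?z and b = ?z]
      w[of x ?z ?z ?z ?z] that by (simp add: steps_def)
  have "prim2 (-2) w2 x = prim2 (-2) w0 x + prim2 (-2) w1 x" for x
    using prim2_add_w0[OF w1, of x] by (simp add: w0_def)
  \<comment> \<open>The pair \<open>(w, w)\<close> is a competitor without singular points, so the
    infimum is taken over a nonempty set.\<close>
  then have start: "boundary w1 (\<lambda>_. 0)"
    using w1 wp unfolding boundary_def by (auto simp: base_def intro!: AE_I2)
  obtain G H J \<tau> A B where GH: "boundary G (steps J \<tau> A B)" "boundary H (\<lambda>_. 0)" "finite J" "inj_on \<tau> J" "\<tau> ` J \<subseteq> {-1..1}"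
    and min: "\<forall>g h I t a b. boundary g (steps I t a b) \<and> boundary h (\<lambda>_. 0) \<and> finite I \<and> t ` I \<subseteq> {-1..1} \<and>
      (\<forall>i\<in>I. a i \<noteq> 0 \<or> b i \<noteq> 0) \<longrightarrow>
      energy (\<Sum>i\<in>J. cost \<alpha> \<beta> (A i) (B i)) G H (steps J \<tau> A B) \<le>
      energy (\<Sum>i\<in>I. cost \<alpha> \<beta> (a i) (b i)) g h (steps I t a b)"
    by (rule energy_minimizer[OF w2 wp start]) (assumption | rule that)+
  obtain vr vp where v: "(vr, vp) \<in> admissible w"
    "F1 \<alpha> \<beta> \<eta> \<mu> \<gamma> f\<^sub>r f\<^sub>p vr vp = ereal (energy (\<Sum>i\<in>J. cost \<alpha> \<beta> (A i) (B i)) G H (steps J \<tau> A B))"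
    using energy_admissible[OF GH] by blast
  have "F1 \<alpha> \<beta> \<eta> \<mu> \<gamma> f\<^sub>r f\<^sub>p vr vp \<le> F1 \<alpha> \<beta> \<eta> \<mu> \<gamma> f\<^sub>r f\<^sub>p ur up" if u: "(ur, up) \<in> admissible w" for ur up
  proof -
    have w': "w x = pw_prim (-2) p (pw_prim (-2) q w2 {} ?z ?z) {} ?z ?z x" if "x \<in> {-2<..<2}" for x
      using w[of x ?z ?z ?z ?z] that by simp
    have w02: "w0 x = w2 x" if "x \<in> {-2<..<-1} \<union> {1<..<2}" for x using that by (auto simp: w0_def w1_def)
    obtain g h I t a b where "boundary g (steps I t a b)" "boundary h (\<lambda>_. 0)" "finite I" "inj_on t I" "t ` I \<subseteq> {-1..1}"
      "\<forall>i\<in>I. a i \<noteq> 0 \<or> b i \<noteq> 0"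
      "F1 \<alpha> \<beta> \<eta> \<mu> \<gamma> f\<^sub>r f\<^sub>p ur up = ereal (energy (\<Sum>i\<in>I. cost \<alpha> \<beta> (a i) (b i)) g h (steps I t a b))"
      by (rule energy_of_admissible[OF w2 w' w02 u]) (assumption | rule that)+
    then show ?thesis using min[rule_format, of g I t a b h] v(2) by simp
  qed
  then show ?thesis using v by (intro bexI[of _ "(vr, vp)"]) auto
qed

end
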